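(* Let $N$ be a smooth connected manifold of dimension $n$ (Hausdorff, second countable, without boundary), let $m\ge 1$, and fix base points $*\in S^m$ and $*_1\neq *_2$ in $N$. For $i=1,2$ let $i'$ denote the other index ($\{i,i'\}=\{1,2\}$) and define $$\pi^c_m(N,*_i):=\{[f]\in\pi_m(N,*_i)\mid (f,*_{i'}) \text{ is loose}\},$$ $$\pi^{(2)}_m(N,*_i):=\{[f]\in\pi_m(N,*_i)\mid \exists\,[\overline f]\in\pi_m(N,*_{i'}) \text{ such that } (f,\overline f)\text{ is loose}\},$$ where $*_{i'}$ also denotes the constant map $S^m\to N$ with value $*_{i'}$. Then $\pi^c_m(N,*_i)\subset\pi^{(2)}_m(N,*_i)$ are subgroups of $\pi_m(N,*_i)$, and there is a well-defined group isomorphism $$c:\ \pi^{(2)}_m(N,*_1)/\pi^c_m(N,*_1)\longrightarrow \pi^{(2)}_m(N,*_2)/\pi^c_m(N,*_2)$$ which takes the coset of $[f]\in\pi^{(2)}_m(N,*_1)$ to the coset of any element $[\overline f]\in\pi^{(2)}_m(N,*_2)$ such that $(f,\overline f)$ is loose. A pair $([f_1],[f_2])\in\pi_m(N,*_1)\times\pi_m(N,*_2)$ is loose if and only if $[f_i]\in\pi^{(2)}_m(N,*_i)$ for $i=1,2$ and $c$ maps the coset of $[f_1]$ to the coset of $[f_2]$. In particular, if $\pi^c_m(N,*_i)=\pi_m(N,*_i)$ (for $i=1,2$), then all pairs of maps $f_1,f_2:S^m\to N$ (base point preserving or not) are loose; this is the case e.g. when $N$ is not compact or when $m<n$.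
   Context: For maps $f_1,f_2:M\to N$, the coincidence set is $C(f_1,f_2)=\{x\in M\mid f_1(x)=f_2(x)\}$. A pair $(f_1,f_2)$ of maps $S^m\to N$ is called loose if there are maps $f_1'\simeq f_1$, $f_2'\simeq f_2$ with $C(f_1',f_2')=\emptyset$. For based maps ($f_1( * )=*_1$, $f_2( * )=*_2$) it makes no difference whether the homotopies are required to be base point preserving or not. Looseness of a pair of based homotopy classes means looseness of a (any) pair of representatives. *)

theory Defs
  imports "HOL-Analysis.Analysis" "HOL-Algebra.Coset" "HOL-Algebra.Generated_Groups"
begin

fun iter_partial ::
  "'a::real_normed_vector list \<Rightarrow> ('a \<Rightarrow> 'b::real_normed_vector) \<Rightarrow> 'a \<Rightarrow> 'b" where
  "iter_partial [] f = f"
| "iter_partial (v # vs) f = (\<lambda>x. frechet_derivative (iter_partial vs f) (at x) v)"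

definition smooth_on :: "'a::euclidean_space set \<Rightarrow> ('a \<Rightarrow> 'b::real_normed_vector) \<Rightarrow> bool" where
  "smooth_on S f \<longleftrightarrow>
     (\<forall>vs. set vs \<subseteq> Basis \<longrightarrow> (\<forall>x\<in>S. iter_partial vs f differentiable (at x)))"

definition smooth_atlas :: "'a topology \<Rightarrow> ('a set \<times> ('a \<Rightarrow> real^'n)) set \<Rightarrow> bool" where
  "smooth_atlas N A \<longleftrightarrow>
     (\<forall>(U,\<phi>)\<in>A. openin N U \<and> open (\<phi> ` U) \<and>
                 homeomorphic_map (subtopology N U) (top_of_set (\<phi> ` U)) \<phi>) \<and>
     (\<Union>(fst ` A) = topspace N) \<and>
     (\<forall>(U,\<phi>)\<in>A. \<forall>(V,\<psi>)\<in>A. smooth_on (\<phi> ` (U \<inter> V)) (\<psi> \<circ> inv_into U \<phi>))"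

definition smooth_manifold :: "'a topology \<Rightarrow> 'n::finite itself \<Rightarrow> bool" where
  "smooth_manifold N _ \<longleftrightarrow> Hausdorff_space N \<and> second_countable N \<and>
     (\<exists>A :: ('a set \<times> ('a \<Rightarrow> real^'n)) set. smooth_atlas N A)"

text \<open>The cube I^m, with points represented as functions nat => real vanishing
  from coordinate m on, and its boundary. S^m is I^m / boundary, so maps
  S^m -> N are maps I^m -> N that are constant on the boundary.\<close>
definition cube :: "nat \<Rightarrow> (nat \<Rightarrow> real) set" where
  "cube m = {x. (\<forall>i<m. 0 \<le> x i \<and> x i \<le> 1) \<and> (\<forall>i\<ge>m. x i = 0)}"

definition cube_bd :: "nat \<Rightarrow> (nat \<Rightarrow> real) set" where
  "cube_bd m = {x \<in> cube m. \<exists>i<m. x i = 0 \<or> x i = 1}"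

definition sphere_maps :: "nat \<Rightarrow> 'a topology \<Rightarrow> ((nat \<Rightarrow> real) \<Rightarrow> 'a) set" where
  "sphere_maps m N = {g \<in> extensional (cube m).
      continuous_map (top_of_set (cube m)) N g \<and> (\<exists>c. \<forall>x\<in>cube_bd m. g x = c)}"

definition based_maps :: "nat \<Rightarrow> 'a topology \<Rightarrow> 'a \<Rightarrow> ((nat \<Rightarrow> real) \<Rightarrow> 'a) set" where
  "based_maps m N b = {g \<in> extensional (cube m).
      continuous_map (top_of_set (cube m)) N g \<and> (\<forall>x\<in>cube_bd m. g x = b)}"

definition free_htpc :: "nat \<Rightarrow> 'a topology \<Rightarrow> ((nat \<Rightarrow> real) \<Rightarrow> 'a) \<Rightarrow> ((nat \<Rightarrow> real) \<Rightarrow> 'a) \<Rightarrow> bool" where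
  "free_htpc m N f g \<longleftrightarrow>
     homotopic_with (\<lambda>k. \<exists>c. \<forall>x\<in>cube_bd m. k x = c) (top_of_set (cube m)) N f g"

definition htp_class :: "nat \<Rightarrow> 'a topology \<Rightarrow> 'a \<Rightarrow> ((nat \<Rightarrow> real) \<Rightarrow> 'a) \<Rightarrow> ((nat \<Rightarrow> real) \<Rightarrow> 'a) set" where
  "htp_class m N b f = {g \<in> based_maps m N b.
     homotopic_with (\<lambda>k. \<forall>x\<in>cube_bd m. k x = b) (top_of_set (cube m)) N f g}"

definition concat_cube :: "nat \<Rightarrow> ((nat \<Rightarrow> real) \<Rightarrow> 'a) \<Rightarrow> ((nat \<Rightarrow> real) \<Rightarrow> 'a) \<Rightarrow> (nat \<Rightarrow> real) \<Rightarrow> 'a" where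
  "concat_cube m f g = (\<lambda>x\<in>cube m. if x 0 \<le> 1/2 then f (x(0 := 2 * x 0))
                                      else g (x(0 := 2 * x 0 - 1)))"

definition homotopy_group :: "nat \<Rightarrow> 'a topology \<Rightarrow> 'a \<Rightarrow> ((nat \<Rightarrow> real) \<Rightarrow> 'a) set monoid" where
  "homotopy_group m N b =
     \<lparr>carrier = htp_class m N b ` based_maps m N b,
      mult = (\<lambda>A B. htp_class m N b (concat_cube m (SOME f. f \<in> A) (SOME g. g \<in> B))),
      one = htp_class m N b (\<lambda>x\<in>cube m. b)\<rparr>"

definition loose :: "nat \<Rightarrow> 'a topology \<Rightarrow> ((nat \<Rightarrow> real) \<Rightarrow> 'a) \<Rightarrow> ((nat \<Rightarrow> real) \<Rightarrow> 'a) \<Rightarrow> bool" where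
  "loose m N f1 f2 \<longleftrightarrow>
     (\<exists>f1' f2'. f1' \<in> sphere_maps m N \<and> f2' \<in> sphere_maps m N \<and>
        free_htpc m N f1 f1' \<and> free_htpc m N f2 f2' \<and>
        (\<forall>x\<in>cube m. f1' x \<noteq> f2' x))"

text \<open>Looseness of a pair of based homotopy classes: of a (any) pair of representatives.\<close>
definition loose_cls :: "nat \<Rightarrow> 'a topology \<Rightarrow> ((nat \<Rightarrow> real) \<Rightarrow> 'a) set \<Rightarrow> ((nat \<Rightarrow> real) \<Rightarrow> 'a) set \<Rightarrow> bool" where
  "loose_cls m N A B \<longleftrightarrow> (\<exists>f\<in>A. \<exists>g\<in>B. loose m N f g)"

definition pi_c :: "nat \<Rightarrow> 'a topology \<Rightarrow> 'a \<Rightarrow> 'a \<Rightarrow> ((nat \<Rightarrow> real) \<Rightarrow> 'a) set set" where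
  "pi_c m N b b' = {A \<in> carrier (homotopy_group m N b).
      loose_cls m N A {\<lambda>x\<in>cube m. b'}}"

definition pi_2 :: "nat \<Rightarrow> 'a topology \<Rightarrow> 'a \<Rightarrow> 'a \<Rightarrow> ((nat \<Rightarrow> real) \<Rightarrow> 'a) set set" where
  "pi_2 m N b b' = {A \<in> carrier (homotopy_group m N b).
      \<exists>B\<in>carrier (homotopy_group m N b'). loose_cls m N A B}"

end

theory Submission
  imports Defs "HOL-Complex_Analysis.Contour_Integration"
begin

text \<open>The pairs of classes that have pointwise disjoint \<^emph>\<open>based\<close> representatives visibly form
  a subgroup of \<open>\<pi>\<^sub>m(N,b\<^sub>1) \<times> \<pi>\<^sub>m(N,b\<^sub>2)\<close>, because concatenation and reversal preserve disjointness. For such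
  a subgroup all claims about \<open>\<pi>\<^sup>c\<close>, \<open>\<pi>\<^sup>(\<^sup>2\<^sup>)\<close> and \<open>c\<close> are Goursat's lemma, so the point is to make a disjoint
  pair \<open>(f', g')\<close> obtained by free homotopies based again. One transports \<open>f'\<close> and \<open>g'\<close> back along the tracks
  of their base points, inserted in a collar of the cube. In dimension at least 2 the base points can be moved
  one at a time, since a path can be pushed off a point. In dimension 1 this is impossible, but two open lines
  in \<open>N\<close> that meet have a line as their union unless \<open>N\<close> is a circle. So either every compact connected subset
  of \<open>N\<close> lies in a line, and all based maps are null homotopic, or \<open>N\<close> is a circle, where multiplication turns
  free homotopies into based ones and disjoint tracks are found by avoiding 1 with their quotient.

  The map \<open>f\<close> lies in \<open>\<pi>\<^sup>c\<close> as soon as it is homotopic to a map missing a point: this holds for compactness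
  reasons if \<open>N\<close> is not compact, and by polynomial approximation in a chart if \<open>m < n\<close>.\<close>

section \<open>The cube\<close>

lemma continuous_map_compose_continuous_on:
  assumes "continuous_map (top_of_set T) N f" "continuous_on S p" "\<And>x. x \<in> S \<Longrightarrow> p x \<in> T"
  shows "continuous_map (top_of_set S) N (\<lambda>x. f (p x))"
proof -
  have "continuous_map (top_of_set S) (top_of_set T) p"
    using assms by auto
  from continuous_map_compose[OF this assms(1)] show ?thesis by (simp add: o_def)
qed

lemma continuous_map_of_snd_on:
  "continuous_map (top_of_set T) N f \<Longrightarrow> continuous_map (top_of_set (S \<times> T)) N (\<lambda>z. f (snd z))"
  by (erule continuous_map_compose_continuous_on) (auto intro!: continuous_intros)

lemma continuous_map_cases_le_on:
  fixes p :: "'b::topological_space \<Rightarrow> real"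
  assumes p: "continuous_on S p"
    and f: "continuous_map (top_of_set {x \<in> S. p x \<le> c}) N f"
    and g: "continuous_map (top_of_set {x \<in> S. c \<le> p x}) N g"
    and "\<And>x. x \<in> S \<Longrightarrow> p x = c \<Longrightarrow> f x = g x"
  shows "continuous_map (top_of_set S) N (\<lambda>x. if p x \<le> c then f x else g x)"
proof (rule continuous_map_cases_le)
  have S: "S \<inter> {x \<in> S. p x \<le> c} = {x \<in> S. p x \<le> c}" "S \<inter> {x \<in> S. c \<le> p x} = {x \<in> S. c \<le> p x}"
    by auto
  show "continuous_map (subtopology (top_of_set S) {x \<in> topspace (top_of_set S). p x \<le> c}) N f"
    "continuous_map (subtopology (top_of_set S) {x \<in> topspace (top_of_set S). c \<le> p x}) N g"
    using f g by (simp_all add: subtopology_subtopology S)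
qed (use assms in auto)

lemma continuous_on_coord [continuous_intros]: "continuous_on S (\<lambda>x. x (i::nat) :: real)"
  by (rule continuous_on_product_then_coordinatewise) (rule continuous_on_id)

lemma continuous_on_snd_coord [continuous_intros]: "continuous_on S (\<lambda>x. snd x (i::nat) :: real)"
  by (rule continuous_on_product_then_coordinatewise) (intro continuous_on_snd continuous_on_id)

lemma continuous_on_fun_upd [continuous_intros]:
  assumes "continuous_on S f" "continuous_on S g"
  shows "continuous_on S (\<lambda>x. (f x)((i::nat) := (g x :: real)))"
proof (rule continuous_on_coordinatewise_then_product)
  fix j show "continuous_on S (\<lambda>x. ((f x)(i := g x)) j)"
    using assms by (cases "j = i") (auto intro: continuous_on_product_then_coordinatewise)
qed

lemma cube_eq_PiE: "cube m = PiE UNIV (\<lambda>i. if i < m then {0..1} else {0})"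
proof (intro equalityI subsetI)
  fix x assume "x \<in> cube m"
  then show "x \<in> PiE UNIV (\<lambda>i. if i < m then {0..1} else {0})"
    by (simp add: cube_def PiE_iff)
next
  fix x assume "x \<in> PiE UNIV (\<lambda>i. if i < m then {0..1::real} else {0})"
  then have x: "x i \<in> (if i < m then {0..1} else {0})" for i by (rule PiE_mem) simp
  show "x \<in> cube m"
    unfolding cube_def using x by (intro CollectI conjI allI impI) (force split: if_splits)+
qed

lemma compact_cube: "compact (cube m)"
proof -
  have "compactin (product_topology (\<lambda>i. euclideanreal) UNIV) (cube m)"
    unfolding cube_eq_PiE compactin_PiE by auto
  then show ?thesis by (simp add: euclidean_product_topology)
qed

lemma connected_cube: "connected (cube m)"
proof -
  have "connectedin (product_topology (\<lambda>i. euclideanreal) UNIV) (cube m)"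
    unfolding cube_eq_PiE connectedin_PiE by auto
  then show ?thesis by (simp add: euclidean_product_topology)
qed

lemma cube_bd_subset_cube: "cube_bd m \<subseteq> cube m"
  by (auto simp: cube_bd_def)

lemma zero_in_cube_bd: "m \<ge> 1 \<Longrightarrow> (\<lambda>_. 0) \<in> cube_bd m"
  by (auto simp: cube_bd_def cube_def intro!: exI[of _ 0])

lemma zero_in_cube: "(\<lambda>_. 0) \<in> cube m"
  by (simp add: cube_def)

lemma cube_coord_bounds: "m \<ge> 1 \<Longrightarrow> x \<in> cube m \<Longrightarrow> 0 \<le> x 0 \<and> x 0 \<le> 1"
  by (auto simp: cube_def)

lemma cube_upd: "m \<ge> 1 \<Longrightarrow> x \<in> cube m \<Longrightarrow> 0 \<le> s \<Longrightarrow> s \<le> 1 \<Longrightarrow> x(0 := s) \<in> cube m"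
  by (auto simp: cube_def)

lemma cube_bd_upd_end: "m \<ge> 1 \<Longrightarrow> x \<in> cube m \<Longrightarrow> s = 0 \<or> s = 1 \<Longrightarrow> x(0 := s) \<in> cube_bd m"
  by (auto simp: cube_def cube_bd_def)

lemma cube_bd_upd:
  assumes "m \<ge> 1" "x \<in> cube_bd m" "0 \<le> s" "s \<le> 1" "x 0 = 0 \<or> x 0 = 1 \<Longrightarrow> s = 0 \<or> s = 1"
  shows "x(0 := s) \<in> cube_bd m"
proof -
  obtain i where "i < m" "x i = 0 \<or> x i = 1" and "x \<in> cube m"
    using assms(2) by (auto simp: cube_bd_def)
  with assms show ?thesis unfolding cube_bd_def by (auto intro!: cube_upd exI[of _ i])
qed

definition cube_norm :: "nat \<Rightarrow> (nat \<Rightarrow> real) \<Rightarrow> real" where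
  "cube_norm m x = Max (insert 0 ((\<lambda>i. \<bar>2 * x i - 1\<bar>) ` {..<m}))"

lemma cube_norm_nonneg: "0 \<le> cube_norm m x"
  by (simp add: cube_norm_def)

lemma continuous_on_cube_norm: "continuous_on S (cube_norm m)"
proof (induction m)
  case 0
  show ?case by (simp add: cube_norm_def[abs_def])
next
  case (Suc m)
  have "cube_norm (Suc m) = (\<lambda>x. max \<bar>2 * x m - 1\<bar> (cube_norm m x))"
    by (rule ext) (simp add: cube_norm_def lessThan_Suc insert_commute[of 0])
  then show ?case using Suc by (auto intro!: continuous_intros)
qed

lemma mem_cube_iff: "x \<in> cube m \<longleftrightarrow> cube_norm m x \<le> 1 \<and> (\<forall>i\<ge>m. x i = 0)"
  by (auto simp: cube_def cube_norm_def abs_le_iff)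

lemma mem_cube_bd_iff: "x \<in> cube_bd m \<longleftrightarrow> cube_norm m x = 1 \<and> (\<forall>i\<ge>m. x i = 0)"
proof -
  have "\<bar>2 * x i - 1\<bar> = 1 \<longleftrightarrow> x i = 0 \<or> x i = 1" for i by auto
  moreover have "cube_norm m x = 1 \<longleftrightarrow> cube_norm m x \<le> 1 \<and> (\<exists>i<m. \<bar>2 * x i - 1\<bar> = 1)"
    unfolding cube_norm_def by (subst Max_eq_iff) auto
  ultimately show ?thesis by (auto simp: cube_bd_def mem_cube_iff)
qed

lemma compact_cube_bd: "compact (cube_bd m)"
proof -
  have "closed {x. cube_norm m x = 1}"
    by (intro closed_Collect_eq continuous_on_cube_norm continuous_on_const)
  moreover have "cube_bd m = cube m \<inter> {x. cube_norm m x = 1}"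
    by (auto simp: mem_cube_iff mem_cube_bd_iff)
  ultimately show ?thesis by (metis compact_Int_closed compact_cube)
qed

definition dilate_cube :: "nat \<Rightarrow> real \<Rightarrow> (nat \<Rightarrow> real) \<Rightarrow> nat \<Rightarrow> real" where
  "dilate_cube m a x = (\<lambda>i. if i < m then 1/2 + a * (x i - 1/2) else 0)"

lemma continuous_on_dilate_cube:
  assumes "continuous_on S a" "continuous_on S f"
  shows "continuous_on S (\<lambda>z. dilate_cube m (a z) (f z))"
proof (rule continuous_on_coordinatewise_then_product)
  show "continuous_on S (\<lambda>z. dilate_cube m (a z) (f z) i)" for i
    unfolding dilate_cube_def using assms
    by (cases "i < m") (auto intro!: continuous_intros intro: continuous_on_product_then_coordinatewise)
qed

lemma cube_norm_dilate:
  assumes "0 \<le> a"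
  shows "cube_norm m (dilate_cube m a x) = a * cube_norm m x"
proof -
  let ?S = "insert 0 ((\<lambda>i. \<bar>2 * x i - 1\<bar>) ` {..<m})"
  have "\<bar>2 * dilate_cube m a x i - 1\<bar> = a * \<bar>2 * x i - 1\<bar>" if "i < m" for i
  proof -
    have "2 * dilate_cube m a x i - 1 = a * (2 * x i - 1)"
      using that by (simp add: dilate_cube_def algebra_simps)
    then show ?thesis using assms by (simp add: abs_mult)
  qed
  then have "(\<lambda>i. \<bar>2 * dilate_cube m a x i - 1\<bar>) ` {..<m} = (\<lambda>s. a * s) ` (\<lambda>i. \<bar>2 * x i - 1\<bar>) ` {..<m}"
    unfolding image_image by (intro image_cong refl) simp
  then have "cube_norm m (dilate_cube m a x) = Max ((\<lambda>s. a * s) ` ?S)"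
    by (simp add: cube_norm_def)
  also have "\<dots> = a * Max ?S"
    using assms by (intro mono_Max_commute[symmetric]) (auto intro: monoI mult_left_mono)
  finally show ?thesis by (simp add: cube_norm_def)
qed

lemma dilate_in_cube: "0 \<le> a \<Longrightarrow> a * cube_norm m x \<le> 1 \<Longrightarrow> dilate_cube m a x \<in> cube m"
  unfolding mem_cube_iff by (simp add: cube_norm_dilate) (simp add: dilate_cube_def)

lemma dilate_in_cube_bd: "0 \<le> a \<Longrightarrow> a * cube_norm m x = 1 \<Longrightarrow> dilate_cube m a x \<in> cube_bd m"
  unfolding mem_cube_bd_iff by (simp add: cube_norm_dilate) (simp add: dilate_cube_def)

lemma dilate_cube_1: "x \<in> cube m \<Longrightarrow> dilate_cube m 1 x = x"
  by (rule ext) (simp add: dilate_cube_def cube_def)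

section \<open>Based and free homotopies\<close>

definition homotopy_along ::
  "nat \<Rightarrow> 'a topology \<Rightarrow> (real \<Rightarrow> 'a) \<Rightarrow> ((nat \<Rightarrow> real) \<Rightarrow> 'a) \<Rightarrow> ((nat \<Rightarrow> real) \<Rightarrow> 'a) \<Rightarrow> bool" where
  "homotopy_along m N \<gamma> f g \<longleftrightarrow>
     (\<exists>h. continuous_map (top_of_set ({0..1} \<times> cube m)) N h \<and>
        (\<forall>x\<in>cube m. h (0, x) = f x \<and> h (1, x) = g x) \<and>
        (\<forall>t\<in>{0..1}. \<forall>x\<in>cube_bd m. h (t, x) = \<gamma> t))"

definition based_htpc ::
  "nat \<Rightarrow> 'a topology \<Rightarrow> 'a \<Rightarrow> ((nat \<Rightarrow> real) \<Rightarrow> 'a) \<Rightarrow> ((nat \<Rightarrow> real) \<Rightarrow> 'a) \<Rightarrow> bool" where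
  "based_htpc m N b f g \<longleftrightarrow>
     homotopic_with (\<lambda>k. \<forall>x\<in>cube_bd m. k x = b) (top_of_set (cube m)) N f g"

lemma based_htpc_iff_homotopy_along: "based_htpc m N b f g \<longleftrightarrow> homotopy_along m N (\<lambda>_. b) f g"
proof -
  have bd: "(\<forall>x\<in>cube_bd m. h x = b) \<longleftrightarrow> (\<forall>x\<in>cube_bd m. k x = b)"
    if "\<And>x. x \<in> topspace (top_of_set (cube m)) \<Longrightarrow> h x = k x" for h k :: "(nat \<Rightarrow> real) \<Rightarrow> 'a"
    using that subsetD[OF cube_bd_subset_cube] by simp
  show ?thesis
    unfolding based_htpc_def homotopy_along_def
    by (subst homotopic_with[OF bd]) (simp_all add: ball_conj_distrib conj_assoc)
qed

lemma free_htpc_iff_homotopy_along: "free_htpc m N f g \<longleftrightarrow> (\<exists>\<gamma>. homotopy_along m N \<gamma> f g)"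
proof -
  have bd: "(\<exists>c. \<forall>x\<in>cube_bd m. h x = c) \<longleftrightarrow> (\<exists>c. \<forall>x\<in>cube_bd m. k x = c)"
    if "\<And>x. x \<in> topspace (top_of_set (cube m)) \<Longrightarrow> h x = k x" for h k :: "(nat \<Rightarrow> real) \<Rightarrow> 'a"
    using that subsetD[OF cube_bd_subset_cube] by simp
  have free: "free_htpc m N f g \<longleftrightarrow>
     (\<exists>h. continuous_map (top_of_set ({0..1::real} \<times> cube m)) N h \<and>
        (\<forall>x\<in>cube m. h (0, x) = f x \<and> h (1, x) = g x) \<and>
        (\<forall>t\<in>{0..1}. \<exists>c. \<forall>x\<in>cube_bd m. h (t, x) = c))"
    unfolding free_htpc_def
    by (subst homotopic_with[OF bd]) (simp_all add: ball_conj_distrib conj_assoc)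
  show ?thesis
  proof
    assume "free_htpc m N f g"
    then obtain h where h: "continuous_map (top_of_set ({0..1::real} \<times> cube m)) N h"
        "\<forall>x\<in>cube m. h (0, x) = f x \<and> h (1, x) = g x"
      and bd: "\<forall>t\<in>{0..1}. \<exists>c. \<forall>x\<in>cube_bd m. h (t, x) = c"
      unfolding free by (elim exE conjE)
    from bchoice[OF bd] obtain \<gamma> where "\<forall>t\<in>{0..1}. \<forall>x\<in>cube_bd m. h (t, x) = \<gamma> t" ..
    with h show "\<exists>\<gamma>. homotopy_along m N \<gamma> f g"
      unfolding homotopy_along_def by (intro exI conjI)
  next
    assume "\<exists>\<gamma>. homotopy_along m N \<gamma> f g"
    then obtain \<gamma> h where "continuous_map (top_of_set ({0..1::real} \<times> cube m)) N h"
        "\<forall>x\<in>cube m. h (0, x) = f x \<and> h (1, x) = g x" "\<forall>t\<in>{0..1}. \<forall>x\<in>cube_bd m. h (t, x) = \<gamma> t"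
      unfolding homotopy_along_def by (elim exE conjE)
    then show "free_htpc m N f g" unfolding free by (intro exI[of _ h] conjI) auto
  qed
qed

lemma free_htpc_trans: "free_htpc m N f g \<Longrightarrow> free_htpc m N g h \<Longrightarrow> free_htpc m N f h"
  unfolding free_htpc_def by (rule homotopic_with_trans)

lemma based_imp_free_htpc: "based_htpc m N b f g \<Longrightarrow> free_htpc m N f g"
  unfolding based_htpc_iff_homotopy_along free_htpc_iff_homotopy_along by blast

lemma based_htpc_sym: "based_htpc m N b f g \<Longrightarrow> based_htpc m N b g f"
  unfolding based_htpc_def by (rule homotopic_with_symD)

lemma based_htpc_trans [trans]: "based_htpc m N b f g \<Longrightarrow> based_htpc m N b g h \<Longrightarrow> based_htpc m N b f h"
  unfolding based_htpc_def by (rule homotopic_with_trans)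

lemma based_htpc_refl: "f \<in> based_maps m N b \<Longrightarrow> based_htpc m N b f f"
  unfolding based_htpc_def by (simp add: based_maps_def)

lemma based_htpc_cong:
  "(\<And>x. x \<in> cube m \<Longrightarrow> f x = f' x) \<Longrightarrow> (\<And>x. x \<in> cube m \<Longrightarrow> g x = g' x) \<Longrightarrow>
    based_htpc m N b f g \<longleftrightarrow> based_htpc m N b f' g'"
  unfolding based_htpc_iff_homotopy_along homotopy_along_def by (simp cong: conj_cong)

lemma based_maps_continuous:
  "f \<in> based_maps m N b \<Longrightarrow> continuous_map (top_of_set (cube m)) N f"
  by (simp add: based_maps_def)

lemma based_maps_bd: "f \<in> based_maps m N b \<Longrightarrow> x \<in> cube_bd m \<Longrightarrow> f x = b"
  by (simp add: based_maps_def)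

lemma restrict_in_based_maps:
  "continuous_map (top_of_set (cube m)) N f \<Longrightarrow> (\<And>x. x \<in> cube_bd m \<Longrightarrow> f x = b) \<Longrightarrow>
    restrict f (cube m) \<in> based_maps m N b"
  using cube_bd_subset_cube by (auto simp: based_maps_def intro: continuous_map_eq)

lemma based_maps_base_in_topspace:
  assumes "m \<ge> 1" "f \<in> based_maps m N b"
  shows "b \<in> topspace N"
  using based_maps_continuous[OF assms(2)] based_maps_bd[OF assms(2) zero_in_cube_bd[OF assms(1)]]
    zero_in_cube[of m] by (auto simp: continuous_map_def)

lemma compactin_based_map_image: "f \<in> based_maps m N b \<Longrightarrow> compactin N (f ` cube m)"
  by (rule image_compactin[OF _ based_maps_continuous]) (auto simp: compactin_subtopology compact_cube)

lemma connectedin_based_map_image: "f \<in> based_maps m N b \<Longrightarrow> connectedin N (f ` cube m)"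
  by (rule connectedin_continuous_map_image[OF based_maps_continuous])
    (auto simp: connectedin_subtopology connected_cube)

lemma const_in_based_maps: "b \<in> topspace N \<Longrightarrow> (\<lambda>x\<in>cube m. b) \<in> based_maps m N b"
  by (rule restrict_in_based_maps) auto

lemma based_map_in_sphere_maps: "f \<in> based_maps m N b \<Longrightarrow> f \<in> sphere_maps m N"
  by (auto simp: based_maps_def sphere_maps_def)

lemma sphere_maps_imp_based: "f \<in> sphere_maps m N \<Longrightarrow> \<exists>p. f \<in> based_maps m N p"
  by (auto simp: based_maps_def sphere_maps_def)

lemma homotopy_along_path:
  assumes m: "m \<ge> 1" and fg: "homotopy_along m N \<gamma> f g"
    and f: "f \<in> based_maps m N p" and g: "g \<in> based_maps m N q"
  shows "pathin N \<gamma>" "\<gamma> 0 = p" "\<gamma> 1 = q"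
proof -
  obtain h where h: "continuous_map (top_of_set ({0..1} \<times> cube m)) N h"
    and ends: "\<forall>x\<in>cube m. h (0, x) = f x \<and> h (1, x) = g x"
    and bd: "\<forall>t\<in>{0..1}. \<forall>x\<in>cube_bd m. h (t, x) = \<gamma> t"
    using fg unfolding homotopy_along_def by blast
  have "continuous_map (top_of_set {0..1::real}) N (\<lambda>t. h (t, \<lambda>_. 0))"
    by (rule continuous_map_compose_continuous_on[OF h]) (auto intro!: continuous_intros zero_in_cube)
  then show "pathin N \<gamma>"
    unfolding pathin_def using bd zero_in_cube_bd[OF m] by (auto intro: continuous_map_eq)
  show "\<gamma> 0 = p" "\<gamma> 1 = q"
    using bspec[OF ends zero_in_cube] bd zero_in_cube_bd[OF m] based_maps_bd[OF f] based_maps_bd[OF g]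
    by auto
qed

section \<open>The homotopy groups\<close>

lemma htp_class_eq: "htp_class m N b f = {g \<in> based_maps m N b. based_htpc m N b f g}"
  by (simp add: htp_class_def based_htpc_def)

lemma htp_class_self: "f \<in> based_maps m N b \<Longrightarrow> f \<in> htp_class m N b f"
  by (simp add: htp_class_eq based_htpc_refl)

lemma htp_class_eqI: "based_htpc m N b f g \<Longrightarrow> htp_class m N b f = htp_class m N b g"
  unfolding htp_class_eq by (intro Collect_cong conj_cong refl) (metis based_htpc_trans based_htpc_sym)

lemma homotopy_group_carrier:
  "carrier (homotopy_group m N b) = htp_class m N b ` based_maps m N b"
  by (simp add: homotopy_group_def)

lemma homotopy_group_one:
  "\<one>\<^bsub>homotopy_group m N b\<^esub> = htp_class m N b (\<lambda>x\<in>cube m. b)"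
  by (simp add: homotopy_group_def)

lemma htp_class_in_carrier:
  "f \<in> based_maps m N b \<Longrightarrow> htp_class m N b f \<in> carrier (homotopy_group m N b)"
  by (simp add: homotopy_group_carrier)

lemma carrier_memD:
  assumes "A \<in> carrier (homotopy_group m N b)" "f \<in> A"
  shows "f \<in> based_maps m N b" "A = htp_class m N b f"
proof -
  obtain g where "g \<in> based_maps m N b" and A: "A = htp_class m N b g"
    using assms by (auto simp: homotopy_group_carrier)
  then have "f \<in> based_maps m N b" "based_htpc m N b g f" using assms(2) by (simp_all add: htp_class_eq)
  then show "f \<in> based_maps m N b" "A = htp_class m N b f" unfolding A by (simp_all add: htp_class_eqI)
qed

lemma concat_cube_apply:
  "x \<in> cube m \<Longrightarrow>
    concat_cube m f g x = (if x 0 \<le> 1/2 then f (x(0 := 2 * x 0)) else g (x(0 := 2 * x 0 - 1)))"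
  by (simp add: concat_cube_def)

lemma concat_cube_bd:
  assumes m: "m \<ge> 1" and fg: "\<And>x. x \<in> cube_bd m \<Longrightarrow> f x = b \<and> g x = b" and x: "x \<in> cube_bd m"
  shows "concat_cube m f g x = b"
proof -
  have xc: "x \<in> cube m" using x cube_bd_subset_cube by blast
  have "x(0 := 2 * x 0) \<in> cube_bd m" if "x 0 \<le> 1/2"
    using cube_coord_bounds[OF m xc] that by (intro cube_bd_upd[OF m x]) auto
  moreover have "x(0 := 2 * x 0 - 1) \<in> cube_bd m" if "\<not> x 0 \<le> 1/2"
    using cube_coord_bounds[OF m xc] that by (intro cube_bd_upd[OF m x]) auto
  ultimately show ?thesis using fg by (simp add: concat_cube_apply[OF xc])
qed

lemma continuous_map_concat:
  fixes Z :: "'b::topological_space set"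
  assumes m: "m \<ge> 1"
    and f: "continuous_map (top_of_set (Z \<times> cube m)) N f"
    and g: "continuous_map (top_of_set (Z \<times> cube m)) N g"
    and bd: "\<And>z x. z \<in> Z \<Longrightarrow> x \<in> cube_bd m \<Longrightarrow> f (z, x) = b \<and> g (z, x) = b"
  shows "continuous_map (top_of_set (Z \<times> cube m)) N
     (\<lambda>p. concat_cube m (\<lambda>y. f (fst p, y)) (\<lambda>y. g (fst p, y)) (snd p))"
proof -
  let ?f = "\<lambda>p. f (fst p, (snd p)(0 := 2 * snd p 0))"
  let ?g = "\<lambda>p. g (fst p, (snd p)(0 := 2 * snd p 0 - 1))"
  have "continuous_map (top_of_set (Z \<times> cube m)) N (\<lambda>p. if snd p 0 \<le> 1/2 then ?f p else ?g p)"
  proof (rule continuous_map_cases_le_on)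
    show "continuous_map (top_of_set {p \<in> Z \<times> cube m. snd p 0 \<le> 1/2}) N ?f"
      by (rule continuous_map_compose_continuous_on[OF f])
        (intro continuous_intros, use cube_coord_bounds[OF m] in \<open>auto intro!: cube_upd[OF m]\<close>)
    show "continuous_map (top_of_set {p \<in> Z \<times> cube m. 1/2 \<le> snd p 0}) N ?g"
      by (rule continuous_map_compose_continuous_on[OF g])
        (intro continuous_intros, use cube_coord_bounds[OF m] in \<open>auto intro!: cube_upd[OF m]\<close>)
    fix p assume "p \<in> Z \<times> cube m" and half: "snd p 0 = 1/2"
    then have "fst p \<in> Z" "snd p \<in> cube m" by auto
    with bd cube_bd_upd_end[OF m \<open>snd p \<in> cube m\<close>] show "?f p = ?g p" by (simp add: half)
  qed (intro continuous_intros)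
  then show ?thesis by (rule continuous_map_eq) (auto simp: concat_cube_apply)
qed

lemma based_htpc_concat:
  assumes m: "m \<ge> 1" and "based_htpc m N b f f'" "based_htpc m N b g g'"
  shows "based_htpc m N b (concat_cube m f g) (concat_cube m f' g')"
proof -
  obtain h where h: "continuous_map (top_of_set ({0..1::real} \<times> cube m)) N h"
    "\<And>x. x \<in> cube m \<Longrightarrow> h (0, x) = f x \<and> h (1, x) = f' x"
    "\<And>t x. t \<in> {0..1} \<Longrightarrow> x \<in> cube_bd m \<Longrightarrow> h (t, x) = b"
    using assms(2) unfolding based_htpc_iff_homotopy_along homotopy_along_def by blast
  obtain k where k: "continuous_map (top_of_set ({0..1::real} \<times> cube m)) N k"
    "\<And>x. x \<in> cube m \<Longrightarrow> k (0, x) = g x \<and> k (1, x) = g' x"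
    "\<And>t x. t \<in> {0..1} \<Longrightarrow> x \<in> cube_bd m \<Longrightarrow> k (t, x) = b"
    using assms(3) unfolding based_htpc_iff_homotopy_along homotopy_along_def by blast
  let ?hk = "\<lambda>p. concat_cube m (\<lambda>y. h (fst p, y)) (\<lambda>y. k (fst p, y)) (snd p)"
  have "continuous_map (top_of_set ({0..1::real} \<times> cube m)) N ?hk"
    by (rule continuous_map_concat[OF m h(1) k(1)]) (use h(3) k(3) in auto)
  moreover have "?hk (0, x) = concat_cube m f g x \<and> ?hk (1, x) = concat_cube m f' g' x"
    if x: "x \<in> cube m" for x
    using cube_coord_bounds[OF m x] h(2) k(2) by (simp add: concat_cube_apply[OF x] cube_upd[OF m x])
  moreover have "?hk (t, x) = b" if "t \<in> {0..1}" "x \<in> cube_bd m" for t x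
    using h(3) k(3) that by (simp add: concat_cube_bd[OF m])
  ultimately show ?thesis
    unfolding based_htpc_iff_homotopy_along homotopy_along_def by (intro exI[of _ ?hk]) blast
qed

lemma concat_in_based_maps:
  assumes m: "m \<ge> 1" and f: "f \<in> based_maps m N b" and g: "g \<in> based_maps m N b"
  shows "concat_cube m f g \<in> based_maps m N b"
proof -
  have "continuous_map (top_of_set (cube m)) N (concat_cube m f g)"
    using based_htpc_concat[OF m based_htpc_refl[OF f] based_htpc_refl[OF g]]
      homotopic_with_imp_continuous_maps unfolding based_htpc_def by blast
  moreover have "concat_cube m f g x = b" if "x \<in> cube_bd m" for x
    using that by (simp add: concat_cube_bd[OF m] based_maps_bd[OF f] based_maps_bd[OF g])
  ultimately show ?thesis by (auto simp: based_maps_def concat_cube_def)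
qed

text \<open>All group laws of the homotopy group are instances of the next lemma: both sides are
  reparametrisations of one map in the first coordinate.\<close>

lemma based_htpc_reparam:
  assumes m: "m \<ge> 1" and f: "f \<in> based_maps m N b"
    and p: "continuous_on {0..1} p" "\<And>s. s \<in> {0..1} \<Longrightarrow> p s \<in> {0..1::real}"
    and q: "continuous_on {0..1} q" "\<And>s. s \<in> {0..1} \<Longrightarrow> q s \<in> {0..1::real}"
    and ends: "p 0 = q 0" "p 1 = q 1" "p 0 \<in> {0,1}" "p 1 \<in> {0,1}"
  shows "based_htpc m N b (\<lambda>x. f (x(0 := p (x 0)))) (\<lambda>x. f (x(0 := q (x 0))))"
proof -
  let ?r = "\<lambda>t s. (1 - t) * p s + t * q s"
  let ?h = "\<lambda>z. f ((snd z)(0 := ?r (fst z) (snd z 0)))"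
  have r: "0 \<le> ?r t s \<and> ?r t s \<le> 1" if "t \<in> {0..1}" "s \<in> {0..1}" for t s
    using convexD_alt[OF convex_real_interval(5), of "p s" 0 1 "q s" t] p(2) q(2) that by simp
  have "continuous_map (top_of_set ({0..1::real} \<times> cube m)) N ?h"
  proof (rule continuous_map_compose_continuous_on[OF based_maps_continuous[OF f]])
    have "continuous_on ({0..1::real} \<times> cube m) (\<lambda>z. p (snd z 0))"
      "continuous_on ({0..1::real} \<times> cube m) (\<lambda>z. q (snd z 0))"
      by (rule continuous_on_compose2[OF p(1) continuous_on_snd_coord],
          use cube_coord_bounds[OF m] in fastforce,
          rule continuous_on_compose2[OF q(1) continuous_on_snd_coord],
          use cube_coord_bounds[OF m] in fastforce)
    then show "continuous_on ({0..1} \<times> cube m) (\<lambda>z. (snd z)(0 := ?r (fst z) (snd z 0)))"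
      by (intro continuous_intros)
    show "(snd z)(0 := ?r (fst z) (snd z 0)) \<in> cube m" if "z \<in> {0..1} \<times> cube m" for z
      using that r[of "fst z" "snd z 0"] cube_coord_bounds[OF m, of "snd z"]
      by (intro cube_upd[OF m]) auto
  qed
  moreover have "?h (t, x) = b" if t: "t \<in> {0..1}" and x: "x \<in> cube_bd m" for t x
  proof -
    have "x \<in> cube m" using x cube_bd_subset_cube by blast
    then have "0 \<le> ?r t (x 0) \<and> ?r t (x 0) \<le> 1" using cube_coord_bounds[OF m] by (intro r[OF t]) auto
    moreover have "?r t (x 0) = 0 \<or> ?r t (x 0) = 1" if "x 0 = 0 \<or> x 0 = 1"
      using that ends by (auto simp: algebra_simps)
    ultimately have "x(0 := ?r t (x 0)) \<in> cube_bd m" by (intro cube_bd_upd[OF m x]) auto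
    then show ?thesis using based_maps_bd[OF f] by simp
  qed
  ultimately show ?thesis
    unfolding based_htpc_iff_homotopy_along homotopy_along_def by (intro exI[of _ ?h]) simp
qed

definition rev_cube :: "nat \<Rightarrow> ((nat \<Rightarrow> real) \<Rightarrow> 'a) \<Rightarrow> (nat \<Rightarrow> real) \<Rightarrow> 'a" where
  "rev_cube m f = (\<lambda>x\<in>cube m. f (x(0 := 1 - x 0)))"

lemma rev_in_based_maps:
  assumes m: "m \<ge> 1" and f: "f \<in> based_maps m N b"
  shows "rev_cube m f \<in> based_maps m N b"
  unfolding rev_cube_def
proof (rule restrict_in_based_maps)
  show "continuous_map (top_of_set (cube m)) N (\<lambda>x. f (x(0 := 1 - x 0)))"
    by (rule continuous_map_compose_continuous_on[OF based_maps_continuous[OF f]])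
      (intro continuous_intros, use cube_coord_bounds[OF m] in \<open>auto intro!: cube_upd[OF m]\<close>)
  fix x assume x: "x \<in> cube_bd m"
  then have "x \<in> cube m" using cube_bd_subset_cube by blast
  then have "x(0 := 1 - x 0) \<in> cube_bd m"
    using cube_coord_bounds[OF m] by (intro cube_bd_upd[OF m x]) auto
  then show "f (x(0 := 1 - x 0)) = b" by (rule based_maps_bd[OF f])
qed

lemma htp_class_mult:
  assumes m: "m \<ge> 1" and f: "f \<in> based_maps m N b" and g: "g \<in> based_maps m N b"
  shows "htp_class m N b f \<otimes>\<^bsub>homotopy_group m N b\<^esub> htp_class m N b g = htp_class m N b (concat_cube m f g)"
proof -
  have representative: "based_htpc m N b f (SOME k. k \<in> htp_class m N b f)" if "f \<in> based_maps m N b" for f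
    using someI[of "\<lambda>k. k \<in> htp_class m N b f", OF htp_class_self[OF that]] by (simp add: htp_class_eq)
  from htp_class_eqI[OF based_htpc_concat[OF m representative[OF f] representative[OF g]]]
  show ?thesis by (simp add: homotopy_group_def)
qed

lemma continuous_on_if_le:
  fixes p q :: "real \<Rightarrow> real"
  assumes "continuous_on UNIV p" "continuous_on UNIV q" "p a = q a"
  shows "continuous_on S (\<lambda>s. if s \<le> a then p s else q s)"
proof -
  have "continuous_on ({..a} \<union> {a..}) (\<lambda>s. if s \<le> a then p s else q s)"
    using assms by (intro continuous_on_If) (auto intro: continuous_on_subset)
  then show ?thesis by (rule continuous_on_subset) auto
qed

lemma based_htpc_concat_rev:
  assumes m: "m \<ge> 1" and f: "f \<in> based_maps m N b"
  shows "based_htpc m N b (concat_cube m (rev_cube m f) f) (\<lambda>x\<in>cube m. b)"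
proof -
  let ?p = "\<lambda>s::real. if s \<le> 1/2 then 1 - 2 * s else 2 * s - 1"
  have p: "continuous_on {0..1} ?p"
    by (rule continuous_on_if_le) (auto intro!: continuous_intros)
  have "based_htpc m N b (\<lambda>x. f (x(0 := ?p (x 0)))) (\<lambda>x. f (x(0 := 1)))"
    by (rule based_htpc_reparam[OF m f p, where q = "\<lambda>_. 1"]) (auto intro!: continuous_intros)
  then show ?thesis
    using cube_coord_bounds[OF m] based_maps_bd[OF f cube_bd_upd_end[OF m]]
    by (subst based_htpc_cong) (auto simp: concat_cube_apply rev_cube_def cube_upd[OF m])
qed

lemma based_htpc_concat_const:
  assumes m: "m \<ge> 1" and f: "f \<in> based_maps m N b"
  shows "based_htpc m N b (concat_cube m (\<lambda>x\<in>cube m. b) f) f"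
proof -
  let ?p = "\<lambda>s::real. if s \<le> 1/2 then 0 else 2 * s - 1"
  have p: "continuous_on {0..1} ?p"
    by (rule continuous_on_if_le) (auto intro!: continuous_intros)
  have "based_htpc m N b (\<lambda>x. f (x(0 := ?p (x 0)))) (\<lambda>x. f (x(0 := x 0)))"
    by (rule based_htpc_reparam[OF m f p, where q = "\<lambda>s. s"]) (auto intro!: continuous_intros)
  then show ?thesis
    using cube_coord_bounds[OF m] based_maps_bd[OF f cube_bd_upd_end[OF m]]
    by (subst based_htpc_cong) (auto simp: concat_cube_apply cube_upd[OF m])
qed

lemma based_htpc_concat_assoc:
  assumes m: "m \<ge> 1" and "f \<in> based_maps m N b" "g \<in> based_maps m N b" "h \<in> based_maps m N b"
  shows "based_htpc m N b (concat_cube m (concat_cube m f g) h) (concat_cube m f (concat_cube m g h))"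
proof -
  let ?k = "concat_cube m f (concat_cube m g h)"
  let ?p = "\<lambda>s::real. if s \<le> 1/2 then (if s \<le> 1/4 then 2 * s else s + 1/4) else s/2 + 1/2"
  have k: "?k \<in> based_maps m N b" using assms by (intro concat_in_based_maps)
  have p: "continuous_on {0..1} ?p"
    by (intro continuous_on_if_le) (auto intro!: continuous_intros)
  have "based_htpc m N b (\<lambda>x. ?k (x(0 := ?p (x 0)))) (\<lambda>x. ?k (x(0 := x 0)))"
    by (rule based_htpc_reparam[OF m k p, where q = "\<lambda>s. s"])
      (auto intro!: continuous_intros split: if_splits)
  moreover have "concat_cube m (concat_cube m f g) h x = ?k (x(0 := ?p (x 0)))" if x: "x \<in> cube m" for x
  proof -
    have "0 \<le> x 0" "x 0 \<le> 1" using cube_coord_bounds[OF m x] by auto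
    moreover consider "x 0 \<le> 1/4" | "1/4 < x 0" "x 0 \<le> 1/2" | "1/2 < x 0" by linarith
    ultimately show ?thesis using x m by cases (simp_all add: concat_cube_apply cube_upd)
  qed
  ultimately show ?thesis by (subst based_htpc_cong) auto
qed

lemma group_homotopy_group:
  assumes m: "m \<ge> 1" and b: "b \<in> topspace N"
  shows "group (homotopy_group m N b)"
proof (rule groupI)
  let ?G = "homotopy_group m N b"
  note [simp] = homotopy_group_carrier homotopy_group_one htp_class_mult[OF m]
    concat_in_based_maps[OF m] const_in_based_maps[OF b]
  show "\<one>\<^bsub>?G\<^esub> \<in> carrier ?G" by simp
  show "A \<otimes>\<^bsub>?G\<^esub> B \<in> carrier ?G" if "A \<in> carrier ?G" "B \<in> carrier ?G" for A B
    using that by auto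
  show "A \<otimes>\<^bsub>?G\<^esub> B \<otimes>\<^bsub>?G\<^esub> C = A \<otimes>\<^bsub>?G\<^esub> (B \<otimes>\<^bsub>?G\<^esub> C)"
    if "A \<in> carrier ?G" "B \<in> carrier ?G" "C \<in> carrier ?G" for A B C
    using that by (auto simp: htp_class_eqI[OF based_htpc_concat_assoc[OF m]])
  show "\<one>\<^bsub>?G\<^esub> \<otimes>\<^bsub>?G\<^esub> A = A" if "A \<in> carrier ?G" for A
    using that by (auto simp: htp_class_eqI[OF based_htpc_concat_const[OF m]])
  show "\<exists>B\<in>carrier ?G. B \<otimes>\<^bsub>?G\<^esub> A = \<one>\<^bsub>?G\<^esub>" if "A \<in> carrier ?G" for A
  proof -
    obtain f where f: "f \<in> based_maps m N b" "A = htp_class m N b f" using \<open>A \<in> carrier ?G\<close> by auto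
    then have "htp_class m N b (rev_cube m f) \<otimes>\<^bsub>?G\<^esub> A = \<one>\<^bsub>?G\<^esub>"
      using rev_in_based_maps[OF m f(1)] by (simp add: htp_class_eqI[OF based_htpc_concat_rev[OF m]])
    then show ?thesis using htp_class_in_carrier[OF rev_in_based_maps[OF m f(1)]] by blast
  qed
qed

lemma htp_class_inv:
  assumes m: "m \<ge> 1" and f: "f \<in> based_maps m N b"
  shows "inv\<^bsub>homotopy_group m N b\<^esub> (htp_class m N b f) = htp_class m N b (rev_cube m f)"
proof (rule group.inv_equality)
  show "group (homotopy_group m N b)"
    by (rule group_homotopy_group[OF m based_maps_base_in_topspace[OF m f]])
  show "htp_class m N b (rev_cube m f) \<otimes>\<^bsub>homotopy_group m N b\<^esub> htp_class m N b f = \<one>\<^bsub>homotopy_group m N b\<^esub>"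
    unfolding htp_class_mult[OF m rev_in_based_maps[OF m f] f] homotopy_group_one
    by (rule htp_class_eqI[OF based_htpc_concat_rev[OF m f]])
qed (rule htp_class_in_carrier[OF f], rule htp_class_in_carrier[OF rev_in_based_maps[OF m f]])

section \<open>Transport of sphere maps along paths\<close>

definition extend_by_collar ::
  "nat \<Rightarrow> real \<Rightarrow> ((nat \<Rightarrow> real) \<Rightarrow> 'a) \<Rightarrow> (real \<Rightarrow> 'a) \<Rightarrow> (nat \<Rightarrow> real) \<Rightarrow> 'a" where
  "extend_by_collar m a f \<delta> x =
     (if a * cube_norm m x \<le> 1 then f (dilate_cube m a x) else \<delta> (a * cube_norm m x - 1))"

lemma continuous_map_extend_by_collar:
  fixes Z :: "'z::topological_space set"
  assumes f: "continuous_map (top_of_set (Z \<times> cube m)) N f"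
    and \<delta>: "continuous_map (top_of_set (Z \<times> {0..1::real})) N \<delta>"
    and match: "\<And>z y. z \<in> Z \<Longrightarrow> y \<in> cube_bd m \<Longrightarrow> f (z, y) = \<delta> (z, 0)"
    and a: "continuous_on Z a" "\<And>z. z \<in> Z \<Longrightarrow> 1 \<le> a z \<and> a z \<le> 2"
  shows "continuous_map (top_of_set (Z \<times> cube m)) N
    (\<lambda>p. extend_by_collar m (a (fst p)) (\<lambda>y. f (fst p, y)) (\<lambda>s. \<delta> (fst p, s)) (snd p))"
  unfolding extend_by_collar_def
proof (rule continuous_map_cases_le_on)
  let ?r = "\<lambda>p. a (fst p) * cube_norm m (snd p)"
  have scale: "continuous_on (Z \<times> cube m) (\<lambda>p. a (fst p))"
    by (rule continuous_on_compose2[OF a(1)]) (auto intro!: continuous_intros)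
  have "continuous_on (Z \<times> cube m) (\<lambda>p. cube_norm m (snd p))"
    by (rule continuous_on_compose2[OF continuous_on_cube_norm[of UNIV]]) (auto intro!: continuous_intros)
  with scale show r: "continuous_on (Z \<times> cube m) ?r" by (rule continuous_on_mult)
  have "continuous_on (Z \<times> cube m) (\<lambda>p. dilate_cube m (a (fst p)) (snd p))"
    by (intro continuous_on_dilate_cube scale continuous_on_snd continuous_on_id)
  then have dilate: "continuous_on {p \<in> Z \<times> cube m. ?r p \<le> 1} (\<lambda>p. dilate_cube m (a (fst p)) (snd p))"
    by (rule continuous_on_subset) auto
  have a_nonneg: "0 \<le> a z" if "z \<in> Z" for z using a(2)[OF that] by simp
  show "continuous_map (top_of_set {p \<in> Z \<times> cube m. ?r p \<le> 1}) N
      (\<lambda>p. f (fst p, dilate_cube m (a (fst p)) (snd p)))"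
    by (rule continuous_map_compose_continuous_on[OF f])
      (auto intro!: continuous_intros dilate dilate_in_cube a_nonneg)
  show "continuous_map (top_of_set {p \<in> Z \<times> cube m. 1 \<le> ?r p}) N (\<lambda>p. \<delta> (fst p, ?r p - 1))"
  proof (rule continuous_map_compose_continuous_on[OF \<delta>])
    show "continuous_on {p \<in> Z \<times> cube m. 1 \<le> ?r p} (\<lambda>p. (fst p, ?r p - 1))"
      by (intro continuous_intros continuous_on_subset[OF r]) auto
    fix p assume p: "p \<in> {p \<in> Z \<times> cube m. 1 \<le> ?r p}"
    then have "fst p \<in> Z" "cube_norm m (snd p) \<le> 1" by (auto simp: mem_cube_iff)
    then have "?r p \<le> 2 * 1" using a(2) by (intro mult_mono cube_norm_nonneg) auto
    with p show "(fst p, ?r p - 1) \<in> Z \<times> {0..1}" by auto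
  qed
  fix p assume "p \<in> Z \<times> cube m" "?r p = 1"
  then show "f (fst p, dilate_cube m (a (fst p)) (snd p)) = \<delta> (fst p, ?r p - 1)"
    using match[OF _ dilate_in_cube_bd] a_nonneg by auto
qed

definition transport :: "nat \<Rightarrow> ((nat \<Rightarrow> real) \<Rightarrow> 'a) \<Rightarrow> (real \<Rightarrow> 'a) \<Rightarrow> (nat \<Rightarrow> real) \<Rightarrow> 'a" where
  "transport m f \<delta> = restrict (extend_by_collar m 2 f \<delta>) (cube m)"

lemma transport_apply:
  "x \<in> cube m \<Longrightarrow> transport m f \<delta> x =
    (if 2 * cube_norm m x \<le> 1 then f (dilate_cube m 2 x) else \<delta> (2 * cube_norm m x - 1))"
  by (simp add: transport_def extend_by_collar_def)

lemma transport_disjoint: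
  assumes fg: "\<And>x. x \<in> cube m \<Longrightarrow> f x \<noteq> g x" and \<delta>\<epsilon>: "\<And>t. t \<in> {0..1} \<Longrightarrow> \<delta> t \<noteq> \<epsilon> t" and x: "x \<in> cube m"
  shows "transport m f \<delta> x \<noteq> transport m g \<epsilon> x"
proof (cases "2 * cube_norm m x \<le> 1")
  case True
  then show ?thesis using fg[OF dilate_in_cube[of 2]] by (simp add: transport_apply[OF x])
next
  case False
  then have "2 * cube_norm m x - 1 \<in> {0..1}" using x by (simp add: mem_cube_iff)
  from \<delta>\<epsilon>[OF this] False show ?thesis by (simp add: transport_apply[OF x])
qed

lemma based_htpc_transport_homotopy:
  assumes f: "continuous_map (top_of_set ({0..1::real} \<times> cube m)) N f"
    and \<delta>: "continuous_map (top_of_set ({0..1::real} \<times> {0..1::real})) N \<delta>"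
    and match: "\<And>t y. t \<in> {0..1} \<Longrightarrow> y \<in> cube_bd m \<Longrightarrow> f (t, y) = \<delta> (t, 0)"
    and base: "\<And>t. t \<in> {0..1} \<Longrightarrow> \<delta> (t, 1) = b"
  shows "based_htpc m N b (transport m (\<lambda>y. f (0, y)) (\<lambda>s. \<delta> (0, s)))
    (transport m (\<lambda>y. f (1, y)) (\<lambda>s. \<delta> (1, s)))"
proof -
  let ?h = "\<lambda>p. extend_by_collar m 2 (\<lambda>y. f (fst p, y)) (\<lambda>s. \<delta> (fst p, s)) (snd p)"
  have "continuous_map (top_of_set ({0..1::real} \<times> cube m)) N ?h"
    by (rule continuous_map_extend_by_collar[OF f \<delta> match]) auto
  then show ?thesis
    unfolding based_htpc_iff_homotopy_along homotopy_along_def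
    by (intro exI[of _ ?h]) (auto simp: transport_def extend_by_collar_def mem_cube_bd_iff base)
qed

lemma homotopy_along_transport:
  assumes f: "f \<in> based_maps m N p" and \<delta>: "pathin N \<delta>" "\<delta> 0 = p"
  shows "homotopy_along m N \<delta> f (transport m f \<delta>)"
proof -
  let ?h = "\<lambda>p. extend_by_collar m (1 + fst p) f \<delta> (snd p)"
  have "continuous_map (top_of_set ({0..1::real} \<times> cube m)) N
      (\<lambda>p. extend_by_collar m (1 + fst p) (\<lambda>y. f (snd (fst p, y))) (\<lambda>s. \<delta> (snd (fst p, s))) (snd p))"
    by (rule continuous_map_extend_by_collar[OF continuous_map_of_snd_on[OF based_maps_continuous[OF f]]
          continuous_map_of_snd_on[OF \<delta>(1)[unfolded pathin_def]]])
      (auto simp: based_maps_bd[OF f] \<delta>(2) intro!: continuous_intros)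
  then have "continuous_map (top_of_set ({0..1::real} \<times> cube m)) N ?h" by simp
  moreover have "?h (0, x) = f x \<and> ?h (1, x) = transport m f \<delta> x" if "x \<in> cube m" for x
    using that by (simp add: extend_by_collar_def transport_def dilate_cube_1 mem_cube_iff)
  moreover have "?h (t, x) = \<delta> t" if "t \<in> {0..1}" "x \<in> cube_bd m" for t x
  proof (cases "t = 0")
    case True
    have "dilate_cube m 1 x = x" using that(2) cube_bd_subset_cube by (intro dilate_cube_1) blast
    with True show ?thesis using that(2) \<delta>(2) based_maps_bd[OF f that(2)]
      by (simp add: extend_by_collar_def mem_cube_bd_iff)
  next
    case False
    then show ?thesis using that by (simp add: extend_by_collar_def mem_cube_bd_iff)
  qed
  ultimately show ?thesis unfolding homotopy_along_def by (intro exI[of _ ?h]) blast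
qed

lemma free_htpc_transport:
  "f \<in> based_maps m N p \<Longrightarrow> pathin N \<delta> \<Longrightarrow> \<delta> 0 = p \<Longrightarrow> free_htpc m N f (transport m f \<delta>)"
  unfolding free_htpc_iff_homotopy_along by (rule exI) (rule homotopy_along_transport)

lemma transport_in_based_maps:
  assumes "f \<in> based_maps m N p" "pathin N \<delta>" "\<delta> 0 = p"
  shows "transport m f \<delta> \<in> based_maps m N (\<delta> 1)"
  unfolding transport_def
proof (rule restrict_in_based_maps)
  have "homotopic_with (\<lambda>k. \<exists>c. \<forall>x\<in>cube_bd m. k x = c) (top_of_set (cube m)) N f (transport m f \<delta>)"
    using free_htpc_transport[OF assms] by (simp add: free_htpc_def)
  then have "continuous_map (top_of_set (cube m)) N (transport m f \<delta>)"
    using homotopic_with_imp_continuous_maps by blast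
  then show "continuous_map (top_of_set (cube m)) N (extend_by_collar m 2 f \<delta>)"
    by (rule continuous_map_eq) (simp add: transport_def)
qed (simp add: extend_by_collar_def mem_cube_bd_iff)

lemma based_htpc_transport_const:
  "f \<in> based_maps m N p \<Longrightarrow> p \<in> topspace N \<Longrightarrow> based_htpc m N p f (transport m f (\<lambda>_. p))"
  unfolding based_htpc_iff_homotopy_along by (rule homotopy_along_transport) (simp_all add: pathin_def)

lemma based_htpc_transport_path_homotopy:
  assumes f: "f \<in> based_maps m N p" "\<delta> 0 = p"
    and \<delta>\<epsilon>: "homotopic_with (\<lambda>k. \<forall>s\<in>{0, 1}. k s = \<delta> s) (top_of_set {0..1}) N \<delta> \<epsilon>"
  shows "based_htpc m N (\<delta> 1) (transport m f \<delta>) (transport m f \<epsilon>)"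
proof -
  obtain k where k: "continuous_map (top_of_set ({0..1::real} \<times> {0..1::real})) N k"
    "\<forall>s. k (0, s) = \<delta> s" "\<forall>s. k (1, s) = \<epsilon> s" "\<forall>t\<in>{0..1}. \<forall>s\<in>{0, 1}. k (t, s) = \<delta> s"
    using \<delta>\<epsilon> unfolding homotopic_with_def by auto
  then show ?thesis
    using based_htpc_transport_homotopy[OF continuous_map_of_snd_on[OF based_maps_continuous[OF f(1)]] k(1),
        of "\<delta> 1"]
      based_maps_bd[OF f(1)] f(2) by simp
qed

text \<open>The homotopy runs through the maps \<open>h\<^sub>t\<close> extended by \<open>\<gamma>\<close> run backwards from \<open>t\<close> to \<open>0\<close>.\<close>

lemma based_htpc_transport_back:
  assumes m: "m \<ge> 1" and fg: "homotopy_along m N \<gamma> f g"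
    and f: "f \<in> based_maps m N b" and g: "g \<in> based_maps m N p"
  shows "based_htpc m N b f (transport m g (\<lambda>s. \<gamma> (1 - s)))"
proof -
  have \<gamma>: "pathin N \<gamma>" "\<gamma> 0 = b" by (rule homotopy_along_path[OF m fg f g])+
  obtain h where h: "continuous_map (top_of_set ({0..1::real} \<times> cube m)) N h"
    and ends: "\<forall>x\<in>cube m. h (0, x) = f x \<and> h (1, x) = g x"
    and bd: "\<forall>t\<in>{0..1}. \<forall>x\<in>cube_bd m. h (t, x) = \<gamma> t"
    using fg unfolding homotopy_along_def by blast
  have "continuous_map (top_of_set ({0..1} \<times> {0..1})) N (\<lambda>z. \<gamma> (fst z * (1 - snd z)))"
    by (rule continuous_map_compose_continuous_on[OF \<gamma>(1)[unfolded pathin_def]])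
      (auto intro!: continuous_intros mult_nonneg_nonneg mult_le_one)
  from based_htpc_transport_homotopy[OF h this, of b] bd \<gamma>(2)
  have "based_htpc m N b (transport m (\<lambda>y. h (0, y)) (\<lambda>_. b)) (transport m (\<lambda>y. h (1, y)) (\<lambda>s. \<gamma> (1 - s)))"
    by simp
  moreover have "transport m (\<lambda>y. h (0, y)) \<delta> = transport m f \<delta>"
    "transport m (\<lambda>y. h (1, y)) \<delta> = transport m g \<delta>" for \<delta>
    unfolding transport_def extend_by_collar_def using ends dilate_in_cube[of 2]
    by (auto intro!: restrict_ext)
  ultimately show ?thesis
    using based_htpc_trans[OF based_htpc_transport_const[OF f based_maps_base_in_topspace[OF m f]]] by simp
qed

lemma pathin_reverse: "pathin N \<gamma> \<Longrightarrow> pathin N (\<lambda>s. \<gamma> (1 - s))"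
  unfolding pathin_def by (erule continuous_map_compose_continuous_on) (auto intro!: continuous_intros)

section \<open>Charts and general position\<close>

definition open_embedding :: "'a topology \<Rightarrow> ('e::topological_space \<Rightarrow> 'a) \<Rightarrow> bool" where
  "open_embedding N \<psi> \<longleftrightarrow> continuous_map euclidean N \<psi> \<and> open_map euclidean N \<psi> \<and> inj \<psi>"

abbreviation coord :: "('e \<Rightarrow> 'a) \<Rightarrow> 'a \<Rightarrow> 'e" where
  "coord \<psi> \<equiv> inv_into UNIV \<psi>"

lemma open_embedding_continuous: "open_embedding N \<psi> \<Longrightarrow> continuous_map euclidean N \<psi>"
  by (simp add: open_embedding_def)

lemma open_embedding_inj: "open_embedding N \<psi> \<Longrightarrow> inj \<psi>"
  by (simp add: open_embedding_def)

lemma openin_open_embedding_image: "open_embedding N \<psi> \<Longrightarrow> open S \<Longrightarrow> openin N (\<psi> ` S)"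
  by (simp add: open_embedding_def open_map_def)

lemma closedin_open_embedding_image:
  assumes "Hausdorff_space N" "open_embedding N \<psi>" "compact K"
  shows "closedin N (\<psi> ` K)"
  by (rule compactin_imp_closedin[OF assms(1) image_compactin[OF _ open_embedding_continuous[OF assms(2)]]])
    (use assms(3) in simp)

lemma continuous_on_coord_open_embedding:
  assumes \<psi>: "open_embedding N \<psi>" and f: "continuous_map (top_of_set S) N f" and range: "f ` S \<subseteq> range \<psi>"
  shows "continuous_on S (\<lambda>x. coord \<psi> (f x))"
proof -
  have "continuous_map (subtopology N (range \<psi>)) euclidean (coord \<psi>)"
    unfolding continuous_map
  proof (intro conjI allI impI)
    fix U assume "openin (euclidean :: 'b topology) U"
    then have "openin (subtopology N (range \<psi>)) (\<psi> ` U)"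
      using openin_open_embedding_image[OF \<psi>, of U] by (auto simp: openin_subtopology)
    moreover have "{x \<in> topspace (subtopology N (range \<psi>)). coord \<psi> x \<in> U} = \<psi> ` U"
      using open_embedding_inj[OF \<psi>] openin_subset[OF openin_open_embedding_image[OF \<psi> open_UNIV]]
      by auto
    ultimately show "openin (subtopology N (range \<psi>))
        {x \<in> topspace (subtopology N (range \<psi>)). coord \<psi> x \<in> U}"
      by simp
  qed simp
  moreover have "continuous_map (top_of_set S) (subtopology N (range \<psi>)) f"
    using f range by (auto simp: continuous_map_in_subtopology)
  ultimately show ?thesis
    using continuous_map_compose[of "top_of_set S" _ f euclidean "coord \<psi>"] by (simp add: o_def)
qed

lemma open_embedding_onto_ball:
  fixes c :: "'f::euclidean_space"
  assumes dim: "DIM('e) = DIM('f)" and r: "r > 0"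
  obtains e :: "'e::euclidean_space \<Rightarrow> 'f" where "open_embedding euclidean e" "range e = ball c r"
proof -
  have "(UNIV :: 'e set) homeomorphic (UNIV :: 'f set)"
    using dim by (simp add: homeomorphic_UNIV_UNIV)
  moreover have "(UNIV :: 'f set) homeomorphic ball c r"
    using homeomorphic_ball_UNIV[OF r] homeomorphic_sym by blast
  ultimately obtain e e' where e: "homeomorphism (UNIV :: 'e set) (ball c r) e e'"
    using homeomorphic_trans unfolding homeomorphic_def by metis
  have "open (e ` S)" if "open S" for S
    using homeomorphism_imp_open_map[OF e, of S] that by (auto simp: openin_open_eq)
  then have "open_embedding euclidean e"
    using e by (auto simp: open_embedding_def open_map_def homeomorphism_def intro: inj_on_inverseI)
  moreover have "range e = ball c r" using e by (simp add: homeomorphism_def)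
  ultimately show ?thesis by (rule that)
qed

lemma open_embedding_inverse_chart:
  assumes chart: "homeomorphic_maps (subtopology N U) (top_of_set V) \<phi> \<theta>" and U: "openin N U"
    and V: "open V"
    and e: "open_embedding euclidean e" "range e \<subseteq> V"
  shows "open_embedding N (\<theta> \<circ> e)"
  unfolding open_embedding_def
proof (intro conjI)
  have "continuous_map euclidean (top_of_set V) e"
    using open_embedding_continuous[OF e(1)] e(2) by (auto simp: continuous_map_in_subtopology)
  moreover have "continuous_map (top_of_set V) N \<theta>"
    using chart by (simp add: homeomorphic_maps_def continuous_map_in_subtopology)
  ultimately show "continuous_map euclidean N (\<theta> \<circ> e)" by (rule continuous_map_compose)
  have "open_map (top_of_set V) (subtopology N U) \<theta>"
    using chart homeomorphic_imp_open_map homeomorphic_maps_map by blast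
  then show "open_map euclidean N (\<theta> \<circ> e)"
    unfolding open_map_def image_comp[symmetric]
    using openin_open_embedding_image[OF e(1)] e(2) U V
    by (simp add: openin_open_eq openin_open_subtopology image_subset_iff) 
  have "inj_on \<theta> V" using chart by (intro inj_on_inverseI[of _ \<phi>]) (simp add: homeomorphic_maps_def)
  then show "inj (\<theta> \<circ> e)"
    using open_embedding_inj[OF e(1)] e(2) by (intro comp_inj_on) (auto intro: inj_on_subset)
qed

lemma manifold_open_embedding:
  assumes N: "smooth_manifold N TYPE('n::finite)" and dim: "DIM('e) = CARD('n)"
    and W: "openin N W" "q \<in> W"
  obtains \<psi> :: "'e::euclidean_space \<Rightarrow> 'a" where "open_embedding N \<psi>" "q \<in> range \<psi>" "range \<psi> \<subseteq> W"
proof -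
  obtain A :: "('a set \<times> ('a \<Rightarrow> real^'n)) set" where A: "smooth_atlas N A"
    using N by (auto simp: smooth_manifold_def)
  then have "q \<in> \<Union>(fst ` A)" using W openin_subset by (auto simp: smooth_atlas_def)
  then obtain U \<phi> where "(U, \<phi>) \<in> A" and q: "q \<in> U" by auto
  with A have U: "openin N U" "open (\<phi> ` U)"
    and \<phi>: "homeomorphic_map (subtopology N U) (top_of_set (\<phi> ` U)) \<phi>"
    unfolding smooth_atlas_def by blast+
  obtain \<theta> where \<theta>: "homeomorphic_maps (subtopology N U) (top_of_set (\<phi> ` U)) \<phi> \<theta>"
    using \<phi> by (auto simp: homeomorphic_map_maps)
  then have \<theta>_\<phi>: "\<theta> (\<phi> x) = x" if "x \<in> U" for x
    using that openin_subset[OF U(1)] by (auto simp: homeomorphic_maps_def)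
  have "openin (subtopology N U) (U \<inter> W)" using W(1) by (simp add: openin_subtopology_Int2)
  then have "openin (top_of_set (\<phi> ` U)) (\<phi> ` (U \<inter> W))"
    using homeomorphic_imp_open_map[OF \<phi>] by (simp add: open_map_def)
  then have "open (\<phi> ` (U \<inter> W))" using U(2) openin_open_eq by blast
  then obtain r where r: "r > 0" "ball (\<phi> q) r \<subseteq> \<phi> ` (U \<inter> W)"
    by (rule openE) (use q W(2) in blast)
  have "DIM('e) = DIM(real^'n)" using dim by simp
  then obtain e :: "'e \<Rightarrow> real^'n" where e: "open_embedding euclidean e" "range e = ball (\<phi> q) r"
    using r(1) by (rule open_embedding_onto_ball)
  have range_comp: "range (\<theta> \<circ> e) = \<theta> ` ball (\<phi> q) r" unfolding e(2)[symmetric] image_comp ..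
  have "open_embedding N (\<theta> \<circ> e)"
    by (rule open_embedding_inverse_chart[OF \<theta> U e(1)]) (use e(2) r(2) in blast)
  moreover have "\<theta> (\<phi> q) \<in> \<theta> ` ball (\<phi> q) r" using r(1) by (intro imageI) simp
  then have "q \<in> range (\<theta> \<circ> e)" unfolding range_comp \<theta>_\<phi>[OF q] .
  moreover have "\<theta> ` \<phi> ` (U \<inter> W) = U \<inter> W" unfolding image_image by (simp add: \<theta>_\<phi>)
  then have "range (\<theta> \<circ> e) \<subseteq> W" using image_mono[OF r(2), of \<theta>] unfolding range_comp by simp
  ultimately show ?thesis by (rule that)
qed

lemma manifold_infinite:
  assumes N: "smooth_manifold N TYPE('n::finite)" and p: "p \<in> topspace N"
  shows "infinite (topspace N)"
proof -
  obtain \<psi> :: "real^'n \<Rightarrow> 'a" where \<psi>: "open_embedding N \<psi>"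
    using manifold_open_embedding[OF N _ openin_topspace p, where 'e = "real^'n"] by auto
  have "infinite (UNIV :: (real^'n) set)" using finite_imp_not_open[of "UNIV :: (real^'n) set"] by auto
  then have "infinite (range \<psi>)" using finite_imageD[OF _ open_embedding_inj[OF \<psi>]] by blast
  then show ?thesis
    using finite_subset[OF openin_subset[OF openin_open_embedding_image[OF \<psi> open_UNIV]]] by blast
qed

lemma manifold_path_connected:
  assumes N: "smooth_manifold N TYPE('n::finite)" "connected_space N"
  shows "path_connected_space N"
proof -
  have "neighbourhood_base_of (path_connectedin N) N"
    unfolding neighbourhood_base_of
  proof (intro allI impI)
    fix W x assume W: "openin N W \<and> x \<in> W"
    obtain \<psi> :: "real^'n \<Rightarrow> 'a" where \<psi>: "open_embedding N \<psi>" "x \<in> range \<psi>" "range \<psi> \<subseteq> W"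
        using manifold_open_embedding[OF N(1) _ conjunct1[OF W] conjunct2[OF W], where 'e = "real^'n"]
        by auto
    have "path_connectedin N (range \<psi>)"
      by (rule path_connectedin_continuous_map_image[OF open_embedding_continuous[OF \<psi>(1)]]) simp
    then show "\<exists>U V. openin N U \<and> path_connectedin N V \<and> x \<in> U \<and> U \<subseteq> V \<and> V \<subseteq> W"
      using \<psi>(2,3) openin_open_embedding_image[OF \<psi>(1) open_UNIV] by blast
  qed
  then show ?thesis
    using N(2) path_connected_eq_connected_space[of N] by (simp add: locally_path_connected_space_def)
qed

lemma manifold_path_between:
  assumes "smooth_manifold N TYPE('n::finite)" "connected_space N" "p \<in> topspace N" "q \<in> topspace N"
  obtains \<gamma> where "pathin N \<gamma>" "\<gamma> 0 = p" "\<gamma> 1 = q"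
  using manifold_path_connected[OF assms(1,2)] assms(3,4) unfolding path_connected_space_def by blast

text \<open>A polynomial approximation of \<open>g\<close> has negligible image, hence misses arbitrarily small
  translates of \<open>c\<close>.\<close>

lemma approximation_avoiding_point:
  fixes g :: "'e::euclidean_space \<Rightarrow> 'e"
  assumes K: "compact K" "negligible K" and g: "continuous_on K g" and e: "e > 0"
  obtains g' where "continuous_on K g'" "\<And>x. x \<in> K \<Longrightarrow> dist (g x) (g' x) < e" "c \<notin> g' ` K"
proof -
  obtain P where P: "polynomial_function P" "\<And>x. x \<in> K \<Longrightarrow> norm (g x - P x) < e/2"
    using Stone_Weierstrass_polynomial_function[OF K(1) g, of "e/2"] e by auto
  have "negligible (P ` K)"
    using negligible_differentiable_image_negligible[OF _ K(2)
        differentiable_on_polynomial_function[OF P(1)]]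
    by simp
  then have "\<not> ball c (e/2) \<subseteq> P ` K"
    using e negligible_subset open_not_negligible[of "ball c (e/2)"] by auto
  then obtain y where y: "y \<in> ball c (e/2)" "y \<notin> P ` K" by blast
  show ?thesis
  proof
    show "continuous_on K (\<lambda>x. P x - (y - c))"
      by (intro continuous_on_diff continuous_on_polymonial_function[OF P(1)] continuous_on_const)
    show "dist (g x) (P x - (y - c)) < e" if "x \<in> K" for x
    proof -
      have "dist (g x) (P x - (y - c)) \<le> norm (g x - P x) + norm (y - c)"
        unfolding dist_norm using norm_triangle_ineq[of "g x - P x" "y - c"] by (simp add: algebra_simps)
      then show ?thesis using P(2)[OF that] y(1) by (simp add: dist_norm norm_minus_commute)
    qed
    show "c \<notin> (\<lambda>x. P x - (y - c)) ` K" using y(2) by (auto simp: image_iff algebra_simps)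
  qed
qed

text \<open>The perturbation towards \<open>g'\<close> is damped by a factor that vanishes outside the unit ball
  and equals 1 wherever the perturbation could reach the center.\<close>

lemma homotopy_avoiding_point_in_ball:
  fixes g :: "'e::euclidean_space \<Rightarrow> 'e"
  assumes K: "compact K" "negligible K" and g: "continuous_on K g"
  obtains k where "continuous_on ({0..1::real} \<times> K) k" "\<And>x. k (0, x) = g x"
    "\<And>x. x \<in> K \<Longrightarrow> k (1, x) \<noteq> c" "\<And>t x. g x \<notin> ball c 1 \<Longrightarrow> k (t, x) = g x"
proof -
  obtain g' where g': "continuous_on K g'" "\<And>x. x \<in> K \<Longrightarrow> dist (g x) (g' x) < 1/2" "c \<notin> g' ` K"
    using approximation_avoiding_point[OF K g, of "1/2" c] by auto
  define damp where "damp x = max 0 (min 1 (2 - 2 * dist c (g x)))" for x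
  define k where "k z = g (snd z) + (fst z * damp (snd z)) *\<^sub>R (g' (snd z) - g (snd z))"
    for z :: "real \<times> 'e"
  show ?thesis
  proof
    have on_snd: "continuous_on ({0..1::real} \<times> K) (\<lambda>z. u (snd z))"
      if "continuous_on K u" for u :: "'e \<Rightarrow> 'e"
      by (rule continuous_on_compose2[OF that]) (auto intro!: continuous_intros)
    show "continuous_on ({0..1} \<times> K) k"
      unfolding k_def damp_def by (intro continuous_intros on_snd g(1) g'(1))
    show "k (1, x) \<noteq> c" if x: "x \<in> K" for x
    proof
      assume "k (1, x) = c"
      then have c: "c = g x + damp x *\<^sub>R (g' x - g x)" by (simp add: k_def)
      have damp: "0 \<le> damp x" "damp x \<le> 1" by (simp_all add: damp_def)
      have "dist c (g x) = norm (damp x *\<^sub>R (g' x - g x))" using c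
        by (metis add_diff_cancel_left' dist_norm)
      also have "\<dots> = damp x * dist (g x) (g' x)"
        using damp(1) by (simp add: dist_norm norm_minus_commute)
      also have "\<dots> \<le> 1 * dist (g x) (g' x)" using damp(2) by (intro mult_right_mono) auto
      finally have "dist c (g x) < 1/2" using g'(2)[OF x] by simp
      then have "damp x = 1" by (simp add: damp_def)
      then have "g' x = c" using c by (metis add_diff_cancel_left' diff_add_cancel add.commute scaleR_one)
      then show False using g'(3) x by blast
    qed
  qed (simp_all add: k_def damp_def)
qed

lemma continuous_map_If_closed:
  assumes "closedin X A" "closedin X B" "topspace X \<subseteq> A \<union> B"
    and "continuous_map (subtopology X A) Y f" "continuous_map (subtopology X B) Y g"
    and "\<And>x. x \<in> A \<Longrightarrow> x \<in> B \<Longrightarrow> f x = g x"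
  shows "continuous_map X Y (\<lambda>x. if x \<in> A then f x else g x)"
proof (rule pasting_lemma_closed[where I = "{True, False}" and f = "\<lambda>b. if b then f else g"
      and T = "\<lambda>b. if b then A else B"])
  fix x assume "x \<in> topspace X"
  then show "\<exists>j. j \<in> {True, False} \<and> x \<in> (if j then A else B) \<and>
      (if x \<in> A then f x else g x) = (if j then f else g) x"
    using assms(3) by auto
qed (use assms in auto)

lemma homotopic_with_extend_from_closed:
  fixes K :: "'b::topological_space set"
  assumes A: "closedin (top_of_set K) A" and B: "closedin (top_of_set K) B" and K: "K = A \<union> B"
    and f: "continuous_map (top_of_set K) N f" and h: "continuous_map (top_of_set ({0..1::real} \<times> A)) N h"
    and start: "\<And>x. x \<in> A \<Longrightarrow> h (0, x) = f x"
    and overlap: "\<And>t x. t \<in> {0..1} \<Longrightarrow> x \<in> A \<Longrightarrow> x \<in> B \<Longrightarrow> h (t, x) = f x"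
  shows "homotopic_with (\<lambda>k. \<forall>x\<in>B. k x = f x) (top_of_set K) N f (\<lambda>x. if x \<in> A then h (1, x) else f x)"
proof -
  define H where "H z = (if z \<in> {0..1} \<times> A then h z else f (snd z))" for z :: "real \<times> 'b"
  have "continuous_map (top_of_set ({0..1} \<times> K)) N H" unfolding H_def
  proof (rule continuous_map_If_closed)
    show "closedin (top_of_set ({0..1} \<times> K)) ({0..1} \<times> A)" "closedin (top_of_set ({0..1} \<times> K)) ({0..1} \<times> B)"
      using A B by (auto intro!: closedin_Times)
    show "topspace (top_of_set ({0..1} \<times> K)) \<subseteq> {0..1} \<times> A \<union> {0..1} \<times> B" using K by auto
    show "continuous_map (subtopology (top_of_set ({0..1} \<times> K)) ({0..1} \<times> A)) N h"
      using h K by (simp add: subtopology_subtopology Times_Int_Times inf_absorb2)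
    show "continuous_map (subtopology (top_of_set ({0..1::real} \<times> K)) ({0..1} \<times> B)) N (\<lambda>z. f (snd z))"
      by (rule continuous_map_from_subtopology[OF continuous_map_of_snd_on[OF f]])
    show "h z = f (snd z)" if "z \<in> {0..1} \<times> A" "z \<in> {0..1} \<times> B" for z
      using that overlap by auto
  qed
  moreover have "H (0, x) = f x" for x using start by (simp add: H_def)
  moreover have "H (t, x) = f x" if "t \<in> {0..1}" "x \<in> B" for t x using that overlap by (simp add: H_def)
  moreover have "H (1, x) = (if x \<in> A then h (1, x) else f x)" for x by (simp add: H_def)
  ultimately show ?thesis unfolding homotopic_with_def by (intro exI[of _ H]) auto
qed

lemma closedin_continuous_map_avoiding_open:
  assumes f: "continuous_map X Y f" and U: "openin Y U"
  shows "closedin X {x \<in> topspace X. f x \<notin> U}"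
proof -
  have "{x \<in> topspace X. f x \<notin> U} = {x \<in> topspace X. f x \<in> topspace Y - U}"
    using f by (auto simp: continuous_map_def)
  then show ?thesis using closedin_continuous_map_preimage[OF f closedin_diff[OF closedin_topspace U]]
    by simp
qed

lemma homotopic_avoiding_center_of_open_embedding:
  fixes \<psi> :: "'e::euclidean_space \<Rightarrow> 'a" and K :: "'e set"
  assumes N: "Hausdorff_space N" and \<psi>: "open_embedding N \<psi>"
    and K: "compact K" "negligible K" and f: "continuous_map (top_of_set K) N f"
  obtains g where "homotopic_with (\<lambda>k. \<forall>x\<in>{x \<in> K. f x \<notin> \<psi> ` ball c 1}. k x = f x) (top_of_set K) N f g"
    "\<psi> c \<notin> g ` K"
proof -
  let ?A = "{x \<in> K. f x \<in> \<psi> ` cball c 1}" and ?B = "{x \<in> K. f x \<notin> \<psi> ` ball c 1}"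
  have \<psi>_image: "\<psi> y \<in> \<psi> ` S \<longleftrightarrow> y \<in> S" for y S by (rule inj_image_mem_iff[OF open_embedding_inj[OF \<psi>]])
  have coord_\<psi>: "coord \<psi> (\<psi> y) = y" for y using open_embedding_inj[OF \<psi>] by simp
  have closed_A: "closedin (top_of_set K) ?A"
    using closedin_continuous_map_preimage[OF f closedin_open_embedding_image[OF N \<psi> compact_cball]] by simp
  have closed_B: "closedin (top_of_set K) ?B"
    using closedin_continuous_map_avoiding_open[OF f openin_open_embedding_image[OF \<psi> open_ball]] by simp
  have "compact ?A" using closedin_compact[OF K(1) closed_A] .
  moreover have "negligible ?A" by (rule negligible_subset[OF K(2)]) auto
  moreover have "continuous_on ?A (\<lambda>x. coord \<psi> (f x))"
    by (rule continuous_on_coord_open_embedding[OF \<psi>])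
      (use f in \<open>auto intro: continuous_map_from_subtopology_mono\<close>)
  ultimately obtain k where k: "continuous_on ({0..1::real} \<times> ?A) k"
    and k_0: "\<And>x. k (0, x) = coord \<psi> (f x)" and k_1: "\<And>x. x \<in> ?A \<Longrightarrow> k (1, x) \<noteq> c"
    and k_fixed: "\<And>t x. coord \<psi> (f x) \<notin> ball c 1 \<Longrightarrow> k (t, x) = coord \<psi> (f x)"
    by (rule homotopy_avoiding_point_in_ball[where c = c]) (rule that)
  let ?g = "\<lambda>x. if x \<in> ?A then \<psi> (k (1, x)) else f x"
  have "homotopic_with (\<lambda>k. \<forall>x\<in>?B. k x = f x) (top_of_set K) N f ?g"
  proof (rule homotopic_with_extend_from_closed[OF closed_A closed_B _ f])
    show "K = ?A \<union> ?B" using ball_subset_cball[of c 1] by blast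
    show "continuous_map (top_of_set ({0..1} \<times> ?A)) N (\<lambda>z. \<psi> (k z))"
      by (rule continuous_map_compose_continuous_on[of UNIV, OF _ k])
        (use open_embedding_continuous[OF \<psi>] in auto)
    show "\<psi> (k (0, x)) = f x" if "x \<in> ?A" for x using that by (auto simp: k_0 f_inv_into_f)
    show "\<psi> (k (t, x)) = f x" if "x \<in> ?A" "x \<in> ?B" for t x
      using that k_fixed[of x t] by (auto simp: coord_\<psi> \<psi>_image)
  qed
  moreover have "\<psi> c \<noteq> ?g x" if "x \<in> K" for x
  proof (cases "x \<in> ?A")
    case True
    then show ?thesis using k_1[OF True] open_embedding_inj[OF \<psi>] by (auto simp: inj_eq)
  next
    case False
    then have "f x \<noteq> \<psi> c" using that \<psi>_image[of c "cball c 1"] by auto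
    with False show ?thesis by auto
  qed
  then have "\<psi> c \<notin> ?g ` K" by blast
  ultimately show ?thesis by (rule that)
qed

lemma homotopic_avoiding_point:
  fixes e :: "'b::t2_space \<Rightarrow> real^'n"
  assumes N: "smooth_manifold N TYPE('n::finite)" and q: "q \<in> topspace N"
    and T: "compact T" and e: "continuous_on T e" "inj_on e T" "negligible (e ` T)"
    and f: "continuous_map (top_of_set T) N f" and A: "compact A" "A \<subseteq> T" "q \<notin> f ` A"
  obtains g where "homotopic_with (\<lambda>k. \<forall>x\<in>A. k x = f x) (top_of_set T) N f g" "q \<notin> g ` T"
proof -
  have haus: "Hausdorff_space N" using N by (simp add: smooth_manifold_def)
  have "compactin N (f ` A)"
    by (rule image_compactin[OF _ f]) (use A in \<open>auto simp: compactin_subtopology\<close>)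
  then have off_A: "openin N (topspace N - f ` A)" "q \<in> topspace N - f ` A"
    using compactin_imp_closedin[OF haus] q A(3) by auto
  then obtain \<psi> :: "real^'n \<Rightarrow> 'a" where \<psi>: "open_embedding N \<psi>" "q \<in> range \<psi>" "range \<psi> \<subseteq> topspace N - f ` A"
    using manifold_open_embedding[OF N _ off_A, where 'e = "real^'n"] by auto
  obtain c where c: "\<psi> c = q" using \<psi>(2) by auto
  obtain d where d: "homeomorphism T (e ` T) e d" using homeomorphism_compact[OF T e(1) refl e(2)] by blast
  then have d_e: "d (e x) = x" if "x \<in> T" for x using that by (simp add: homeomorphism_def)
  have "continuous_map (top_of_set (e ` T)) N (f \<circ> d)" unfolding o_def
    by (rule continuous_map_compose_continuous_on[OF f]) (use d in \<open>auto simp: homeomorphism_def\<close>)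
  then obtain g where
    g: "homotopic_with (\<lambda>k. \<forall>y\<in>{y \<in> e ` T. (f \<circ> d) y \<notin> \<psi> ` ball c 1}. k y = (f \<circ> d) y)
          (top_of_set (e ` T)) N (f \<circ> d) g"
      "\<psi> c \<notin> g ` e ` T"
    using homotopic_avoiding_center_of_open_embedding[OF haus \<psi>(1)
        compact_continuous_image[OF e(1) T] e(3)] by blast
  have "homotopic_with (\<lambda>k. \<forall>x\<in>A. k x = f x) (top_of_set T) N (f \<circ> d \<circ> e) (g \<circ> e)"
  proof (rule homotopic_with_compose_continuous_map_right[OF g(1)])
    show "continuous_map (top_of_set T) (top_of_set (e ` T)) e"
      using e(1) by (auto simp: continuous_map_in_subtopology)
    have "(f \<circ> d) (e x) \<notin> \<psi> ` ball c 1" if "x \<in> A" for x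
      using d_e[OF subsetD[OF A(2) that]] \<psi>(3) that by auto
    then show "\<forall>x\<in>A. (k \<circ> e) x = f x"
      if "\<forall>y\<in>{y \<in> e ` T. (f \<circ> d) y \<notin> \<psi> ` ball c 1}. k y = (f \<circ> d) y" for k
      using that d_e[OF subsetD[OF A(2)]] A(2) by fastforce
  qed
  then have "homotopic_with (\<lambda>k. \<forall>x\<in>A. k x = f x) (top_of_set T) N f (g \<circ> e)"
    by (rule homotopic_with_eq) (use A(2) d_e in \<open>auto simp: subset_iff\<close>)
  moreover have "q \<notin> (g \<circ> e) ` T" using g(2) c by (simp add: image_comp)
  ultimately show ?thesis by (rule that)
qed

lemma negligible_coord_zero:
  fixes S :: "(real^'n) set"
  assumes "\<And>y. y \<in> S \<Longrightarrow> y $ l = 0"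
  shows "negligible S"
proof -
  have "negligible {y :: real^'n. y \<bullet> axis l 1 = 0}"
    by (rule negligible_standard_hyperplane) (simp add: axis_in_Basis_iff)
  then show ?thesis by (rule negligible_subset) (use assms in \<open>auto simp: inner_axis\<close>)
qed

lemma path_homotopic_avoiding_point:
  assumes N: "smooth_manifold N TYPE('n::finite)" and n: "CARD('n) \<ge> 2" and q: "q \<in> topspace N"
    and \<gamma>: "pathin N \<gamma>" "\<gamma> 0 \<noteq> q" "\<gamma> 1 \<noteq> q"
  obtains \<delta> where "homotopic_with (\<lambda>k. \<forall>s\<in>{0, 1}. k s = \<gamma> s) (top_of_set {0..1}) N \<gamma> \<delta>" "q \<notin> \<delta> ` {0..1}"
proof -
  obtain i l :: 'n where "i \<noteq> l"
    using n card_le_Suc0_iff_eq[of "UNIV :: 'n set"] by fastforce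
  define e where "e t = (t *\<^sub>R axis i 1 :: real^'n)" for t
  have "negligible (e ` {0..1})"
    by (rule negligible_coord_zero[of _ l]) (use \<open>i \<noteq> l\<close> in \<open>auto simp: e_def axis_def\<close>)
  moreover have "continuous_on {0..1} e" unfolding e_def by (intro continuous_intros)
  moreover have "inj_on e {0..1}" by (rule inj_onI) (simp add: e_def axis_eq_0_iff)
  ultimately show ?thesis
    using homotopic_avoiding_point[OF N q compact_Icc[of 0 1], where e = e and f = \<gamma> and A = "{0, 1}"] \<gamma>
      that
    by (auto simp: pathin_def)
qed

lemma based_htpc_avoiding_point:
  assumes N: "smooth_manifold N TYPE('n::finite)" and n: "m < CARD('n)" and q: "q \<in> topspace N"
    and f: "f \<in> based_maps m N b" and b: "b \<noteq> q"
  obtains g where "g \<in> based_maps m N b" "based_htpc m N b f g" "q \<notin> g ` cube m"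
proof -
  obtain \<tau> :: "nat \<Rightarrow> 'n" where \<tau>: "inj_on \<tau> {..<m}"
    using card_le_inj[of "{..<m}" "UNIV :: 'n set"] n by auto
  have "card (\<tau> ` {..<m}) < CARD('n)" using n by (simp add: card_image[OF \<tau>])
  then have "\<tau> ` {..<m} \<noteq> UNIV" by auto
  then obtain l where l: "l \<notin> \<tau> ` {..<m}" by blast
  define e where "e x = (\<Sum>i<m. x i *\<^sub>R axis (\<tau> i) 1 :: real^'n)" for x :: "nat \<Rightarrow> real"
  have coord: "e x $ \<tau> i = x i" if "i < m" for x i
  proof -
    have "e x $ \<tau> i = (\<Sum>j<m. if j = i then x j else 0)"
      unfolding e_def sum_component using that inj_on_eq_iff[OF \<tau>] by (intro sum.cong) (auto simp: axis_def)
    then show ?thesis using that by simp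
  qed
  have "continuous_on (cube m) e" unfolding e_def by (intro continuous_intros)
  moreover have "inj_on e (cube m)"
  proof (rule inj_onI, rule ext)
    fix x y i assume "x \<in> cube m" "y \<in> cube m" "e x = e y"
    then show "x i = y i" using coord[of i x] coord[of i y] by (cases "i < m") (auto simp: cube_def)
  qed
  moreover have "negligible (e ` cube m)"
    by (rule negligible_coord_zero[of _ l]) (use l in \<open>auto simp: e_def axis_def intro!: sum.neutral\<close>)
  ultimately obtain g
    where g: "homotopic_with (\<lambda>k. \<forall>x\<in>cube_bd m. k x = f x) (top_of_set (cube m)) N f g" "q \<notin> g ` cube m"
    using homotopic_avoiding_point[OF N q compact_cube[of m], where e = e and f = f and A = "cube_bd m"]
      based_maps_continuous[OF f]
      based_maps_bd[OF f] b compact_cube_bd cube_bd_subset_cube by auto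
  have "based_htpc m N b f g"
    using g(1) unfolding based_htpc_def by (rule homotopic_with_mono) (use based_maps_bd[OF f] in simp)
  moreover have "continuous_map (top_of_set (cube m)) N g"
    using homotopic_with_imp_continuous_maps[OF g(1)] by blast
  then have "restrict g (cube m) \<in> based_maps m N b"
    using homotopic_with_imp_property[OF g(1)] based_maps_bd[OF f] by (intro restrict_in_based_maps) auto
  ultimately show ?thesis
    using g(2) by (intro that[of "restrict g (cube m)"])
      (auto simp: based_htpc_cong[of m f f "restrict g (cube m)" g])
qed

section \<open>One-dimensional manifolds\<close>

lemma connected_closed_unbounded_ray:
  fixes T :: "real set"
  assumes T: "connected T" "closed T" "\<not> compact T" and r: "r \<in> T" "T \<subseteq> {r..}"
  shows "T = {r..}"
proof
  show "{r..} \<subseteq> T"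
  proof
    fix x assume "x \<in> {r..}"
    have "\<not> T \<subseteq> {r..x}"
      using T(2,3) bounded_subset[OF bounded_closed_interval] compact_eq_bounded_closed by blast
    then obtain y where "y \<in> T" "x \<le> y" using r(2) by force
    then show "x \<in> T" using connectedD_interval[OF T(1) r(1)] \<open>x \<in> {r..}\<close> by simp
  qed
qed (rule r(2))

lemma connected_closed_unbounded_half_line:
  fixes T :: "real set"
  assumes T: "connected T" "closed T" "\<not> compact T" and r: "r \<in> T" and end_point: "connected (T - {r})"
  shows "T = {r..} \<or> T = {..r}"
proof (cases "T \<subseteq> {r..}")
  case True
  then show ?thesis using connected_closed_unbounded_ray[OF T r] by blast
next
  case False
  then obtain a where a: "a \<in> T" "a < r" by (meson atLeast_iff not_le subsetI)
  have "b \<le> r" if "b \<in> T" for b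
  proof (rule ccontr)
    assume "\<not> b \<le> r"
    then have "r \<in> T - {r}" using connectedD_interval[OF end_point, of a b r] a that by auto
    then show False by simp
  qed
  then have "uminus ` T \<subseteq> {- r..}" by auto
  moreover have "connected (uminus ` T)"
    using T(1) by (intro connected_continuous_image continuous_intros)
  moreover have "compact T" if "compact (uminus ` T)"
    using compact_negations[OF that] by (simp add: image_image)
  ultimately have "uminus ` T = {- r..}"
    using T r closed_negations[OF T(2)] by (intro connected_closed_unbounded_ray) auto
  then have "uminus ` uminus ` T = uminus ` {- r..}" by simp
  then show ?thesis by (simp add: image_image)
qed

lemma first_exit_open:
  fixes S :: "real set"
  assumes S: "open S" and s: "s < \<beta>" "\<beta> \<notin> S"
  obtains \<alpha> where "s \<le> \<alpha>" "\<alpha> \<le> \<beta>" "\<alpha> \<notin> S" "{s..<\<alpha>} \<subseteq> S"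
proof -
  let ?C = "{s..} - S"
  have bdd: "bdd_below ?C" by (intro bdd_belowI[of _ s]) simp
  have \<beta>: "\<beta> \<in> ?C" using s by simp
  have "closed ?C" using S by (simp add: closed_Diff)
  then have "Inf ?C \<in> ?C" using \<beta> bdd by (intro closed_contains_Inf) blast
  moreover have "Inf ?C \<le> \<beta>" by (rule cInf_lower[OF \<beta> bdd])
  moreover have "{s..<Inf ?C} \<subseteq> S" using cInf_lower[OF _ bdd] by force
  ultimately show ?thesis by (intro that[of "Inf ?C"]) auto
qed

lemma open_embedding_affine:
  fixes \<gamma> :: "real \<Rightarrow> 'a"
  assumes \<gamma>: "open_embedding N \<gamma>" and a: "a \<noteq> 0"
  shows "open_embedding N (\<lambda>t. \<gamma> (c + a * t))"
  unfolding open_embedding_def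
proof (intro conjI)
  show "continuous_map euclidean N (\<lambda>t. \<gamma> (c + a * t))"
    using continuous_map_compose_continuous_on[of UNIV N \<gamma> UNIV "\<lambda>t. c + a * t"]
      open_embedding_continuous[OF \<gamma>]
    by (simp add: continuous_intros)
  have "\<gamma> ` (\<lambda>t. c + a * t) ` S = (\<lambda>t. \<gamma> (c + a * t)) ` S" for S by (rule image_image)
  then show "open_map euclidean N (\<lambda>t. \<gamma> (c + a * t))"
    unfolding open_map_def using openin_open_embedding_image[OF \<gamma> open_affinity[OF _ a, of _ c]] by simp
  show "inj (\<lambda>t. \<gamma> (c + a * t))"
    using a open_embedding_inj[OF \<gamma>] by (auto intro!: injI simp: inj_eq)
qed

lemma range_affine:
  fixes \<gamma> :: "real \<Rightarrow> 'a"
  assumes "a \<noteq> 0"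
  shows "range (\<lambda>t. \<gamma> (c + a * t)) = range \<gamma>"
proof -
  have "x = c + a * ((x - c) / a)" for x using assms by simp
  then show ?thesis by (auto, metis rangeI)
qed

lemma open_embedding_of_injective_line:
  fixes \<omega> :: "real \<Rightarrow> 'a"
  assumes \<omega>: "continuous_map euclidean N \<omega>" "inj \<omega>"
    and lines: "\<And>t. \<exists>\<delta> :: real \<Rightarrow> 'a. open_embedding N \<delta> \<and> \<omega> t \<in> range \<delta>"
  shows "open_embedding N \<omega>"
proof -
  have "\<exists>T. openin N T \<and> x \<in> T \<and> T \<subseteq> \<omega> ` S" if S: "open S" and "x \<in> \<omega> ` S" for S x
  proof -
    obtain t where t: "t \<in> S" "x = \<omega> t" using \<open>x \<in> \<omega> ` S\<close> by auto
    obtain \<delta> :: "real \<Rightarrow> 'a" where \<delta>: "open_embedding N \<delta>" "\<omega> t \<in> range \<delta>" using lines by blast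
    have "open {s. \<omega> s \<in> range \<delta>}"
      using openin_continuous_map_preimage[OF \<omega>(1) openin_open_embedding_image[OF \<delta>(1) open_UNIV]] by simp
    then obtain r where r: "r > 0" "ball t r \<subseteq> S \<inter> {s. \<omega> s \<in> range \<delta>}"
      by (rule openE[OF open_Int[OF S], of _ t]) (use t(1) \<delta>(2) in blast)
    then have \<delta>_coord: "\<delta> (coord \<delta> (\<omega> s)) = \<omega> s" if "s \<in> ball t r" for s
      using that by (auto simp: f_inv_into_f)
    have "continuous_on (ball t r) (\<lambda>s. coord \<delta> (\<omega> s))"
      using r(2) by (intro continuous_on_coord_open_embedding[OF \<delta>(1)
            continuous_map_from_subtopology[OF \<omega>(1)]]) auto
    moreover have "inj_on (\<lambda>s. coord \<delta> (\<omega> s)) (ball t r)"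
      using \<delta>_coord \<omega>(2) by (intro inj_onI) (metis injD)
    ultimately have "open ((\<lambda>s. coord \<delta> (\<omega> s)) ` ball t r)"
      using injective_eq_1d_open_map_UNIV by (metis is_interval_ball_real open_ball order_refl)
    then have "openin N (\<delta> ` (\<lambda>s. coord \<delta> (\<omega> s)) ` ball t r)" by (rule openin_open_embedding_image[OF \<delta>(1)])
    also have "\<delta> ` (\<lambda>s. coord \<delta> (\<omega> s)) ` ball t r = \<omega> ` ball t r"
      unfolding image_image using \<delta>_coord by (rule image_cong[OF refl])
    finally show ?thesis using r t by (intro exI[of _ "\<omega> ` ball t r"]) auto
  qed
  then have "open_map euclidean N \<omega>" unfolding open_map_def by (subst openin_subopen) auto
  then show ?thesis using \<omega> by (simp add: open_embedding_def)
qed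

lemma connected_preimage_open_embedding:
  fixes \<delta> :: "'e::euclidean_space \<Rightarrow> 'a" and f :: "'b::topological_space \<Rightarrow> 'a"
  assumes \<delta>: "open_embedding N \<delta>" and f: "continuous_map (top_of_set S) N f" "f ` S \<subseteq> range \<delta>"
    and S: "connected S"
  shows "connected {x. \<delta> x \<in> f ` S}"
proof -
  have "{x. \<delta> x \<in> f ` S} = (\<lambda>t. coord \<delta> (f t)) ` S"
  proof (intro equalityI subsetI)
    fix x assume "x \<in> {x. \<delta> x \<in> f ` S}"
    moreover have "coord \<delta> (\<delta> x) = x" using open_embedding_inj[OF \<delta>] by simp
    ultimately show "x \<in> (\<lambda>t. coord \<delta> (f t)) ` S" by (metis imageE imageI mem_Collect_eq)
  next
    fix x assume "x \<in> (\<lambda>t. coord \<delta> (f t)) ` S"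
    then obtain t where t: "t \<in> S" "x = coord \<delta> (f t)" by auto
    then have "f t \<in> range \<delta>" using f(2) by auto
    then show "x \<in> {x. \<delta> x \<in> f ` S}" using t by (simp add: f_inv_into_f)
  qed
  moreover have "connected ((\<lambda>t. coord \<delta> (f t)) ` S)"
    by (rule connected_continuous_image[OF continuous_on_coord_open_embedding[OF \<delta> f] S])
  ultimately show ?thesis by simp
qed

lemma closed_preimage_compact_image:
  fixes \<gamma> :: "'e::euclidean_space \<Rightarrow> 'a" and \<delta> :: "'b::topological_space \<Rightarrow> 'a"
  assumes "Hausdorff_space N" "open_embedding N \<gamma>" "continuous_map euclidean N \<delta>" "compact K"
  shows "closed {x. \<delta> x \<in> \<gamma> ` K}"
  using closedin_continuous_map_preimage[OF assms(3) closedin_open_embedding_image[OF assms(1,2,4)]] by simp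

text \<open>A line \<open>\<gamma>\<close> that leaves the line \<open>\<delta>\<close> must run to infinity in the coordinate of \<open>\<delta>\<close>,
  since otherwise the exit point would lie in the closed set \<open>\<delta> ` K\<close> for a compact \<open>K\<close>.\<close>

lemma open_line_exit_half_line:
  fixes \<gamma> \<delta> :: "real \<Rightarrow> 'a"
  assumes N: "Hausdorff_space N" and \<gamma>: "open_embedding N \<gamma>" and \<delta>: "open_embedding N \<delta>"
    and s: "\<gamma> s = \<delta> r" "s < \<alpha>" and inside: "\<gamma> ` {s..<\<alpha>} \<subseteq> range \<delta>" and exit: "\<gamma> \<alpha> \<notin> range \<delta>"
  shows "\<delta> ` {r..} = \<gamma> ` {s..<\<alpha>} \<or> \<delta> ` {..r} = \<gamma> ` {s..<\<alpha>}"
proof -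
  define T where "T = {x. \<delta> x \<in> \<gamma> ` {s..<\<alpha>}}"
  have "\<delta> ` T = range \<delta> \<inter> \<gamma> ` {s..<\<alpha>}" by (auto simp: T_def)
  then have image_T: "\<delta> ` T = \<gamma> ` {s..<\<alpha>}" using inside by blast
  have connected_coord: "connected {x. \<delta> x \<in> \<gamma> ` I}" if "connected I" "I \<subseteq> {s..<\<alpha>}" for I
    using that inside open_embedding_continuous[OF \<gamma>]
    by (intro connected_preimage_open_embedding[OF \<delta>] continuous_map_from_subtopology) auto
  then have "connected T" by (simp add: T_def)
  moreover have "{s..\<alpha>} = insert \<alpha> {s..<\<alpha>}" "\<delta> x \<noteq> \<gamma> \<alpha>" for x using s(2) exit by (auto, metis rangeI)
  then have "T = {x. \<delta> x \<in> \<gamma> ` {s..\<alpha>}}" by (auto simp: T_def)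
  then have "closed T" using closed_preimage_compact_image[OF N \<gamma> open_embedding_continuous[OF \<delta>]] by simp
  moreover have "\<not> compact T"
  proof
    assume "compact T"
    then have "closed {t. \<gamma> t \<in> \<gamma> ` {s..<\<alpha>}}"
      unfolding image_T[symmetric]
      by (rule closed_preimage_compact_image[OF N \<delta> open_embedding_continuous[OF \<gamma>]])
    then have "closed {s..<\<alpha>}"
      unfolding inj_image_mem_iff[OF open_embedding_inj[OF \<gamma>]] by (simp only: Collect_mem_eq)
    then have "{s..<\<alpha>} = {s..\<alpha>}" using s(2) closure_atLeastLessThan[OF s(2)] by (simp add: closure_closed)
    then have "\<alpha> \<in> {s..<\<alpha>}" using s(2) by simp
    then show False by simp
  qed
  moreover have "r \<in> T" using s by (auto simp: T_def s(1)[symmetric])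
  moreover have "{s..<\<alpha>} = insert s {s<..<\<alpha>}" using s(2) by auto
  then have minus_r: "T - {r} = {x. \<delta> x \<in> \<gamma> ` {s<..<\<alpha>}}"
    using s(1) inj_eq[OF open_embedding_inj[OF \<delta>]] inj_eq[OF open_embedding_inj[OF \<gamma>]] by (auto simp: T_def)
  have "connected (T - {r})" unfolding minus_r by (rule connected_coord) auto
  ultimately have "T = {r..} \<or> T = {..r}" by (rule connected_closed_unbounded_half_line)
  then show ?thesis using image_T by metis
qed

lemma open_line_exit:
  fixes \<gamma> \<delta> :: "real \<Rightarrow> 'a"
  assumes N: "Hausdorff_space N" and \<gamma>: "open_embedding N \<gamma>" and \<delta>: "open_embedding N \<delta>"
    and s: "\<gamma> s = \<delta> r" "s < \<beta>" "\<gamma> \<beta> \<notin> range \<delta>"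
  obtains \<alpha> where "s < \<alpha>" "\<alpha> \<le> \<beta>" "\<gamma> \<alpha> \<notin> range \<delta>"
    "\<delta> ` {r..} = \<gamma> ` {s..<\<alpha>} \<or> \<delta> ` {..r} = \<gamma> ` {s..<\<alpha>}"
proof -
  have "open {t. \<gamma> t \<in> range \<delta>}"
    using openin_continuous_map_preimage[OF open_embedding_continuous[OF \<gamma>]
        openin_open_embedding_image[OF \<delta> open_UNIV]] by simp
  then obtain \<alpha> where \<alpha>: "s \<le> \<alpha>" "\<alpha> \<le> \<beta>" "\<gamma> \<alpha> \<notin> range \<delta>" "{s..<\<alpha>} \<subseteq> {t. \<gamma> t \<in> range \<delta>}"
    using first_exit_open[of "{t. \<gamma> t \<in> range \<delta>}" s \<beta>] s by auto
  have "\<alpha> \<noteq> s" using \<alpha>(3) s(1) by auto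
  with \<alpha>(1) have "s < \<alpha>" by simp
  moreover have "\<gamma> ` {s..<\<alpha>} \<subseteq> range \<delta>" using \<alpha>(4) by blast
  ultimately show ?thesis
    using open_line_exit_half_line[OF N \<gamma> \<delta> s(1) _ _ \<alpha>(3)] \<alpha>(2,3) by (intro that)
qed

lemma homeomorphic_space_same_fibres:
  assumes "compact_space X" "Hausdorff_space Y" "Hausdorff_space Z"
    and f: "continuous_map X Y f" "f ` topspace X = topspace Y"
    and g: "continuous_map X Z g" "g ` topspace X = topspace Z"
    and fibres: "\<And>x x'. x \<in> topspace X \<Longrightarrow> x' \<in> topspace X \<Longrightarrow> f x = f x' \<longleftrightarrow> g x = g x'"
  shows "Y homeomorphic_space Z"
proof -
  have "quotient_map X Y f" using assms(1,2) f by (intro continuous_imp_quotient_map)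
  then obtain h where h: "continuous_map Y Z h" "h ` topspace Y = topspace Z"
    and h_f: "\<And>x. x \<in> topspace X \<Longrightarrow> h (f x) = g x"
    using quotient_map_lift_exists[OF _ g(1)] fibres g(2) by metis
  have "inj_on h (topspace Y)"
  proof (rule inj_onI)
    fix y y' assume "y \<in> topspace Y" "y' \<in> topspace Y" "h y = h y'"
    then obtain x x' where "x \<in> topspace X" "x' \<in> topspace X" "y = f x" "y' = f x'" "g x = g x'"
      unfolding f(2)[symmetric] using h_f by auto
    then show "y = y'" using fibres by simp
  qed
  moreover have "compact_space Y"
    using image_compactin[OF assms(1)[unfolded compact_space_def] f(1)] f(2)
    by (simp add: compact_space_def)
  ultimately have "homeomorphic_map Y Z h" using continuous_imp_homeomorphic_map h assms(3) by blast
  then show ?thesis by (rule homeomorphic_map_imp_homeomorphic_space)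
qed

abbreviation unit_circle :: "complex topology" where
  "unit_circle \<equiv> top_of_set (sphere 0 1)"

lemma circlepath_eq_iff:
  assumes "u \<in> {0..1}" "v \<in> {0..1}"
  shows "circlepath 0 1 u = circlepath 0 1 v \<longleftrightarrow> u = v \<or> u = 0 \<and> v = 1 \<or> u = 1 \<and> v = 0"
proof -
  have "circlepath 0 1 0 = circlepath 0 1 1"
    using pathfinish_circlepath[of 0 1] pathstart_circlepath[of 0 1]
    by (simp add: pathfinish_def pathstart_def)
  moreover have "loop_free (circlepath 0 1)" using simple_path_circlepath by (simp add: simple_path_def)
  ultimately show ?thesis using assms unfolding loop_free_def by metis
qed

lemma homeomorphic_circle_of_loop:
  fixes w :: "real \<Rightarrow> 'a"
  assumes N: "Hausdorff_space N" and ab: "a < b" and w: "continuous_map (top_of_set {a..b}) N w"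
    and "w a = w b" "inj_on w {a..<b}" and onto: "w ` {a..b} = topspace N"
  shows "N homeomorphic_space unit_circle"
proof -
  let ?scale = "\<lambda>s. (s - a) / (b - a)"
  let ?c = "\<lambda>s. circlepath 0 1 (?scale s)"
  have scale: "?scale s \<in> {0..1}" if "s \<in> {a..b}" for s using that ab by (simp add: field_simps)
  have onto_scale: "?scale ` {a..b} = {0..1}"
  proof (intro equalityI subsetI)
    fix u :: real assume u: "u \<in> {0..1}"
    then have "u * (b - a) \<le> 1 * (b - a)" "0 \<le> u * (b - a)" using ab by (auto intro!: mult_right_mono)
    then have "a + u * (b - a) \<in> {a..b}" by auto
    moreover have "?scale (a + u * (b - a)) = u" using ab by simp
    ultimately show "u \<in> ?scale ` {a..b}" by (metis imageI)
  qed (use scale in auto)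
  have "continuous_on {0..1} (circlepath 0 1)" using path_circlepath by (simp add: path_def)
  then have "continuous_on {a..b} ?c"
    by (rule continuous_on_compose2) (use scale ab in \<open>auto intro!: continuous_intros\<close>)
  moreover have "?c ` {a..b} = circlepath 0 1 ` ?scale ` {a..b}" by (rule image_image[symmetric])
  then have "?c ` {a..b} = sphere 0 1"
    unfolding onto_scale using path_image_circlepath[of 0 1] by (simp add: path_image_def)
  moreover have "w x = w y \<longleftrightarrow> ?c x = ?c y" if xy: "x \<in> {a..b}" "y \<in> {a..b}" for x y
  proof -
    have "w x = w y \<longleftrightarrow> x = y \<or> x = a \<and> y = b \<or> x = b \<and> y = a"
      using ab xy inj_on_eq_iff[OF assms(5)]
      by (cases "x = b"; cases "y = b") (auto simp: assms(4)[symmetric])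
    moreover have "?c x = ?c y \<longleftrightarrow>
        ?scale x = ?scale y \<or> ?scale x = 0 \<and> ?scale y = 1 \<or> ?scale x = 1 \<and> ?scale y = 0"
      by (rule circlepath_eq_iff[OF scale[OF xy(1)] scale[OF xy(2)]])
    moreover have "?scale x = ?scale y \<longleftrightarrow> x = y" "?scale s = 0 \<longleftrightarrow> s = a" "?scale s = 1 \<longleftrightarrow> s = b" for s
      using ab by (auto simp: field_simps)
    ultimately show ?thesis using ab by auto
  qed
  ultimately show ?thesis
    using homeomorphic_space_same_fibres[of "top_of_set {a..b}" N "top_of_set (sphere 0 1)" w ?c] N w onto
    by (auto simp: compact_space_subtopology Hausdorff_space_subtopology continuous_map_in_subtopology)
qed

lemma range_eq_half_lines: "range \<delta> = \<delta> ` {..0::real} \<union> \<delta> ` {0..}"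
proof -
  have "(UNIV :: real set) = {..0} \<union> {0..}" by auto
  then show ?thesis by (metis image_Un)
qed

locale open_lines_meeting =
  fixes N :: "'a topology" and \<gamma> \<delta> :: "real \<Rightarrow> 'a" and \<alpha> :: real
  assumes Hausdorff: "Hausdorff_space N" and connected: "connected_space N"
    and \<gamma>: "open_embedding N \<gamma>" and \<delta>: "open_embedding N \<delta>" and meet: "\<gamma> 0 = \<delta> 0"
    and \<alpha>_neg: "\<alpha> < 0" and outside: "\<gamma> \<alpha> \<notin> range \<delta>" and ray: "\<delta> ` {..0} = \<gamma> ` {\<alpha><..0}"
begin

lemma \<gamma>_eq_iff [simp]: "\<gamma> t = \<gamma> t' \<longleftrightarrow> t = t'"
  using open_embedding_inj[OF \<gamma>] by (simp add: inj_eq)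

lemma \<delta>_eq_iff [simp]: "\<delta> t = \<delta> t' \<longleftrightarrow> t = t'"
  using open_embedding_inj[OF \<delta>] by (simp add: inj_eq)

lemma on_ray: "x \<le> 0 \<Longrightarrow> \<exists>s. \<alpha> < s \<and> s \<le> 0 \<and> \<delta> x = \<gamma> s"
  using imageI[of x "{..0}" \<delta>] unfolding ray by auto

lemma reentry_ray:
  assumes t: "t \<le> \<alpha>" "\<gamma> t = \<delta> r"
  obtains \<beta> where "t < \<beta>" "\<beta> \<le> \<alpha>" "\<delta> ` {r..} = \<gamma> ` {t..<\<beta>}"
proof -
  have "t < \<alpha>" using t outside by (metis less_le rangeI)
  then obtain \<beta> where \<beta>: "t < \<beta>" "\<beta> \<le> \<alpha>" "\<delta> ` {r..} = \<gamma> ` {t..<\<beta>} \<or> \<delta> ` {..r} = \<gamma> ` {t..<\<beta>}"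
    using open_line_exit[OF Hausdorff \<gamma> \<delta> t(2) _ outside] by metis
  obtain s where "\<alpha> < s" "\<delta> (min r 0) = \<gamma> s" using on_ray[of "min r 0"] by auto
  then have "\<delta> (min r 0) \<notin> \<gamma> ` {t..<\<beta>}" using \<beta>(2) by auto
  moreover have "\<delta> (min r 0) \<in> \<delta> ` {..r}" by simp
  ultimately show thesis using \<beta> that by metis
qed

lemma reentry_pos:
  assumes t: "t \<le> \<alpha>" "\<gamma> t = \<delta> r"
  shows "0 < r"
proof (rule ccontr)
  assume "\<not> 0 < r"
  then obtain s where "\<alpha> < s" "\<delta> r = \<gamma> s" using on_ray[of r] by auto
  then show False using t by simp
qed

lemma reentry_arcs_disjoint:
  assumes t: "t \<le> \<alpha>" "\<gamma> t = \<delta> r" and "t < s" "0 < x" "x \<le> r" "s \<le> 0"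
  shows "\<gamma> s \<noteq> \<delta> x"
proof
  assume sx: "\<gamma> s = \<delta> x"
  show False
  proof (cases "s \<le> \<alpha>")
    case True
    obtain \<beta> where "\<delta> ` {x..} = \<gamma> ` {s..<\<beta>}" by (rule reentry_ray[OF True sx])
    moreover have "\<delta> r \<in> \<delta> ` {x..}" using \<open>x \<le> r\<close> by simp
    ultimately have "\<gamma> t \<in> \<gamma> ` {s..<\<beta>}" using t(2) by metis
    then show False using \<open>t < s\<close> by auto
  next
    case False
    then have "\<gamma> s \<in> \<delta> ` {..0}" unfolding ray using \<open>s \<le> 0\<close> by simp
    then show False using sx \<open>0 < x\<close> by auto
  qed
qed

text \<open>The segments of \<open>\<gamma>\<close> and \<open>\<delta>\<close> between the two meeting points form a closed set, which is also
  the union of \<open>\<delta>\<close> with an open segment of \<open>\<gamma>\<close>.\<close>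

lemma reentry_arcs_cover:
  assumes t: "t \<le> \<alpha>" "\<gamma> t = \<delta> r"
  shows "\<gamma> ` {t..0} \<union> \<delta> ` {0..r} = topspace N"
proof -
  let ?L = "\<gamma> ` {t..0} \<union> \<delta> ` {0..r}"
  obtain \<beta> where \<beta>: "\<beta> \<le> \<alpha>" "\<delta> ` {r..} = \<gamma> ` {t..<\<beta>}" by (rule reentry_ray[OF t])
  then have "\<delta> ` {r..} \<subseteq> \<gamma> ` {t..0}" "\<delta> ` {..0} \<subseteq> \<gamma> ` {t..0}"
    unfolding ray using t(1) \<alpha>_neg by (auto intro!: image_mono)
  moreover have "{0..} \<subseteq> {0..r} \<union> {r..}" by auto
  then have "\<delta> ` {0..} \<subseteq> \<delta> ` {0..r} \<union> \<delta> ` {r..}" unfolding image_Un[symmetric] by (rule image_mono)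
  ultimately have "range \<delta> \<subseteq> ?L" unfolding range_eq_half_lines[of \<delta>] by blast
  moreover have "{t..0} = {t<..<0} \<union> {t, 0}" using t(1) \<alpha>_neg by auto
  then have "\<gamma> ` {t..0} \<subseteq> \<gamma> ` {t<..<0} \<union> range \<delta>" using t(2) meet by auto
  ultimately have "?L = range \<delta> \<union> \<gamma> ` {t<..<0}" by auto
  then have "openin N ?L"
    using openin_open_embedding_image[OF \<gamma>, of "{t<..<0}"] openin_open_embedding_image[OF \<delta> open_UNIV]
    by auto
  moreover have "closedin N ?L"
    using closedin_open_embedding_image[OF Hausdorff \<gamma>] closedin_open_embedding_image[OF Hausdorff \<delta>]
    by auto
  moreover have "?L \<noteq> {}" using t(1) \<alpha>_neg by auto
  ultimately show ?thesis using connected unfolding connected_space_clopen_in by blast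
qed

definition glued :: "real \<Rightarrow> 'a" where
  "glued t = (if t \<le> 0 then \<gamma> t else \<delta> t)"

lemma glued_nonpos: "t \<le> 0 \<Longrightarrow> glued t = \<gamma> t"
  by (simp add: glued_def)

lemma glued_nonneg: "0 \<le> t \<Longrightarrow> glued t = \<delta> t"
  using meet by (auto simp: glued_def)

lemma continuous_map_glued: "continuous_map euclidean N glued"
proof -
  have "continuous_map (top_of_set UNIV) N (\<lambda>t. if t \<le> 0 then \<gamma> t else \<delta> t)"
    by (rule continuous_map_cases_le_on)
      (use meet open_embedding_continuous[OF \<gamma>] open_embedding_continuous[OF \<delta>] in
        \<open>auto intro: continuous_map_from_subtopology continuous_on_id\<close>)
  then show ?thesis by (simp add: glued_def[abs_def])
qed

lemma homeomorphic_circle_if_reentry: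
  assumes t: "t \<le> \<alpha>" "\<gamma> t = \<delta> r"
  shows "N homeomorphic_space unit_circle"
proof (rule homeomorphic_circle_of_loop[OF Hausdorff])
  have r: "0 < r" by (rule reentry_pos[OF t])
  show "t < r" using t(1) \<alpha>_neg r by simp
  show "continuous_map (top_of_set {t..r}) N glued"
    by (rule continuous_map_from_subtopology[OF continuous_map_glued])
  show "glued t = glued r" using t \<alpha>_neg r by (simp add: glued_def)
  have disjoint: "\<gamma> s \<noteq> \<delta> x" if "t \<le> s" "s \<le> 0" "0 < x" "x < r" for s x
    using that reentry_arcs_disjoint[OF t, of s x] t(2) by (cases "s = t") auto
  show "inj_on glued {t..<r}"
  proof (rule inj_onI)
    fix x y assume "x \<in> {t..<r}" "y \<in> {t..<r}" "glued x = glued y"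
    then show "x = y" using disjoint[of x y] disjoint[of y x] by (auto simp: glued_def split: if_splits)
  qed
  have "glued ` {t..0} = \<gamma> ` {t..0}" "glued ` {0..r} = \<delta> ` {0..r}"
    by (intro image_cong; simp add: glued_nonpos glued_nonneg)+
  moreover have "{t..r} = {t..0} \<union> {0..r}" using t(1) \<alpha>_neg r by auto
  ultimately show "glued ` {t..r} = topspace N" using reentry_arcs_cover[OF t] by (simp add: image_Un)
qed

lemma stays_inside:
  assumes "\<not> range \<delta> \<subseteq> range \<gamma>" "0 \<le> t"
  shows "\<gamma> t \<in> range \<delta>"
proof (rule ccontr)
  assume t: "\<gamma> t \<notin> range \<delta>"
  then have "0 < t" using assms(2) meet by (metis less_le rangeI)
  then obtain \<beta> where \<beta>: "\<delta> ` {0..} = \<gamma> ` {0..<\<beta>} \<or> \<delta> ` {..0} = \<gamma> ` {0..<\<beta>}"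
    using open_line_exit[OF Hausdorff \<gamma> \<delta> meet _ t] by metis
  have "\<gamma> (\<alpha>/2) \<in> \<delta> ` {..0}" unfolding ray using \<alpha>_neg by (intro imageI) simp
  moreover have "\<gamma> (\<alpha>/2) \<notin> \<gamma> ` {0..<\<beta>}" using \<alpha>_neg by auto
  ultimately have "\<delta> ` {0..} = \<gamma> ` {0..<\<beta>}" using \<beta> by metis
  then have "range \<delta> \<subseteq> range \<gamma>" unfolding range_eq_half_lines[of \<delta>] ray by auto
  then show False using assms(1) by blast
qed

lemma open_embedding_glued:
  assumes "\<And>t. t \<le> \<alpha> \<Longrightarrow> \<gamma> t \<notin> range \<delta>"
  shows "open_embedding N glued"
proof (rule open_embedding_of_injective_line[OF continuous_map_glued])
  have disjoint: "\<gamma> t \<noteq> \<delta> t'" if "t \<le> 0" "0 < t'" for t t'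
  proof (cases "t \<le> \<alpha>")
    case True
    then show ?thesis using assms by (metis rangeI)
  next
    case False
    then have "\<gamma> t \<in> \<delta> ` {..0}" unfolding ray using that(1) by simp
    then show ?thesis using that(2) by auto
  qed
  show "inj glued"
  proof (rule injI)
    show "t = t'" if "glued t = glued t'" for t t'
      using that disjoint[of t t'] disjoint[of t' t] by (auto simp: glued_def split: if_splits)
  qed
  show "\<exists>\<epsilon> :: real \<Rightarrow> 'a. open_embedding N \<epsilon> \<and> glued t \<in> range \<epsilon>" for t
    using \<gamma> \<delta> by (auto simp: glued_def)
qed

lemma range_glued:
  assumes "\<not> range \<delta> \<subseteq> range \<gamma>"
  shows "range glued = range \<gamma> \<union> range \<delta>"
proof -
  have "glued ` {..0} = \<gamma> ` {..0}" "glued ` {0..} = \<delta> ` {0..}"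
    by (intro image_cong; simp add: glued_nonpos glued_nonneg)+
  then have "range glued = \<gamma> ` {..0} \<union> \<delta> ` {0..}" unfolding range_eq_half_lines[of glued] by simp
  moreover have "A \<union> D = (A \<union> B) \<union> (C \<union> D)" if "C \<subseteq> A" "B \<subseteq> C \<union> D" for A B C D :: "'a set"
    using that by blast
  moreover have "\<delta> ` {..0} \<subseteq> \<gamma> ` {..0}" unfolding ray by auto
  moreover have "\<gamma> ` {0..} \<subseteq> \<delta> ` {..0} \<union> \<delta> ` {0..}"
    unfolding range_eq_half_lines[of \<delta>, symmetric] using stays_inside[OF assms] by auto
  ultimately show ?thesis
    unfolding range_eq_half_lines[of \<gamma>] range_eq_half_lines[of \<delta>] by simp
qed

lemma union_open_line_or_circle:
  assumes "\<not> range \<delta> \<subseteq> range \<gamma>"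
  shows "(\<exists>\<omega> :: real \<Rightarrow> 'a. open_embedding N \<omega> \<and> range \<omega> = range \<gamma> \<union> range \<delta>) \<or>
    N homeomorphic_space unit_circle"
proof (cases "\<exists>t\<le>\<alpha>. \<gamma> t \<in> range \<delta>")
  case True
  then show ?thesis using homeomorphic_circle_if_reentry by blast
next
  case False
  then show ?thesis using open_embedding_glued range_glued[OF assms] by blast
qed

end

lemma open_lines_union_at:
  fixes \<gamma> \<delta> :: "real \<Rightarrow> 'a"
  assumes N: "Hausdorff_space N" "connected_space N" and \<gamma>: "open_embedding N \<gamma>" and \<delta>: "open_embedding N \<delta>"
    and meet: "\<gamma> 0 = \<delta> r" and \<alpha>: "\<alpha> < 0" "\<gamma> \<alpha> \<notin> range \<delta>"
    and ray: "\<delta> ` {r..} = \<gamma> ` {\<alpha><..0} \<or> \<delta> ` {..r} = \<gamma> ` {\<alpha><..0}"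
    and not_sub: "\<not> range \<delta> \<subseteq> range \<gamma>"
  shows "(\<exists>\<omega> :: real \<Rightarrow> 'a. open_embedding N \<omega> \<and> range \<omega> = range \<gamma> \<union> range \<delta>) \<or>
    N homeomorphic_space unit_circle"
proof -
  have glue: ?thesis if "\<sigma> \<noteq> 0" and ray: "(\<lambda>x. \<delta> (r + \<sigma> * x)) ` {..0} = \<gamma> ` {\<alpha><..0}" for \<sigma>
  proof -
    have range: "range (\<lambda>x. \<delta> (r + \<sigma> * x)) = range \<delta>" by (rule range_affine[OF \<open>\<sigma> \<noteq> 0\<close>])
    interpret open_lines_meeting N \<gamma> "\<lambda>x. \<delta> (r + \<sigma> * x)" \<alpha>
      using N \<gamma> open_embedding_affine[OF \<delta> \<open>\<sigma> \<noteq> 0\<close>] meet \<alpha> ray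
      by unfold_locales (simp_all add: range)
    show ?thesis using union_open_line_or_circle not_sub unfolding range .
  qed
  have "(\<lambda>x. \<delta> (r + \<sigma> * x)) ` {..0} = \<delta> ` S" if "(\<lambda>x. r + \<sigma> * x) ` {..0} = S" for \<sigma> S
    unfolding that[symmetric] by (simp only: image_image)
  from this[of 1 "{..r}"] this[of "- 1" "{r..}"] show ?thesis using ray glue[of 1] glue[of "- 1"] by auto
qed

lemma open_lines_union:
  fixes \<gamma> \<delta> :: "real \<Rightarrow> 'a"
  assumes N: "Hausdorff_space N" "connected_space N" and \<gamma>: "open_embedding N \<gamma>" and \<delta>: "open_embedding N \<delta>"
    and meet: "range \<gamma> \<inter> range \<delta> \<noteq> {}"
  shows "(\<exists>\<omega> :: real \<Rightarrow> 'a. open_embedding N \<omega> \<and> range \<omega> = range \<gamma> \<union> range \<delta>) \<or>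
    N homeomorphic_space unit_circle"
proof (cases "range \<gamma> \<subseteq> range \<delta> \<or> range \<delta> \<subseteq> range \<gamma>")
  case True
  then show ?thesis using \<gamma> \<delta> by (metis sup.absorb1 sup.absorb2)
next
  case False
  then obtain t where t: "\<gamma> t \<notin> range \<delta>" by blast
  obtain s r where s: "\<gamma> s = \<delta> r" using meet by blast
  \<comment> \<open>In the parameter \<open>(x - s) / (s - t)\<close> the line \<open>\<gamma>\<close> meets \<open>\<delta>\<close> at 0 and is off \<open>\<delta>\<close> at -1.\<close>
  define a where "a = s - t"
  have "a \<noteq> 0" using s t by (auto simp: a_def)
  let ?forward = "\<lambda>x. \<gamma> (s + a * x)" and ?backward = "\<lambda>x. \<gamma> (s + (- a) * x)"
  have forward: "open_embedding N ?forward" and backward: "open_embedding N ?backward"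
    by (rule open_embedding_affine[OF \<gamma>]; use \<open>a \<noteq> 0\<close> in simp)+
  have "?backward 0 = \<delta> r" "?backward 1 \<notin> range \<delta>" using s t by (simp_all add: a_def)
  then obtain \<beta> where \<beta>: "0 < \<beta>" "?backward \<beta> \<notin> range \<delta>"
      "\<delta> ` {r..} = ?backward ` {0..<\<beta>} \<or> \<delta> ` {..r} = ?backward ` {0..<\<beta>}"
    using open_line_exit[OF N(1) backward \<delta>, of 0 r 1] by (metis zero_less_one)
  have "?backward ` {0..<\<beta>} = ?forward ` uminus ` {0..<\<beta>}" unfolding image_image by simp
  also have "\<dots> = ?forward ` {- \<beta><..0}" by simp
  finally have "\<delta> ` {r..} = ?forward ` {- \<beta><..0} \<or> \<delta> ` {..r} = ?forward ` {- \<beta><..0}"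
    using \<beta>(3) by metis
  moreover have "range ?forward = range \<gamma>" by (rule range_affine[OF \<open>a \<noteq> 0\<close>])
  ultimately show ?thesis
    using open_lines_union_at[OF N forward \<delta>, of r "- \<beta>"] \<beta>(1,2) s False by auto
qed

lemma compact_connected_subset_of_member:
  assumes K: "compactin N K" "connectedin N K" "p \<in> K"
    and \<L>_open: "\<And>U. U \<in> \<L> \<Longrightarrow> openin N U" and cover: "K \<subseteq> \<Union>\<L>"
    and union: "\<And>U V. U \<in> \<L> \<Longrightarrow> V \<in> \<L> \<Longrightarrow> U \<inter> V \<noteq> {} \<Longrightarrow> U \<union> V \<in> \<L>"
  shows "\<exists>U\<in>\<L>. K \<subseteq> U"
proof -
  define \<C> where "\<C> = {U \<in> \<L>. p \<in> U}"
  have "K \<subseteq> \<Union>\<C>"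
  proof -
    let ?rest = "\<Union>{V \<in> \<L>. V \<inter> \<Union>\<C> = {}}"
    have covered: "x \<in> \<Union>\<C> \<union> ?rest" if x: "x \<in> K" for x
    proof -
      obtain V where V: "V \<in> \<L>" "x \<in> V" using cover x by blast
      have "U \<union> V \<in> \<C>" if "U \<in> \<C>" "U \<inter> V \<noteq> {}" for U using that union V(1) by (auto simp: \<C>_def)
      then show ?thesis using V by blast
    qed
    have "openin N (\<Union>\<C>)" "openin N ?rest" using \<L>_open by (auto simp: \<C>_def)
    moreover have "p \<in> K \<inter> \<Union>\<C>" using cover K(3) by (auto simp: \<C>_def)
    moreover have "K \<subseteq> \<Union>\<C> \<union> ?rest" using covered by blast
    ultimately have "?rest \<inter> K = {}" using K(2) unfolding connectedin by blast
    then show ?thesis using covered by blast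
  qed
  moreover have "\<forall>U\<in>\<C>. openin N U" using \<L>_open by (simp add: \<C>_def)
  ultimately obtain F where F: "finite F" "F \<subseteq> \<C>" "K \<subseteq> \<Union>F" using K(1) unfolding compactin_def by metis
  have "F \<noteq> {}" using F(3) K(3) by blast
  with F(1) have "\<Union>F \<in> \<C>" using F(2)
  proof (induction F rule: finite_ne_induct)
    case (insert U F)
    then show ?case using union[of U "\<Union>F"] by (auto simp: \<C>_def)
  qed simp
  then show ?thesis using F(3) unfolding \<C>_def by blast
qed

lemma compact_connected_in_open_line:
  assumes N: "smooth_manifold N TYPE('n::finite)" "connected_space N" and n: "CARD('n) = 1"
    and not_circle: "\<not> N homeomorphic_space unit_circle"
    and K: "compactin N K" "connectedin N K" "p \<in> K"
  obtains \<gamma> :: "real \<Rightarrow> 'a" where "open_embedding N \<gamma>" "K \<subseteq> range \<gamma>"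
proof -
  let ?\<L> = "{range \<gamma> | \<gamma> :: real \<Rightarrow> 'a. open_embedding N \<gamma>}"
  have haus: "Hausdorff_space N" using N(1) by (simp add: smooth_manifold_def)
  have dim: "DIM(real) = CARD('n)" using n by simp
  have "\<exists>U\<in>?\<L>. K \<subseteq> U"
  proof (rule compact_connected_subset_of_member[OF K])
    show "openin N U" if "U \<in> ?\<L>" for U using that openin_open_embedding_image[OF _ open_UNIV] by blast
    show "K \<subseteq> \<Union>?\<L>"
    proof
      fix x assume "x \<in> K"
      then have x: "x \<in> topspace N" using compactin_subset_topspace[OF K(1)] by blast
      obtain \<gamma> :: "real \<Rightarrow> 'a" where "open_embedding N \<gamma>" "x \<in> range \<gamma>"
        by (rule manifold_open_embedding[OF N(1) dim openin_topspace x])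
      then show "x \<in> \<Union>?\<L>" by blast
    qed
    fix U V assume "U \<in> ?\<L>" "V \<in> ?\<L>" "U \<inter> V \<noteq> {}"
    then obtain \<gamma> \<delta> :: "real \<Rightarrow> 'a" where \<gamma>: "open_embedding N \<gamma>" "U = range \<gamma>"
      and \<delta>: "open_embedding N \<delta>" "V = range \<delta>" and "range \<gamma> \<inter> range \<delta> \<noteq> {}" by blast
    then obtain \<omega> :: "real \<Rightarrow> 'a" where "open_embedding N \<omega>" "range \<omega> = U \<union> V"
      using open_lines_union[OF haus N(2) \<gamma>(1) \<delta>(1)] not_circle by blast
    then show "U \<union> V \<in> ?\<L>" by (intro CollectI exI[of _ \<omega>]) simp
  qed
  then show thesis using that by blast
qed

lemma null_htpc_in_open_embedding:
  fixes \<psi> :: "'e::real_normed_vector \<Rightarrow> 'a"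
  assumes m: "m \<ge> 1" and \<psi>: "open_embedding N \<psi>" and f: "f \<in> based_maps m N p" "f ` cube m \<subseteq> range \<psi>"
  shows "based_htpc m N p f (\<lambda>x\<in>cube m. p)"
proof -
  have p: "p \<in> range \<psi>" using f(2) based_maps_bd[OF f(1) zero_in_cube_bd[OF m]] zero_in_cube by blast
  let ?line = "\<lambda>z. (1 - fst z) *\<^sub>R coord \<psi> (f (snd z)) + fst z *\<^sub>R coord \<psi> p"
  have "continuous_on (cube m) (\<lambda>x. coord \<psi> (f x))"
    by (rule continuous_on_coord_open_embedding[OF \<psi> based_maps_continuous[OF f(1)] f(2)])
  then have "continuous_on ({0..1} \<times> cube m) (\<lambda>z. coord \<psi> (f (snd z)))"
    by (rule continuous_on_compose2) (auto intro!: continuous_intros)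
  then have "continuous_on ({0..1::real} \<times> cube m) ?line" by (intro continuous_intros)
  then have "continuous_map (top_of_set ({0..1::real} \<times> cube m)) N (\<lambda>z. \<psi> (?line z))"
    by (rule continuous_map_compose_continuous_on[of UNIV, rotated])
      (use open_embedding_continuous[OF \<psi>] in auto)
  moreover have "\<psi> (?line (0, x)) = f x \<and> \<psi> (?line (1, x)) = (\<lambda>x\<in>cube m. p) x" if "x \<in> cube m" for x
    using that f(2) p by (auto simp: f_inv_into_f)
  moreover have "\<psi> (?line (t, x)) = p" if "x \<in> cube_bd m" for t x
    using based_maps_bd[OF f(1) that] p by (simp add: scaleR_left_distrib[symmetric] f_inv_into_f)
  ultimately show ?thesis
    unfolding based_htpc_iff_homotopy_along homotopy_along_def by (intro exI[of _ "\<lambda>z. \<psi> (?line z)"]) blast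
qed

lemma null_htpc_dim_1:
  assumes "smooth_manifold N TYPE('n::finite)" "connected_space N" "CARD('n) = 1"
    and "\<not> N homeomorphic_space unit_circle"
    and m: "m \<ge> 1" and f: "f \<in> based_maps m N p"
  shows "based_htpc m N p f (\<lambda>x\<in>cube m. p)"
proof -
  obtain \<gamma> :: "real \<Rightarrow> 'a" where "open_embedding N \<gamma>" "f ` cube m \<subseteq> range \<gamma>"
    by (rule compact_connected_in_open_line[OF assms(1-4) compactin_based_map_image[OF f]
        connectedin_based_map_image[OF f] imageI[OF zero_in_cube]])
  then show ?thesis by (rule null_htpc_in_open_embedding[OF m _ f])
qed

lemma circle_coordinates:
  assumes "N homeomorphic_space unit_circle"
  obtains \<phi> \<theta> where "continuous_map N euclidean \<phi>" "continuous_map unit_circle N \<theta>"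
    "\<And>x. x \<in> topspace N \<Longrightarrow> norm (\<phi> x) = 1" "\<And>x. x \<in> topspace N \<Longrightarrow> \<theta> (\<phi> x) = x"
    "\<And>w. w \<in> sphere 0 1 \<Longrightarrow> \<phi> (\<theta> w) = w"
proof -
  obtain \<phi> \<theta> where "homeomorphic_maps N unit_circle \<phi> \<theta>"
    using assms by (auto simp: homeomorphic_space_def)
  then show ?thesis
    by (intro that[of \<phi> \<theta>])
      (auto simp: homeomorphic_maps_def continuous_map_in_subtopology image_subset_iff Pi_iff)
qed

lemma circle_free_imp_based_htpc:
  assumes N: "N homeomorphic_space unit_circle" and m: "m \<ge> 1"
    and f: "f \<in> based_maps m N b" and g: "g \<in> based_maps m N b" and fg: "free_htpc m N f g"
  shows "based_htpc m N b f g"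
proof -
  obtain \<phi> \<theta> where \<phi>: "continuous_map N euclidean \<phi>" and \<theta>: "continuous_map unit_circle N \<theta>"
    and \<phi>_sphere: "\<And>x. x \<in> topspace N \<Longrightarrow> norm (\<phi> x) = 1" and \<theta>_\<phi>: "\<And>x. x \<in> topspace N \<Longrightarrow> \<theta> (\<phi> x) = x"
    using N by (rule circle_coordinates) (rule that)
  obtain \<gamma> where along: "homotopy_along m N \<gamma> f g" using fg unfolding free_htpc_iff_homotopy_along by blast
  then have \<gamma>: "pathin N \<gamma>" "\<gamma> 0 = b" "\<gamma> 1 = b" by (rule homotopy_along_path[OF m _ f g])+
  obtain h where h: "continuous_map (top_of_set ({0..1} \<times> cube m)) N h"
    and ends: "\<forall>x\<in>cube m. h (0, x) = f x \<and> h (1, x) = g x"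
    and bd: "\<forall>t\<in>{0..1}. \<forall>x\<in>cube_bd m. h (t, x) = \<gamma> t"
    using along unfolding homotopy_along_def by blast
  have b: "b \<in> topspace N" by (rule based_maps_base_in_topspace[OF m f])
  have hN: "h z \<in> topspace N" if "z \<in> {0..1} \<times> cube m" for z using h that by (auto simp: continuous_map_def)
  have \<gamma>N: "\<gamma> t \<in> topspace N" if "t \<in> {0..1}" for t using \<gamma>(1) that
    by (auto simp: pathin_def continuous_map_def)
  have \<phi>_nonzero: "\<phi> x \<noteq> 0" if "x \<in> topspace N" for x using \<phi>_sphere[OF that] by auto
  let ?rotated = "\<lambda>z. \<phi> (h z) / \<phi> (\<gamma> (fst z)) * \<phi> b"
  have "continuous_on ({0..1} \<times> cube m) (\<lambda>z. \<phi> (h z))"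
    using continuous_map_compose[OF h \<phi>] by (simp add: o_def)
  moreover have "continuous_on ({0..1} \<times> cube m) (\<lambda>z. \<phi> (\<gamma> (fst z)))"
    by (rule continuous_on_compose2[of "{0..1}" "\<lambda>t. \<phi> (\<gamma> t)"])
      (use continuous_map_compose[OF \<gamma>(1)[unfolded pathin_def] \<phi>] in
        \<open>auto simp: o_def intro!: continuous_intros\<close>)
  ultimately have "continuous_on ({0..1} \<times> cube m) ?rotated"
    using \<phi>_nonzero \<gamma>N by (intro continuous_on_mult continuous_on_divide continuous_on_const) auto
  moreover have "?rotated z \<in> sphere 0 1" if "z \<in> {0..1} \<times> cube m" for z
    using \<phi>_sphere[OF hN[OF that]] \<phi>_sphere[OF \<gamma>N[of "fst z"]] \<phi>_sphere[OF b] that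
    by (auto simp: norm_mult norm_divide)
  ultimately have "continuous_map (top_of_set ({0..1} \<times> cube m)) N (\<lambda>z. \<theta> (?rotated z))"
    by (rule continuous_map_compose_continuous_on[OF \<theta>])
  moreover have "\<theta> (?rotated (0, x)) = f x \<and> \<theta> (?rotated (1, x)) = g x" if "x \<in> cube m" for x
    using that hN[of "(0, x)"] hN[of "(1, x)"] ends \<gamma>(2,3) \<phi>_nonzero[OF b] \<theta>_\<phi> by auto
  moreover have "\<theta> (?rotated (t, x)) = b" if "t \<in> {0..1}" "x \<in> cube_bd m" for t x
    using that bd \<phi>_nonzero[OF \<gamma>N] \<theta>_\<phi>[OF b] by simp
  ultimately show ?thesis
    unfolding based_htpc_iff_homotopy_along homotopy_along_def
    by (intro exI[of _ "\<lambda>z. \<theta> (?rotated z)"]) blast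
qed

text \<open>The second path is the first one multiplied by a path in the punctured circle.\<close>

lemma disjoint_paths_unit_circle:
  fixes p\<^sub>1 p\<^sub>2 b\<^sub>1 b\<^sub>2 :: complex
  assumes unit: "norm p\<^sub>1 = 1" "norm p\<^sub>2 = 1" "norm b\<^sub>1 = 1" "norm b\<^sub>2 = 1" and ne: "p\<^sub>1 \<noteq> p\<^sub>2" "b\<^sub>1 \<noteq> b\<^sub>2"
  obtains \<delta> \<epsilon> :: "real \<Rightarrow> complex" where "continuous_on {0..1} \<delta>" "\<delta> ` {0..1} \<subseteq> sphere 0 1" "\<delta> 0 = p\<^sub>1"
      "\<delta> 1 = b\<^sub>1"
    "continuous_on {0..1} \<epsilon>" "\<epsilon> ` {0..1} \<subseteq> sphere 0 1" "\<epsilon> 0 = p\<^sub>2" "\<epsilon> 1 = b\<^sub>2"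
    "\<And>t. t \<in> {0..1} \<Longrightarrow> \<delta> t \<noteq> \<epsilon> t"
proof -
  have "path_connected (sphere (0::complex) 1)" by (rule path_connected_sphere) simp
  then obtain \<delta> where \<delta>: "path \<delta>" "path_image \<delta> \<subseteq> sphere 0 1" "\<delta> 0 = p\<^sub>1" "\<delta> 1 = b\<^sub>1"
    using unit unfolding path_connected_def pathstart_def pathfinish_def by (metis mem_sphere_0)
  have "(sphere (0::complex) 1 - {1}) homeomorphic {x. (1::complex) \<bullet> x = 0}"
    by (rule homeomorphic_punctured_sphere_hyperplane) auto
  then have "path_connected (sphere (0::complex) 1 - {1})"
    by (rule homeomorphic_path_connectedness[THEN iffD2])
      (intro convex_imp_path_connected convex_hyperplane)
  moreover have "p\<^sub>2 / p\<^sub>1 \<in> sphere 0 1 - {1}" "b\<^sub>2 / b\<^sub>1 \<in> sphere 0 1 - {1}"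
    using unit ne by (auto simp: norm_divide)
  ultimately obtain \<rho> where \<rho>: "path \<rho>" "path_image \<rho> \<subseteq> sphere 0 1 - {1}" "\<rho> 0 = p\<^sub>2 / p\<^sub>1"
    "\<rho> 1 = b\<^sub>2 / b\<^sub>1"
    unfolding path_connected_def pathstart_def pathfinish_def by metis
  have \<delta>_unit: "norm (\<delta> t) = 1" and \<rho>_unit: "norm (\<rho> t) = 1" "\<rho> t \<noteq> 1" if "t \<in> {0..1}" for t
    using \<delta>(2) \<rho>(2) that unfolding path_image_def by (auto simp: image_subset_iff)
  show ?thesis
  proof
    show "continuous_on {0..1} \<delta>" "\<delta> ` {0..1} \<subseteq> sphere 0 1" "\<delta> 0 = p\<^sub>1" "\<delta> 1 = b\<^sub>1"
      using \<delta> by (simp_all add: path_def path_image_def)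
    show "continuous_on {0..1} (\<lambda>t. \<delta> t * \<rho> t)"
      using \<delta>(1) \<rho>(1) unfolding path_def by (rule continuous_on_mult)
    show "(\<lambda>t. \<delta> t * \<rho> t) ` {0..1} \<subseteq> sphere 0 1" using \<delta>_unit \<rho>_unit by (auto simp: norm_mult)
    show "\<delta> 0 * \<rho> 0 = p\<^sub>2" "\<delta> 1 * \<rho> 1 = b\<^sub>2" using \<delta>(3,4) \<rho>(3,4) unit by auto
    show "\<delta> t \<noteq> \<delta> t * \<rho> t" if "t \<in> {0..1}" for t using \<delta>_unit[OF that] \<rho>_unit[OF that] by auto
  qed
qed

lemma circle_disjoint_paths:
  assumes N: "N homeomorphic_space unit_circle"
    and pts: "p\<^sub>1 \<in> topspace N" "p\<^sub>2 \<in> topspace N" "b\<^sub>1 \<in> topspace N" "b\<^sub>2 \<in> topspace N" "p\<^sub>1 \<noteq> p\<^sub>2"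
      "b\<^sub>1 \<noteq> b\<^sub>2"
  obtains \<delta> \<epsilon> where "pathin N \<delta>" "\<delta> 0 = p\<^sub>1" "\<delta> 1 = b\<^sub>1" "pathin N \<epsilon>" "\<epsilon> 0 = p\<^sub>2" "\<epsilon> 1 = b\<^sub>2"
    "\<And>t. t \<in> {0..1} \<Longrightarrow> \<delta> t \<noteq> \<epsilon> t"
proof -
  obtain \<phi> \<theta> where \<theta>: "continuous_map unit_circle N \<theta>" and \<phi>_sphere: "\<And>x. x \<in> topspace N \<Longrightarrow> norm (\<phi> x) = 1"
    and \<theta>_\<phi>: "\<And>x. x \<in> topspace N \<Longrightarrow> \<theta> (\<phi> x) = x" and \<phi>_\<theta>: "\<And>w. w \<in> sphere 0 1 \<Longrightarrow> \<phi> (\<theta> w) = w"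
    using N by (rule circle_coordinates) (rule that)
  have \<phi>_inj: "\<phi> x \<noteq> \<phi> y" if "x \<in> topspace N" "y \<in> topspace N" "x \<noteq> y" for x y using that \<theta>_\<phi> by metis
  obtain \<delta> \<epsilon> :: "real \<Rightarrow> complex" where \<delta>: "continuous_on {0..1} \<delta>" "\<delta> ` {0..1} \<subseteq> sphere 0 1"
    "\<delta> 0 = \<phi> p\<^sub>1" "\<delta> 1 = \<phi> b\<^sub>1"
    and \<epsilon>: "continuous_on {0..1} \<epsilon>" "\<epsilon> ` {0..1} \<subseteq> sphere 0 1" "\<epsilon> 0 = \<phi> p\<^sub>2" "\<epsilon> 1 = \<phi> b\<^sub>2"
    and disjoint: "\<And>t. t \<in> {0..1} \<Longrightarrow> \<delta> t \<noteq> \<epsilon> t"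
    by (rule disjoint_paths_unit_circle[of "\<phi> p\<^sub>1" "\<phi> p\<^sub>2" "\<phi> b\<^sub>1" "\<phi> b\<^sub>2"])
      (use \<phi>_sphere \<phi>_inj pts in auto)
  show ?thesis
  proof
    show "pathin N (\<lambda>t. \<theta> (\<delta> t))" "pathin N (\<lambda>t. \<theta> (\<epsilon> t))"
      unfolding pathin_def using \<delta>(1,2) \<epsilon>(1,2) by (auto intro!: continuous_map_compose_continuous_on[OF \<theta>])
    show "\<theta> (\<delta> 0) = p\<^sub>1" "\<theta> (\<delta> 1) = b\<^sub>1" "\<theta> (\<epsilon> 0) = p\<^sub>2" "\<theta> (\<epsilon> 1) = b\<^sub>2"
      using \<delta>(3,4) \<epsilon>(3,4) \<theta>_\<phi> pts by simp_all
    show "\<theta> (\<delta> t) \<noteq> \<theta> (\<epsilon> t)" if "t \<in> {0..1}" for t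
      using disjoint[OF that] \<phi>_\<theta> \<delta>(2) \<epsilon>(2) that by (metis image_subset_iff)
  qed
qed

section \<open>Goursat's lemma\<close>

definition relation_kernel ::
  "('a, 'm) monoid_scheme \<Rightarrow> ('b, 'n) monoid_scheme \<Rightarrow> ('a \<Rightarrow> 'b \<Rightarrow> bool) \<Rightarrow> 'a set" where
  "relation_kernel G H L = {a \<in> carrier G. L a \<one>\<^bsub>H\<^esub>}"

definition relation_domain ::
  "('a, 'm) monoid_scheme \<Rightarrow> ('b, 'n) monoid_scheme \<Rightarrow> ('a \<Rightarrow> 'b \<Rightarrow> bool) \<Rightarrow> 'a set" where
  "relation_domain G H L = {a \<in> carrier G. \<exists>b\<in>carrier H. L a b}"

locale group_relation = G: group G + H: group H
  for G :: "('a, 'm) monoid_scheme" and H :: "('b, 'n) monoid_scheme" +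
  fixes L :: "'a \<Rightarrow> 'b \<Rightarrow> bool"
  assumes related_one: "L \<one>\<^bsub>G\<^esub> \<one>\<^bsub>H\<^esub>"
    and related_mult: "\<lbrakk>a \<in> carrier G; b \<in> carrier H; a' \<in> carrier G; b' \<in> carrier H; L a b; L a' b'\<rbrakk>
        \<Longrightarrow> L (a \<otimes>\<^bsub>G\<^esub> a') (b \<otimes>\<^bsub>H\<^esub> b')"
    and related_inv: "\<lbrakk>a \<in> carrier G; b \<in> carrier H; L a b\<rbrakk> \<Longrightarrow> L (inv\<^bsub>G\<^esub> a) (inv\<^bsub>H\<^esub> b)"
begin

abbreviation "K\<^sub>1 \<equiv> relation_kernel G H L"
abbreviation "D\<^sub>1 \<equiv> relation_domain G H L"
abbreviation "K\<^sub>2 \<equiv> relation_kernel H G L\<inverse>\<inverse>"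
abbreviation "D\<^sub>2 \<equiv> relation_domain H G L\<inverse>\<inverse>"

lemma group_relation_converse: "group_relation H G L\<inverse>\<inverse>"
  by unfold_locales (simp_all add: related_one related_mult related_inv)

lemma kernel_subset_domain: "K\<^sub>1 \<subseteq> D\<^sub>1"
  by (auto simp: relation_kernel_def relation_domain_def)

lemma subgroup_kernel: "subgroup K\<^sub>1 G"
proof (rule G.subgroupI)
  show "inv\<^bsub>G\<^esub> a \<in> K\<^sub>1" if "a \<in> K\<^sub>1" for a
    using that related_inv[of a "\<one>\<^bsub>H\<^esub>"] by (simp add: relation_kernel_def)
  show "a \<otimes>\<^bsub>G\<^esub> b \<in> K\<^sub>1" if "a \<in> K\<^sub>1" "b \<in> K\<^sub>1" for a b
    using that related_mult[of a "\<one>\<^bsub>H\<^esub>" b "\<one>\<^bsub>H\<^esub>"] by (simp add: relation_kernel_def)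
qed (use related_one in \<open>auto simp: relation_kernel_def\<close>)

lemma subgroup_domain: "subgroup D\<^sub>1 G"
proof (rule G.subgroupI)
  show "inv\<^bsub>G\<^esub> a \<in> D\<^sub>1" if "a \<in> D\<^sub>1" for a
    using that related_inv[of a] by (auto simp: relation_domain_def)
  show "a \<otimes>\<^bsub>G\<^esub> b \<in> D\<^sub>1" if "a \<in> D\<^sub>1" "b \<in> D\<^sub>1" for a b
    using that related_mult[of a _ b] H.m_closed unfolding relation_domain_def by blast
qed (use related_one in \<open>auto simp: relation_domain_def\<close>)

lemma carrier_domain: "carrier (subgroup_generated G D\<^sub>1) = D\<^sub>1"
  using subgroup.carrier_subgroup_generated_subgroup[OF subgroup_domain] .

lemma mem_carrier_domain_iff:
  "a \<in> carrier (subgroup_generated G D\<^sub>1) \<longleftrightarrow> a \<in> carrier G \<and> (\<exists>b\<in>carrier H. L a b)"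
  unfolding carrier_domain by (simp add: relation_domain_def)

lemma kernel_normal: "K\<^sub>1 \<lhd> subgroup_generated G D\<^sub>1"
proof (rule group.normal_invI)
  let ?D = "subgroup_generated G D\<^sub>1"
  show "group ?D" by (rule G.group_subgroup_generated)
  show "subgroup K\<^sub>1 ?D"
    using subgroup_kernel kernel_subset_domain
    by (simp add: G.subgroup_subgroup_generated_iff carrier_domain)
  fix x k assume x: "x \<in> carrier ?D" and k: "k \<in> K\<^sub>1"
  then obtain y where y: "x \<in> carrier G" "y \<in> carrier H" "L x y"
    by (auto simp: mem_carrier_domain_iff)
  then have "L (x \<otimes>\<^bsub>G\<^esub> k \<otimes>\<^bsub>G\<^esub> inv\<^bsub>G\<^esub> x) (y \<otimes>\<^bsub>H\<^esub> \<one>\<^bsub>H\<^esub> \<otimes>\<^bsub>H\<^esub> inv\<^bsub>H\<^esub> y)"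
    using k by (intro related_mult related_inv) (auto simp: relation_kernel_def)
  then show "x \<otimes>\<^bsub>?D\<^esub> k \<otimes>\<^bsub>?D\<^esub> inv\<^bsub>?D\<^esub> x \<in> K\<^sub>1"
    using x y k by (simp add: relation_kernel_def G.inv_subgroup_generated)
qed

interpretation converse: group_relation H G "L\<inverse>\<inverse>"
  by (rule group_relation_converse)

lemma coset_eq_if_related:
  assumes "a \<in> carrier G" "b \<in> carrier H" "b' \<in> carrier H" "L a b" "L a b'"
  shows "K\<^sub>2 #>\<^bsub>H\<^esub> b = K\<^sub>2 #>\<^bsub>H\<^esub> b'"
proof -
  have "L (a \<otimes>\<^bsub>G\<^esub> inv\<^bsub>G\<^esub> a) (b \<otimes>\<^bsub>H\<^esub> inv\<^bsub>H\<^esub> b')"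
    using assms by (intro related_mult related_inv) auto
  then have "b \<otimes>\<^bsub>H\<^esub> inv\<^bsub>H\<^esub> b' \<in> K\<^sub>2" using assms by (simp add: relation_kernel_def)
  then have "b \<in> K\<^sub>2 #>\<^bsub>H\<^esub> b'" using assms by (force simp: r_coset_def H.m_assoc)
  then show ?thesis using H.repr_independence[OF _ _ converse.subgroup_kernel] assms(3) by simp
qed

lemma related_if_coset_eq:
  assumes "a \<in> carrier G" "b \<in> carrier H" "b' \<in> carrier H" "L a b" and coset: "K\<^sub>2 #>\<^bsub>H\<^esub> b = K\<^sub>2 #>\<^bsub>H\<^esub> b'"
  shows "L a b'"
proof -
  have "b' \<in> K\<^sub>2 #>\<^bsub>H\<^esub> b"
    unfolding coset by (rule H.rcos_self[OF assms(3) converse.subgroup_kernel])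
  then obtain k where k: "k \<in> K\<^sub>2" "b' = k \<otimes>\<^bsub>H\<^esub> b" by (auto simp: r_coset_def)
  then have "L (\<one>\<^bsub>G\<^esub> \<otimes>\<^bsub>G\<^esub> a) (k \<otimes>\<^bsub>H\<^esub> b)"
    using assms by (intro related_mult) (auto simp: relation_kernel_def)
  then show ?thesis using assms(1) k(2) by simp
qed

definition related_coset :: "'a \<Rightarrow> 'b set" where
  "related_coset a = K\<^sub>2 #>\<^bsub>H\<^esub> (SOME b. b \<in> carrier H \<and> L a b)"

lemma related_coset_eq:
  assumes "a \<in> carrier G" "b \<in> carrier H" "L a b"
  shows "related_coset a = K\<^sub>2 #>\<^bsub>H\<^esub> b"
proof -
  have choice: "(SOME b. b \<in> carrier H \<and> L a b) \<in> carrier H \<and> L a (SOME b. b \<in> carrier H \<and> L a b)"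
    by (rule someI[of _ b]) (use assms in simp)
  show ?thesis
    unfolding related_coset_def
    by (rule coset_eq_if_related[OF assms(1) conjunct1[OF choice] assms(2) conjunct2[OF choice] assms(3)])
qed

lemma r_coset_subgroup_generated: "A #>\<^bsub>subgroup_generated H B\<^esub> x = A #>\<^bsub>H\<^esub> x"
  by (simp add: r_coset_def)

lemma carrier_factor: "carrier (subgroup_generated H D\<^sub>2 Mod K\<^sub>2) = (\<lambda>b. K\<^sub>2 #>\<^bsub>H\<^esub> b) ` D\<^sub>2"
  by (simp only: carrier_FactGroup converse.carrier_domain r_coset_subgroup_generated)

lemma related_coset_hom:
  "group_hom (subgroup_generated G D\<^sub>1) (subgroup_generated H D\<^sub>2 Mod K\<^sub>2) related_coset"
proof (intro group_hom.intro group_hom_axioms.intro homI)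
  let ?Q = "subgroup_generated H D\<^sub>2 Mod K\<^sub>2"
  interpret normal: normal "K\<^sub>2" "subgroup_generated H D\<^sub>2" by (rule converse.kernel_normal)
  show "group (subgroup_generated G D\<^sub>1)" "group ?Q"
    by (rule G.group_subgroup_generated, rule normal.factorgroup_is_group)
  fix a assume "a \<in> carrier (subgroup_generated G D\<^sub>1)"
  then obtain b where a: "a \<in> carrier G" "b \<in> carrier H" "L a b"
    by (auto simp: mem_carrier_domain_iff)
  then have b: "b \<in> D\<^sub>2" by (auto simp: relation_domain_def)
  show "related_coset a \<in> carrier ?Q"
    unfolding related_coset_eq[OF a] carrier_factor using b by (rule imageI)
  fix a' assume "a' \<in> carrier (subgroup_generated G D\<^sub>1)"
  then obtain b' where a': "a' \<in> carrier G" "b' \<in> carrier H" "L a' b'"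
    by (auto simp: mem_carrier_domain_iff)
  then have b': "b' \<in> D\<^sub>2" by (auto simp: relation_domain_def)
  have "related_coset (a \<otimes>\<^bsub>G\<^esub> a') = K\<^sub>2 #>\<^bsub>H\<^esub> (b \<otimes>\<^bsub>H\<^esub> b')"
    using a a' by (intro related_coset_eq related_mult) auto
  also have "\<dots> = (K\<^sub>2 #>\<^bsub>H\<^esub> b) \<otimes>\<^bsub>?Q\<^esub> (K\<^sub>2 #>\<^bsub>H\<^esub> b')"
    using normal.rcos_sum[of b b'] b b'
    by (simp add: converse.carrier_domain FactGroup_def r_coset_subgroup_generated)
  finally show "related_coset (a \<otimes>\<^bsub>subgroup_generated G D\<^sub>1\<^esub> a') = related_coset a \<otimes>\<^bsub>?Q\<^esub> related_coset a'"
    by (simp add: related_coset_eq[OF a] related_coset_eq[OF a'])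
qed

lemma kernel_related_coset:
  "kernel (subgroup_generated G D\<^sub>1) (subgroup_generated H D\<^sub>2 Mod K\<^sub>2) related_coset = K\<^sub>1"
proof -
  have trivial: "related_coset a = K\<^sub>2 \<longleftrightarrow> L a \<one>\<^bsub>H\<^esub>" if a: "a \<in> carrier G" "b \<in> carrier H" "L a b" for a b
  proof -
    have "K\<^sub>2 #>\<^bsub>H\<^esub> \<one>\<^bsub>H\<^esub> = K\<^sub>2"
      by (rule H.coset_mult_one) (auto simp: relation_kernel_def)
    then show ?thesis
      using related_coset_eq[OF a] related_coset_eq[OF a(1) H.one_closed]
        related_if_coset_eq[OF a(1,2) H.one_closed a(3)]
      by metis
  qed
  show ?thesis
  proof (rule Set.set_eqI)
    show "a \<in> kernel (subgroup_generated G D\<^sub>1) (subgroup_generated H D\<^sub>2 Mod K\<^sub>2) related_coset \<longleftrightarrow>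
        a \<in> K\<^sub>1" for a
      unfolding kernel_def mem_Collect_eq mem_carrier_domain_iff
      using trivial[of a] by (auto simp: FactGroup_def relation_kernel_def[of G])
  qed
qed

lemma surj_related_coset:
  "related_coset ` carrier (subgroup_generated G D\<^sub>1) = carrier (subgroup_generated H D\<^sub>2 Mod K\<^sub>2)"
proof
  show "related_coset ` carrier (subgroup_generated G D\<^sub>1) \<subseteq> carrier (subgroup_generated H D\<^sub>2 Mod K\<^sub>2)"
    using group_hom.hom_closed[OF related_coset_hom] by blast
  show "carrier (subgroup_generated H D\<^sub>2 Mod K\<^sub>2) \<subseteq> related_coset ` carrier (subgroup_generated G D\<^sub>1)"
  proof
    fix X assume "X \<in> carrier (subgroup_generated H D\<^sub>2 Mod K\<^sub>2)"
    then obtain a b where a: "a \<in> carrier G" "b \<in> carrier H" "L a b" and X: "X = K\<^sub>2 #>\<^bsub>H\<^esub> b"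
      unfolding carrier_factor by (auto simp: relation_domain_def)
    then have "a \<in> carrier (subgroup_generated G D\<^sub>1)" by (auto simp: mem_carrier_domain_iff)
    then show "X \<in> related_coset ` carrier (subgroup_generated G D\<^sub>1)"
      unfolding X related_coset_eq[OF a, symmetric] by (rule imageI)
  qed
qed

theorem goursat:
  "\<exists>c. c \<in> iso (subgroup_generated G D\<^sub>1 Mod K\<^sub>1) (subgroup_generated H D\<^sub>2 Mod K\<^sub>2) \<and>
    (\<forall>a\<in>carrier G. \<forall>b\<in>carrier H.
      L a b \<longleftrightarrow> a \<in> D\<^sub>1 \<and> b \<in> D\<^sub>2 \<and> c (K\<^sub>1 #>\<^bsub>G\<^esub> a) = K\<^sub>2 #>\<^bsub>H\<^esub> b)"
proof (intro exI conjI ballI)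
  let ?c = "\<lambda>X. the_elem (related_coset ` X)"
  show "?c \<in> iso (subgroup_generated G D\<^sub>1 Mod K\<^sub>1) (subgroup_generated H D\<^sub>2 Mod K\<^sub>2)"
    using group_hom.FactGroup_iso_set[OF related_coset_hom surj_related_coset]
    unfolding kernel_related_coset .
  have c: "?c (K\<^sub>1 #>\<^bsub>G\<^esub> a) = K\<^sub>2 #>\<^bsub>H\<^esub> b" if a: "a \<in> carrier G" "b \<in> carrier H" "L a b" for a b
  proof -
    have "related_coset (k \<otimes>\<^bsub>G\<^esub> a) = K\<^sub>2 #>\<^bsub>H\<^esub> b" if "k \<in> K\<^sub>1" for k
      using related_coset_eq[of "k \<otimes>\<^bsub>G\<^esub> a" b] related_mult[of k "\<one>\<^bsub>H\<^esub>" a b] a that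
      by (simp add: relation_kernel_def)
    moreover have "K\<^sub>1 \<noteq> {}" using subgroup.one_closed[OF subgroup_kernel] by blast
    ultimately have "related_coset ` (K\<^sub>1 #>\<^bsub>G\<^esub> a) = {K\<^sub>2 #>\<^bsub>H\<^esub> b}" by (auto simp: r_coset_def)
    then show ?thesis by simp
  qed
  fix a b assume ab: "a \<in> carrier G" "b \<in> carrier H"
  show "L a b \<longleftrightarrow> a \<in> D\<^sub>1 \<and> b \<in> D\<^sub>2 \<and> ?c (K\<^sub>1 #>\<^bsub>G\<^esub> a) = K\<^sub>2 #>\<^bsub>H\<^esub> b"
  proof
    show "a \<in> D\<^sub>1 \<and> b \<in> D\<^sub>2 \<and> ?c (K\<^sub>1 #>\<^bsub>G\<^esub> a) = K\<^sub>2 #>\<^bsub>H\<^esub> b" if "L a b"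
      using ab that c[OF ab that] by (auto simp: relation_domain_def)
    assume related: "a \<in> D\<^sub>1 \<and> b \<in> D\<^sub>2 \<and> ?c (K\<^sub>1 #>\<^bsub>G\<^esub> a) = K\<^sub>2 #>\<^bsub>H\<^esub> b"
    then obtain b' where b': "b' \<in> carrier H" "L a b'" by (auto simp: relation_domain_def)
    then have "K\<^sub>2 #>\<^bsub>H\<^esub> b' = K\<^sub>2 #>\<^bsub>H\<^esub> b" using c[OF ab(1) b'] related by simp
    then show "L a b" by (rule related_if_coset_eq[OF ab(1) b'(1) ab(2) b'(2)])
  qed
qed

end

section \<open>Looseness and disjoint representatives\<close>

lemma free_htpc_sym: "free_htpc m N f g \<Longrightarrow> free_htpc m N g f"
  unfolding free_htpc_def by (rule homotopic_with_symD)

lemma loose_commute: "loose m N f g \<longleftrightarrow> loose m N g f"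
  unfolding loose_def by (metis (no_types, lifting))

lemma loose_cls_commute: "loose_cls m N A B \<longleftrightarrow> loose_cls m N B A"
  unfolding loose_cls_def by (metis loose_commute)

lemma loose_cls_converse: "(loose_cls m N)\<inverse>\<inverse> = loose_cls m N"
  by (intro ext) (simp only: conversep_iff, rule loose_cls_commute)

lemma loose_free_htpc:
  assumes "loose m N f g" "free_htpc m N f' f" "free_htpc m N g' g"
  shows "loose m N f' g'"
  using assms free_htpc_trans unfolding loose_def by metis

lemma loose_cls_htp_class:
  assumes "f \<in> based_maps m N b" "g \<in> based_maps m N b'"
  shows "loose_cls m N (htp_class m N b f) (htp_class m N b' g) \<longleftrightarrow> loose m N f g"
proof
  assume "loose_cls m N (htp_class m N b f) (htp_class m N b' g)"
  then obtain f' g' where "loose m N f' g'" "based_htpc m N b f f'" "based_htpc m N b' g g'"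
    unfolding loose_cls_def htp_class_eq by blast
  then show "loose m N f g" using loose_free_htpc based_imp_free_htpc by metis
next
  show "loose m N f g \<Longrightarrow> loose_cls m N (htp_class m N b f) (htp_class m N b' g)"
    unfolding loose_cls_def using assms htp_class_self by metis
qed

definition disjoint_classes ::
  "nat \<Rightarrow> ((nat \<Rightarrow> real) \<Rightarrow> 'a) set \<Rightarrow> ((nat \<Rightarrow> real) \<Rightarrow> 'a) set \<Rightarrow> bool" where
  "disjoint_classes m A B \<longleftrightarrow> (\<exists>f\<in>A. \<exists>g\<in>B. \<forall>x\<in>cube m. f x \<noteq> g x)"

lemma disjoint_classes_sym:
  assumes "disjoint_classes m A B"
  shows "disjoint_classes m B A"
proof -
  obtain f g where "f \<in> A" "g \<in> B" "\<forall>x\<in>cube m. f x \<noteq> g x"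
    using assms unfolding disjoint_classes_def by blast
  moreover from this have "\<forall>x\<in>cube m. g x \<noteq> f x" by auto
  ultimately show ?thesis unfolding disjoint_classes_def by blast
qed

lemma disjoint_classesE:
  assumes "disjoint_classes m (htp_class m N b f) (htp_class m N b' g)"
  obtains f' g' where "f' \<in> based_maps m N b" "based_htpc m N b f f'"
    "g' \<in> based_maps m N b'" "based_htpc m N b' g g'" "\<forall>x\<in>cube m. f' x \<noteq> g' x"
  using assms unfolding disjoint_classes_def htp_class_eq by blast

lemma disjoint_classes_imp_loose_cls:
  assumes A: "A \<in> carrier (homotopy_group m N b)" and B: "B \<in> carrier (homotopy_group m N b')"
    and AB: "disjoint_classes m A B"
  shows "loose_cls m N A B"
proof -
  obtain f g where fg: "f \<in> A" "g \<in> B" "\<forall>x\<in>cube m. f x \<noteq> g x"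
    using AB unfolding disjoint_classes_def by blast
  have "f \<in> based_maps m N b" "g \<in> based_maps m N b'"
    by (rule carrier_memD(1)[OF A fg(1)], rule carrier_memD(1)[OF B fg(2)])
  then have "loose m N f g" unfolding loose_def
    using fg(3) based_map_in_sphere_maps based_imp_free_htpc based_htpc_refl by metis
  then show ?thesis unfolding loose_cls_def using fg(1,2) by blast
qed

lemma base_points_ne_if_disjoint:
  assumes m: "m \<ge> 1" and f: "f \<in> based_maps m N p" and g: "g \<in> based_maps m N q"
    and disjoint: "\<forall>x\<in>cube m. f x \<noteq> g x"
  shows "p \<noteq> q"
  using disjoint based_maps_bd[OF f zero_in_cube_bd[OF m]] based_maps_bd[OF g zero_in_cube_bd[OF m]]
    zero_in_cube
  by metis

text \<open>The first map is transported back along the track of its base point, pushed off the base point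
  of the second map, which stays fixed.\<close>

lemma disjoint_classes_rebase:
  assumes N: "smooth_manifold N TYPE('n::finite)" and n: "CARD('n) \<ge> 2" and m: "m \<ge> 1"
    and f: "f \<in> based_maps m N p" and g: "g \<in> based_maps m N q" and fg: "\<forall>x\<in>cube m. f x \<noteq> g x"
    and f': "f' \<in> based_maps m N b" "free_htpc m N f' f" and b: "b \<noteq> q"
  shows "disjoint_classes m (htp_class m N b f') (htp_class m N q g)"
proof -
  have q: "q \<in> topspace N" by (rule based_maps_base_in_topspace[OF m g])
  obtain \<gamma> where along: "homotopy_along m N \<gamma> f' f" using f'(2) unfolding free_htpc_iff_homotopy_along
    by blast
  have \<gamma>: "pathin N \<gamma>" "\<gamma> 0 = b" "\<gamma> 1 = p" by (rule homotopy_along_path[OF m along f'(1) f])+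
  have "p \<noteq> q" by (rule base_points_ne_if_disjoint[OF m f g fg])
  let ?\<delta> = "\<lambda>s. \<gamma> (1 - s)"
  obtain \<epsilon> where \<epsilon>: "homotopic_with (\<lambda>k. \<forall>s\<in>{0, 1}. k s = ?\<delta> s) (top_of_set {0..1}) N ?\<delta> \<epsilon>" "q \<notin> \<epsilon> ` {0..1}"
    by (rule path_homotopic_avoiding_point[OF N n q pathin_reverse[OF \<gamma>(1)]]) (use \<gamma> b \<open>p \<noteq> q\<close> in auto)
  have \<epsilon>_path: "pathin N \<epsilon>" "\<epsilon> 0 = p" "\<epsilon> 1 = b"
    using homotopic_with_imp_continuous_maps[OF \<epsilon>(1)] homotopic_with_imp_property[OF \<epsilon>(1)] \<gamma>
    by (simp_all add: pathin_def)
  have "based_htpc m N b f' (transport m f ?\<delta>)" by (rule based_htpc_transport_back[OF m along f'(1) f])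
  also have "based_htpc m N b (transport m f ?\<delta>) (transport m f \<epsilon>)"
    using based_htpc_transport_path_homotopy[OF f _ \<epsilon>(1)] \<gamma> by simp
  finally have "transport m f \<epsilon> \<in> htp_class m N b f'"
    using transport_in_based_maps[OF f \<epsilon>_path(1,2)] \<epsilon>_path(3) by (simp add: htp_class_eq)
  moreover have "transport m g (\<lambda>_. q) \<in> htp_class m N q g"
    using transport_in_based_maps[OF g, of "\<lambda>_. q"] based_htpc_transport_const[OF g q] q
    by (simp add: htp_class_eq pathin_def)
  moreover have "\<forall>x\<in>cube m. transport m f \<epsilon> x \<noteq> transport m g (\<lambda>_. q) x"
    using transport_disjoint[of m f g \<epsilon> "\<lambda>_. q"] fg \<epsilon>(2) by (metis imageI)
  ultimately show ?thesis unfolding disjoint_classes_def by blast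
qed

text \<open>Since \<open>b\<^sub>1\<close> may be the base point of \<open>g'\<close>, the latter is first moved out of the way, to \<open>q\<close>.\<close>

lemma disjoint_classes_dim_ge_2:
  assumes N: "smooth_manifold N TYPE('n::finite)" "connected_space N" and n: "CARD('n) \<ge> 2" and m: "m \<ge> 1"
    and b: "b\<^sub>1 \<noteq> b\<^sub>2" and f: "f \<in> based_maps m N b\<^sub>1" "free_htpc m N f f'"
    and g: "g \<in> based_maps m N b\<^sub>2" "free_htpc m N g g'"
    and f': "f' \<in> based_maps m N p\<^sub>1" and g': "g' \<in> based_maps m N p\<^sub>2"
    and disjoint: "\<forall>x\<in>cube m. f' x \<noteq> g' x"
  shows "disjoint_classes m (htp_class m N b\<^sub>1 f) (htp_class m N b\<^sub>2 g)"
proof -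
  note rebase = disjoint_classes_rebase[OF N(1) n m]
  have "infinite (topspace N - {p\<^sub>1, b\<^sub>1})"
    using manifold_infinite[OF N(1) based_maps_base_in_topspace[OF m f']] by simp
  then obtain q where q: "q \<in> topspace N" "q \<noteq> p\<^sub>1" "b\<^sub>1 \<noteq> q"
    by (metis Diff_iff finite.emptyI insertCI equals0I)
  obtain \<eta> where \<eta>: "pathin N \<eta>" "\<eta> 0 = p\<^sub>2" "\<eta> 1 = q"
    by (rule manifold_path_between[OF N based_maps_base_in_topspace[OF m g'] q(1)])
  let ?k = "transport m g' \<eta>"
  have k: "?k \<in> based_maps m N q" "free_htpc m N g' ?k"
    using transport_in_based_maps[OF g' \<eta>(1,2)] free_htpc_transport[OF g' \<eta>(1,2)] \<eta>(3) by simp_all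
  have "disjoint_classes m (htp_class m N q ?k) (htp_class m N p\<^sub>1 f')"
    by (rule rebase[OF g' f' _ k(1) free_htpc_sym[OF k(2)] q(2)]) (use disjoint in metis)
  then obtain g\<^sub>1 f\<^sub>1 where g\<^sub>1: "g\<^sub>1 \<in> based_maps m N q" "based_htpc m N q ?k g\<^sub>1"
    and f\<^sub>1: "f\<^sub>1 \<in> based_maps m N p\<^sub>1" "based_htpc m N p\<^sub>1 f' f\<^sub>1" and "\<forall>x\<in>cube m. g\<^sub>1 x \<noteq> f\<^sub>1 x"
    by (rule disjoint_classesE)
  then have "disjoint_classes m (htp_class m N b\<^sub>1 f) (htp_class m N q g\<^sub>1)"
    using rebase[OF f\<^sub>1(1) g\<^sub>1(1) _ f(1) free_htpc_trans[OF f(2) based_imp_free_htpc[OF f\<^sub>1(2)]] q(3)]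
    by metis
  then obtain f\<^sub>2 g\<^sub>2 where f\<^sub>2: "f\<^sub>2 \<in> based_maps m N b\<^sub>1" "based_htpc m N b\<^sub>1 f f\<^sub>2"
    and g\<^sub>2: "g\<^sub>2 \<in> based_maps m N q" "based_htpc m N q g\<^sub>1 g\<^sub>2" and disjoint\<^sub>2: "\<forall>x\<in>cube m. f\<^sub>2 x \<noteq> g\<^sub>2 x"
    by (rule disjoint_classesE)
  have "free_htpc m N g g\<^sub>2"
    using g(2) k(2) based_imp_free_htpc[OF based_htpc_trans[OF g\<^sub>1(2) g\<^sub>2(2)]] free_htpc_trans by metis
  then have "disjoint_classes m (htp_class m N b\<^sub>2 g) (htp_class m N b\<^sub>1 f\<^sub>2)"
    using rebase[OF g\<^sub>2(1) f\<^sub>2(1) _ g(1)] disjoint\<^sub>2 b by metis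
  from disjoint_classes_sym[OF this] show ?thesis unfolding htp_class_eqI[OF f\<^sub>2(2)] .
qed

lemma disjoint_classes_circle:
  assumes N: "N homeomorphic_space unit_circle" and m: "m \<ge> 1"
    and b: "b\<^sub>1 \<noteq> b\<^sub>2" and f: "f \<in> based_maps m N b\<^sub>1" "free_htpc m N f f'"
    and g: "g \<in> based_maps m N b\<^sub>2" "free_htpc m N g g'"
    and f': "f' \<in> based_maps m N p\<^sub>1" and g': "g' \<in> based_maps m N p\<^sub>2"
    and disjoint: "\<forall>x\<in>cube m. f' x \<noteq> g' x"
  shows "disjoint_classes m (htp_class m N b\<^sub>1 f) (htp_class m N b\<^sub>2 g)"
proof -
  note in_topspace = based_maps_base_in_topspace[OF m]
  have "p\<^sub>1 \<noteq> p\<^sub>2" by (rule base_points_ne_if_disjoint[OF m f' g' disjoint])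
  then obtain \<delta> \<epsilon> where \<delta>: "pathin N \<delta>" "\<delta> 0 = p\<^sub>1" "\<delta> 1 = b\<^sub>1" and \<epsilon>: "pathin N \<epsilon>" "\<epsilon> 0 = p\<^sub>2" "\<epsilon> 1 = b\<^sub>2"
    and \<delta>\<epsilon>: "\<And>t. t \<in> {0..1} \<Longrightarrow> \<delta> t \<noteq> \<epsilon> t"
    by (rule circle_disjoint_paths[OF N in_topspace[OF f'] in_topspace[OF g']
        in_topspace[OF f(1)] in_topspace[OF g(1)] _ b]) (rule that)
  have based: "transport m f' \<delta> \<in> based_maps m N b\<^sub>1" "transport m g' \<epsilon> \<in> based_maps m N b\<^sub>2"
    using transport_in_based_maps[OF f' \<delta>(1,2)] transport_in_based_maps[OF g' \<epsilon>(1,2)] \<delta>(3) \<epsilon>(3) by simp_all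
  have "transport m f' \<delta> \<in> htp_class m N b\<^sub>1 f" "transport m g' \<epsilon> \<in> htp_class m N b\<^sub>2 g"
    using circle_free_imp_based_htpc[OF N m f(1) based(1) free_htpc_trans[OF f(2)]]
      circle_free_imp_based_htpc[OF N m g(1) based(2) free_htpc_trans[OF g(2)]]
      free_htpc_transport[OF f' \<delta>(1,2)] free_htpc_transport[OF g' \<epsilon>(1,2)] based
    by (simp_all add: htp_class_eq)
  moreover have "\<forall>x\<in>cube m. transport m f' \<delta> x \<noteq> transport m g' \<epsilon> x"
    using transport_disjoint[of m f' g' \<delta> \<epsilon>] disjoint \<delta>\<epsilon> by blast
  ultimately show ?thesis unfolding disjoint_classes_def by blast
qed

lemma disjoint_classes_not_circle:
  assumes N: "smooth_manifold N TYPE('n::finite)" "connected_space N" "CARD('n) = 1"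
      "\<not> N homeomorphic_space unit_circle" and m: "m \<ge> 1"
    and b: "b\<^sub>1 \<noteq> b\<^sub>2" and f: "f \<in> based_maps m N b\<^sub>1" and g: "g \<in> based_maps m N b\<^sub>2"
  shows "disjoint_classes m (htp_class m N b\<^sub>1 f) (htp_class m N b\<^sub>2 g)"
proof -
  have "(\<lambda>x\<in>cube m. b) \<in> htp_class m N b f" if "f \<in> based_maps m N b" for f b
    using null_htpc_dim_1[OF N m that] const_in_based_maps[OF based_maps_base_in_topspace[OF m that]]
    by (simp add: htp_class_eq)
  from this[OF f] this[OF g] b show ?thesis
    unfolding disjoint_classes_def by (intro bexI[of _ "\<lambda>x\<in>cube m. b\<^sub>1"] bexI[of _ "\<lambda>x\<in>cube m. b\<^sub>2"]) auto
qed

lemma loose_cls_iff_disjoint_classes: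
  assumes N: "smooth_manifold N TYPE('n::finite)" "connected_space N" and m: "m \<ge> 1" and b: "b\<^sub>1 \<noteq> b\<^sub>2"
    and A: "A \<in> carrier (homotopy_group m N b\<^sub>1)" and B: "B \<in> carrier (homotopy_group m N b\<^sub>2)"
  shows "loose_cls m N A B \<longleftrightarrow> disjoint_classes m A B"
proof
  assume "loose_cls m N A B"
  then obtain f g f' g' where fg: "f \<in> A" "g \<in> B" and f': "f' \<in> sphere_maps m N" "free_htpc m N f f'"
    and g': "g' \<in> sphere_maps m N" "free_htpc m N g g'" and disjoint: "\<forall>x\<in>cube m. f' x \<noteq> g' x"
    unfolding loose_cls_def loose_def by blast
  have f: "f \<in> based_maps m N b\<^sub>1" "A = htp_class m N b\<^sub>1 f" by (rule carrier_memD[OF A fg(1)])+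
  have g: "g \<in> based_maps m N b\<^sub>2" "B = htp_class m N b\<^sub>2 g" by (rule carrier_memD[OF B fg(2)])+
  obtain p\<^sub>1 p\<^sub>2 where p: "f' \<in> based_maps m N p\<^sub>1" "g' \<in> based_maps m N p\<^sub>2"
    using sphere_maps_imp_based f'(1) g'(1) by blast
  consider "CARD('n) \<ge> 2" | "CARD('n) = 1" using zero_less_card_finite[where 'a = 'n] by linarith
  then show "disjoint_classes m A B" unfolding f(2) g(2)
  proof cases
    case 1
    then show "disjoint_classes m (htp_class m N b\<^sub>1 f) (htp_class m N b\<^sub>2 g)"
      by (rule disjoint_classes_dim_ge_2[OF N _ m b f(1) f'(2) g(1) g'(2) p disjoint])
  next
    case 2
    then show "disjoint_classes m (htp_class m N b\<^sub>1 f) (htp_class m N b\<^sub>2 g)"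
      using disjoint_classes_circle[OF _ m b f(1) f'(2) g(1) g'(2) p disjoint]
        disjoint_classes_not_circle[OF N _ _ m b f(1) g(1)] by blast
  qed
qed (rule disjoint_classes_imp_loose_cls[OF A B])

section \<open>Looseness as a relation between homotopy groups\<close>

lemma disjoint_classes_mult:
  assumes m: "m \<ge> 1"
    and A: "A \<in> carrier (homotopy_group m N b)" "A' \<in> carrier (homotopy_group m N b)"
    and B: "B \<in> carrier (homotopy_group m N b')" "B' \<in> carrier (homotopy_group m N b')"
    and disjoint: "disjoint_classes m A B" "disjoint_classes m A' B'"
  shows "disjoint_classes m (A \<otimes>\<^bsub>homotopy_group m N b\<^esub> A') (B \<otimes>\<^bsub>homotopy_group m N b'\<^esub> B')"
proof -
  obtain f g f' g' where fg: "f \<in> A" "g \<in> B" "\<forall>x\<in>cube m. f x \<noteq> g x"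
    and fg': "f' \<in> A'" "g' \<in> B'" "\<forall>x\<in>cube m. f' x \<noteq> g' x"
    using disjoint unfolding disjoint_classes_def by blast
  note f = carrier_memD[OF A(1) fg(1)] carrier_memD[OF A(2) fg'(1)]
  note g = carrier_memD[OF B(1) fg(2)] carrier_memD[OF B(2) fg'(2)]
  have "concat_cube m f f' \<in> A \<otimes>\<^bsub>homotopy_group m N b\<^esub> A'"
    unfolding f(2,4) htp_class_mult[OF m f(1,3)]
    by (rule htp_class_self[OF concat_in_based_maps[OF m f(1,3)]])
  moreover have "concat_cube m g g' \<in> B \<otimes>\<^bsub>homotopy_group m N b'\<^esub> B'"
    unfolding g(2,4) htp_class_mult[OF m g(1,3)]
    by (rule htp_class_self[OF concat_in_based_maps[OF m g(1,3)]])
  moreover have "concat_cube m f f' x \<noteq> concat_cube m g g' x" if x: "x \<in> cube m" for x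
    using fg(3) fg'(3) cube_coord_bounds[OF m x] cube_upd[OF m x] by (simp add: concat_cube_apply[OF x])
  ultimately show ?thesis unfolding disjoint_classes_def by blast
qed

lemma disjoint_classes_inv:
  assumes m: "m \<ge> 1" and A: "A \<in> carrier (homotopy_group m N b)"
    and B: "B \<in> carrier (homotopy_group m N b')"
    and disjoint: "disjoint_classes m A B"
  shows "disjoint_classes m (inv\<^bsub>homotopy_group m N b\<^esub> A) (inv\<^bsub>homotopy_group m N b'\<^esub> B)"
proof -
  obtain f g where fg: "f \<in> A" "g \<in> B" "\<forall>x\<in>cube m. f x \<noteq> g x"
    using disjoint unfolding disjoint_classes_def by blast
  note f = carrier_memD[OF A fg(1)] and g = carrier_memD[OF B fg(2)]
  have "rev_cube m f \<in> inv\<^bsub>homotopy_group m N b\<^esub> A"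
    unfolding f(2) htp_class_inv[OF m f(1)] by (rule htp_class_self[OF rev_in_based_maps[OF m f(1)]])
  moreover have "rev_cube m g \<in> inv\<^bsub>homotopy_group m N b'\<^esub> B"
    unfolding g(2) htp_class_inv[OF m g(1)] by (rule htp_class_self[OF rev_in_based_maps[OF m g(1)]])
  moreover have "rev_cube m f x \<noteq> rev_cube m g x" if x: "x \<in> cube m" for x
    using fg(3) cube_coord_bounds[OF m x] cube_upd[OF m x] x by (simp add: rev_cube_def)
  ultimately show ?thesis unfolding disjoint_classes_def by blast
qed

lemma group_relation_loose_cls:
  assumes N: "smooth_manifold N TYPE('n::finite)" "connected_space N" and m: "m \<ge> 1"
    and b: "b\<^sub>1 \<in> topspace N" "b\<^sub>2 \<in> topspace N" "b\<^sub>1 \<noteq> b\<^sub>2"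
  shows "group_relation (homotopy_group m N b\<^sub>1) (homotopy_group m N b\<^sub>2) (loose_cls m N)"
proof -
  let ?G = "homotopy_group m N b\<^sub>1" and ?H = "homotopy_group m N b\<^sub>2"
  interpret G: group ?G by (rule group_homotopy_group[OF m b(1)])
  interpret H: group ?H by (rule group_homotopy_group[OF m b(2)])
  note loose_iff = loose_cls_iff_disjoint_classes[OF N m b(3)]
  show ?thesis
  proof
    have "(\<lambda>x\<in>cube m. b\<^sub>1) \<in> \<one>\<^bsub>?G\<^esub>" "(\<lambda>x\<in>cube m. b\<^sub>2) \<in> \<one>\<^bsub>?H\<^esub>"
      using b by (simp_all add: homotopy_group_one htp_class_self const_in_based_maps)
    moreover have "\<forall>x\<in>cube m. (\<lambda>x\<in>cube m. b\<^sub>1) x \<noteq> (\<lambda>x\<in>cube m. b\<^sub>2) x" using b(3) by simp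
    ultimately show "loose_cls m N \<one>\<^bsub>?G\<^esub> \<one>\<^bsub>?H\<^esub>"
      unfolding loose_iff[OF G.one_closed H.one_closed] disjoint_classes_def by blast
  next
    fix A B A' B' assume "A \<in> carrier ?G" "B \<in> carrier ?H" "A' \<in> carrier ?G" "B' \<in> carrier ?H"
      "loose_cls m N A B" "loose_cls m N A' B'"
    then show "loose_cls m N (A \<otimes>\<^bsub>?G\<^esub> A') (B \<otimes>\<^bsub>?H\<^esub> B')"
      using disjoint_classes_mult[OF m, of A N b\<^sub>1 A' B b\<^sub>2 B'] by (simp add: loose_iff)
  next
    fix A B assume "A \<in> carrier ?G" "B \<in> carrier ?H" "loose_cls m N A B"
    then show "loose_cls m N (inv\<^bsub>?G\<^esub> A) (inv\<^bsub>?H\<^esub> B)"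
      using disjoint_classes_inv[OF m, of A N b\<^sub>1 B b\<^sub>2] by (simp add: loose_iff)
  qed
qed

lemma pi_c_eq_relation_kernel:
  assumes "b' \<in> topspace N"
  shows "pi_c m N b b' = relation_kernel (homotopy_group m N b) (homotopy_group m N b') (loose_cls m N)"
proof -
  have "loose_cls m N (htp_class m N b f) {\<lambda>x\<in>cube m. b'} \<longleftrightarrow>
      loose_cls m N (htp_class m N b f) (htp_class m N b' (\<lambda>x\<in>cube m. b'))"
    if f: "f \<in> based_maps m N b" for f
  proof -
    have "loose m N f (\<lambda>x\<in>cube m. b')" if "f' \<in> htp_class m N b f" "loose m N f' (\<lambda>x\<in>cube m. b')" for f'
      using that loose_free_htpc[OF that(2) based_imp_free_htpc] based_imp_free_htpc[OF based_htpc_refl]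
        const_in_based_maps[OF assms] by (metis (no_types, lifting) htp_class_eq mem_Collect_eq)
    then show ?thesis
      unfolding loose_cls_htp_class[OF f const_in_based_maps[OF assms]]
      using htp_class_self[OF f] by (auto simp: loose_cls_def)
  qed
  then show ?thesis
    unfolding pi_c_def relation_kernel_def homotopy_group_one by (auto simp: homotopy_group_carrier)
qed

lemma pi_2_eq_relation_domain:
  "pi_2 m N b b' = relation_domain (homotopy_group m N b) (homotopy_group m N b') (loose_cls m N)"
  by (simp add: pi_2_def relation_domain_def)

lemma free_htpc_const:
  assumes "pathin N \<eta>"
  shows "free_htpc m N (\<lambda>x\<in>cube m. \<eta> 0) (\<lambda>x\<in>cube m. \<eta> 1)"
proof -
  have "continuous_map (top_of_set ({0..1::real} \<times> cube m)) N (\<lambda>z. \<eta> (fst z))"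
    by (rule continuous_map_compose_continuous_on[OF assms[unfolded pathin_def]])
      (auto intro!: continuous_intros)
  then have "homotopy_along m N \<eta> (\<lambda>x\<in>cube m. \<eta> 0) (\<lambda>x\<in>cube m. \<eta> 1)"
    unfolding homotopy_along_def by (intro exI[of _ "\<lambda>z. \<eta> (fst z)"]) auto
  then show ?thesis unfolding free_htpc_iff_homotopy_along by blast
qed

lemma loose_const_if_missing_point:
  assumes N: "smooth_manifold N TYPE('n::finite)" "connected_space N"
    and g: "g \<in> based_maps m N b" "based_htpc m N b f g" and q: "q \<in> topspace N" "q \<notin> g ` cube m"
    and p: "p \<in> topspace N"
  shows "loose m N f (\<lambda>x\<in>cube m. p)"
proof -
  obtain \<eta> where "pathin N \<eta>" "\<eta> 0 = p" "\<eta> 1 = q" by (rule manifold_path_between[OF N p q(1)])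
  then have "free_htpc m N (\<lambda>x\<in>cube m. p) (\<lambda>x\<in>cube m. q)" using free_htpc_const by blast
  moreover have "(\<lambda>x\<in>cube m. q) \<in> sphere_maps m N"
    by (rule based_map_in_sphere_maps[OF const_in_based_maps[OF q(1)]])
  moreover have "\<forall>x\<in>cube m. g x \<noteq> (\<lambda>x\<in>cube m. q) x" using q(2) by auto
  ultimately show ?thesis
    unfolding loose_def using based_map_in_sphere_maps[OF g(1)] based_imp_free_htpc[OF g(2)] by blast
qed

lemma pi_c_eq_carrier:
  assumes N: "smooth_manifold N TYPE('n::finite)" "connected_space N"
    and b: "b \<in> topspace N" "b' \<in> topspace N" "b \<noteq> b'"
    and room: "\<not> compact_space N \<or> m < CARD('n)"
  shows "pi_c m N b b' = carrier (homotopy_group m N b)"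
proof -
  have "loose m N f (\<lambda>x\<in>cube m. b')" if f: "f \<in> based_maps m N b" for f
    using room
  proof
    assume "\<not> compact_space N"
    then have "f ` cube m \<noteq> topspace N" using compactin_based_map_image[OF f]
      by (auto simp: compact_space_def)
    then obtain q where "q \<in> topspace N" "q \<notin> f ` cube m"
      using compactin_subset_topspace[OF compactin_based_map_image[OF f]] by blast
    then show ?thesis by (rule loose_const_if_missing_point[OF N f based_htpc_refl[OF f] _ _ b(2)])
  next
    assume m: "m < CARD('n)"
    obtain g where g: "g \<in> based_maps m N b" "based_htpc m N b f g" "b' \<notin> g ` cube m"
      by (rule based_htpc_avoiding_point[OF N(1) m b(2) f b(3)])
    then show ?thesis by (rule loose_const_if_missing_point[OF N _ _ b(2) _ b(2)])
  qed
  then show ?thesis unfolding pi_c_def loose_cls_def using htp_class_self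
    by (fastforce simp: homotopy_group_carrier)
qed

lemma all_loose_if_pi_c_eq_carrier:
  assumes N: "smooth_manifold N TYPE('n::finite)" "connected_space N" and m: "m \<ge> 1"
    and b: "b\<^sub>1 \<in> topspace N" "b\<^sub>2 \<in> topspace N" "b\<^sub>1 \<noteq> b\<^sub>2"
    and full: "pi_c m N b\<^sub>1 b\<^sub>2 = carrier (homotopy_group m N b\<^sub>1)"
      "pi_c m N b\<^sub>2 b\<^sub>1 = carrier (homotopy_group m N b\<^sub>2)"
    and f: "f\<^sub>1 \<in> sphere_maps m N" "f\<^sub>2 \<in> sphere_maps m N"
  shows "loose m N f\<^sub>1 f\<^sub>2"
proof -
  let ?G = "homotopy_group m N b\<^sub>1" and ?H = "homotopy_group m N b\<^sub>2"
  interpret group_relation ?G ?H "loose_cls m N" by (rule group_relation_loose_cls[OF N m b])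
  have rebase: "\<exists>g. g \<in> based_maps m N b \<and> free_htpc m N f g"
    if "f \<in> sphere_maps m N" "b \<in> topspace N" for f b
  proof -
    obtain p where p: "f \<in> based_maps m N p" using sphere_maps_imp_based[OF \<open>f \<in> sphere_maps m N\<close>] by blast
    obtain \<delta> where \<delta>: "pathin N \<delta>" "\<delta> 0 = p" "\<delta> 1 = b"
      by (rule manifold_path_between[OF N based_maps_base_in_topspace[OF m p] \<open>b \<in> topspace N\<close>])
    then show ?thesis using transport_in_based_maps[OF p \<delta>(1,2)] free_htpc_transport[OF p \<delta>(1,2)] by blast
  qed
  obtain g\<^sub>1 g\<^sub>2 where g: "g\<^sub>1 \<in> based_maps m N b\<^sub>1" "g\<^sub>2 \<in> based_maps m N b\<^sub>2" "free_htpc m N f\<^sub>1 g\<^sub>1"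
    "free_htpc m N f\<^sub>2 g\<^sub>2"
    using rebase[OF f(1) b(1)] rebase[OF f(2) b(2)] by blast
  let ?A = "htp_class m N b\<^sub>1 g\<^sub>1" and ?B = "htp_class m N b\<^sub>2 g\<^sub>2"
  have A: "?A \<in> carrier ?G" and B: "?B \<in> carrier ?H" using g by (simp_all add: htp_class_in_carrier)
  have "loose_cls m N ?A \<one>\<^bsub>?H\<^esub>" "loose_cls m N ?B \<one>\<^bsub>?G\<^esub>"
    using A B unfolding full[symmetric] pi_c_eq_relation_kernel[OF b(1)] pi_c_eq_relation_kernel[OF b(2)]
    by (simp_all add: relation_kernel_def)
  then have "loose_cls m N ?A \<one>\<^bsub>?H\<^esub>" "loose_cls m N \<one>\<^bsub>?G\<^esub> ?B"
    by (simp_all only: loose_cls_commute[of m N ?B])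
  then have "loose_cls m N (?A \<otimes>\<^bsub>?G\<^esub> \<one>\<^bsub>?G\<^esub>) (\<one>\<^bsub>?H\<^esub> \<otimes>\<^bsub>?H\<^esub> ?B)" using A B by (intro related_mult) auto
  then have "loose m N g\<^sub>1 g\<^sub>2" using A B by (simp add: loose_cls_htp_class[OF g(1,2)])
  then show ?thesis using g(3,4) by (rule loose_free_htpc)
qed

theorem theorem1p18:
  fixes N :: "'a topology" and m :: nat and b1 b2 :: 'a
  assumes "smooth_manifold N TYPE('n::finite)"
    and "connected_space N"
    and "m \<ge> 1"
    and "b1 \<in> topspace N" and "b2 \<in> topspace N" and "b1 \<noteq> b2"
  defines "G1 \<equiv> homotopy_group m N b1" and "G2 \<equiv> homotopy_group m N b2"
    and "C1 \<equiv> pi_c m N b1 b2" and "C2 \<equiv> pi_c m N b2 b1"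
    and "P1 \<equiv> pi_2 m N b1 b2" and "P2 \<equiv> pi_2 m N b2 b1"
  shows
    "group G1 \<and> group G2 \<and>
     C1 \<subseteq> P1 \<and> subgroup C1 G1 \<and> subgroup P1 G1 \<and>
     C2 \<subseteq> P2 \<and> subgroup C2 G2 \<and> subgroup P2 G2 \<and>
     C1 \<lhd> subgroup_generated G1 P1 \<and> C2 \<lhd> subgroup_generated G2 P2 \<and>
     (\<exists>c. c \<in> iso (subgroup_generated G1 P1 Mod C1) (subgroup_generated G2 P2 Mod C2) \<and>
          (\<forall>A\<in>P1. \<forall>B\<in>P2. loose_cls m N A B \<longrightarrow> c (C1 #>\<^bsub>G1\<^esub> A) = C2 #>\<^bsub>G2\<^esub> B) \<and>
          (\<forall>A\<in>carrier G1. \<forall>B\<in>carrier G2.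
              loose_cls m N A B \<longleftrightarrow>
              (A \<in> P1 \<and> B \<in> P2 \<and> c (C1 #>\<^bsub>G1\<^esub> A) = C2 #>\<^bsub>G2\<^esub> B))) \<and>
     ((C1 = carrier G1 \<and> C2 = carrier G2) \<longrightarrow>
        (\<forall>f1\<in>sphere_maps m N. \<forall>f2\<in>sphere_maps m N. loose m N f1 f2)) \<and>
     ((\<not> compact_space N \<or> m < CARD('n)) \<longrightarrow> C1 = carrier G1 \<and> C2 = carrier G2)"
proof -
  note N = assms(1,2) and b = assms(4-6)
  interpret R: group_relation G1 G2 "loose_cls m N"
    unfolding G1_def G2_def by (rule group_relation_loose_cls[OF N assms(3) b])
  interpret R': group_relation G2 G1 "loose_cls m N"
    using R.group_relation_converse by (simp only: loose_cls_converse)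
  have C: "C1 = relation_kernel G1 G2 (loose_cls m N)" "C2 = relation_kernel G2 G1 (loose_cls m N)"
    unfolding C1_def C2_def G1_def G2_def
    by (rule pi_c_eq_relation_kernel[OF b(2)], rule pi_c_eq_relation_kernel[OF b(1)])
  have P: "P1 = relation_domain G1 G2 (loose_cls m N)" "P2 = relation_domain G2 G1 (loose_cls m N)"
    unfolding P1_def P2_def G1_def G2_def by (rule pi_2_eq_relation_domain)+
  have P_carrier: "P1 \<subseteq> carrier G1" "P2 \<subseteq> carrier G2" unfolding P relation_domain_def by auto
  obtain c where c: "c \<in> iso (subgroup_generated G1 P1 Mod C1) (subgroup_generated G2 P2 Mod C2)"
    "\<forall>A\<in>carrier G1. \<forall>B\<in>carrier G2.
      loose_cls m N A B \<longleftrightarrow> A \<in> P1 \<and> B \<in> P2 \<and> c (C1 #>\<^bsub>G1\<^esub> A) = C2 #>\<^bsub>G2\<^esub> B"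
    using R.goursat unfolding loose_cls_converse C P by blast
  moreover have "C1 \<subseteq> P1" "subgroup C1 G1" "subgroup P1 G1" "C1 \<lhd> subgroup_generated G1 P1"
    unfolding C P by (rule R.kernel_subset_domain R.subgroup_kernel R.subgroup_domain R.kernel_normal)+
  moreover have "C2 \<subseteq> P2" "subgroup C2 G2" "subgroup P2 G2" "C2 \<lhd> subgroup_generated G2 P2"
    unfolding C P by (rule R'.kernel_subset_domain R'.subgroup_kernel R'.subgroup_domain R'.kernel_normal)+
  moreover have "loose m N f1 f2"
    if "C1 = carrier G1" "C2 = carrier G2" "f1 \<in> sphere_maps m N" "f2 \<in> sphere_maps m N" for f1 f2
    using all_loose_if_pi_c_eq_carrier[OF N assms(3) b] that unfolding C1_def C2_def G1_def G2_def by blast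
  moreover have "C1 = carrier G1" "C2 = carrier G2" if "\<not> compact_space N \<or> m < CARD('n)"
    unfolding C1_def C2_def G1_def G2_def
    using pi_c_eq_carrier[OF N b that] pi_c_eq_carrier[OF N b(2,1) b(3)[symmetric] that] by simp_all
  ultimately show ?thesis using R.G.group_axioms R.H.group_axioms P_carrier by blast
qed

end
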